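(* Let $\mathbb{P}^{\rm I}=\mathbb{P}^3\setminus\ell_\infty$ with $\ell_\infty=\{z=w=0\}$. There is an isomorphism $$H^1(\mathbb{P}^{\rm I},\mathcal{O}_{\mathbb{P}^{\rm I}}(-2))\otimes_{\mathbb{C}}\mathbb{C}(q)\ \xrightarrow{\ \simeq\ }\ \ker\square_x\subset\mathfrak{M}^{\rm I}$$ given by the integral formula $$f(x,y,z,w)\longmapsto\frac{1}{2\pi i}\oint f(x_{11}s+x_{21},\,x_{12}s+x_{22},\,s,\,1)\,ds,$$ where $f$ represents a cocycle in $H^1(\mathbb{P}^{\rm I},\mathcal{O}_{\mathbb{P}^{\rm I}}(-2))$, that is, $f$ is a linear combination of the Laurent monomials $$\frac{x^{l-m}y^{l+m}}{z^{l-n+1}w^{l+n+1}},\qquad l\in\tfrac12\mathbb{Z}_{\geq 0},\ -l\leq n,m\leq l,\ n,m\equiv l\pmod 1 .$$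
   Context: $\mathbb{P}^3$ has homogeneous coordinates $[x:y:z:w]$; $H^1(\mathbb{P}^{\rm I},\mathcal{O}(-2))$ is computed as Čech cohomology for the cover of $\mathbb{P}^{\rm I}$ by $\{z\neq0\}$ and $\{w\neq0\}$, in which the listed Laurent monomials represent a natural basis. $q$ is a formal parameter; all algebras are over $\mathbb{C}(q)$, and $p\in\{q,q^{-1}\}$ is fixed. $\mathfrak{M}^{\rm I}$ is the algebra generated by $x_{11},x_{12},x_{21},x_{22}$ with relations $$x_{11}x_{12}=x_{12}x_{11},\quad x_{21}x_{22}=x_{22}x_{21},\quad [x_{11},x_{22}]+[x_{21},x_{12}]=0,$$ $$x_{11}x_{21}=q^{-2}x_{21}x_{11},\quad x_{12}x_{22}=q^{-2}x_{22}x_{12},\quad x_{21}x_{12}=q^{2}x_{12}x_{21}.$$ The variable $s$ commutes with the generators, and $x_{11}s+x_{21}$ commutes with $x_{12}s+x_{22}$. The contour integral is around $s=0$, i.e. $\frac{1}{2\pi i}\oint(\cdot)\,ds$ extracts the coefficient of $s^{-1}$. Differential calculus: let $R_{11,11}=R_{22,22}=p^{-1}$, $R_{12,12}=q$, $R_{21,21}=q^{-1}$, $R_{12,21}=p^{-1}-q^{-1}$, $R_{21,12}=p^{-1}-q$, and all other $R_{ij,mn}=0$ ($i,j,m,n\in\{1,2\}$). The module of 1-forms $\Omega^1$ is the $\mathfrak{M}^{\rm I}$-bimodule generated by $dx_{11},dx_{12},dx_{21},dx_{22}$ with relations $$dx_{jl}\,x_{ik}=\sum_{m,n,a,b\in\{1,2\}}R_{ij,mn}\,R_{ba,lk}\;x_{ma}\,dx_{nb};$$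 it is free as a left module on the $dx_{rs}$. The de Rham operator $d:\mathfrak{M}^{\rm I}\to\Omega^1$ is the linear map with $x_{rs}\mapsto dx_{rs}$ and $d(fg)=(df)g+f\,dg$. The quantum partial derivatives are defined by $df=\sum_{r,s}(\partial_{rs}f)\,dx_{rs}$, and the quantum Laplacian is $\square_x=\partial_{11}\partial_{22}-\partial_{21}\partial_{12}$. *)

theory Defs
  imports
    Complex_Main
    "HOL-Computational_Algebra.Polynomial"
    "HOL-Computational_Algebra.Fraction_Field"
    "HOL-Library.Poly_Mapping"
begin

section \<open>The ground field\<close>

type_synonym cq = "complex poly fract"

definition cq_of_complex :: "complex \<Rightarrow> cq" where
  "cq_of_complex c = Fract [:c:] 1"

definition q :: cq where
  "q = Fract [:0, 1:] 1"


section \<open>Generated additive subgroups\<close>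

inductive_set subgroup_gen :: "'a::ab_group_add set \<Rightarrow> 'a set" for S where
  base: "a \<in> S \<Longrightarrow> a \<in> subgroup_gen S"
| zero: "0 \<in> subgroup_gen S"
| diff: "a \<in> subgroup_gen S \<Longrightarrow> b \<in> subgroup_gen S \<Longrightarrow> a - b \<in> subgroup_gen S"

lemma subgroup_gen_uminus: "a \<in> subgroup_gen S \<Longrightarrow> - a \<in> subgroup_gen S"
  using subgroup_gen.diff[OF subgroup_gen.zero] by fastforce

lemma subgroup_gen_add:
  "a \<in> subgroup_gen S \<Longrightarrow> b \<in> subgroup_gen S \<Longrightarrow> a + b \<in> subgroup_gen S"
  using subgroup_gen.diff[OF _ subgroup_gen_uminus] by fastforce

lemma subgroup_gen_hom:
  fixes h :: "'a::ab_group_add \<Rightarrow> 'b::ab_group_add"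
  assumes "a \<in> subgroup_gen S" and "\<And>u v. h (u - v) = h u - h v"
    and "\<And>u. u \<in> S \<Longrightarrow> h u \<in> subgroup_gen T"
  shows "h a \<in> subgroup_gen T"
  using assms(1)
proof (induction rule: subgroup_gen.induct)
  case (base a)
  then show ?case by (rule assms(3))
next
  case zero
  then show ?case using assms(2)[of 0 0] by (simp add: subgroup_gen.zero)
next
  case (diff a b)
  then show ?case by (simp add: assms(2) subgroup_gen.diff)
qed

lemma equivp_subgroup_gen: "equivp (\<lambda>a b. a - b \<in> subgroup_gen S)"
proof (rule equivpI)
  show "reflp (\<lambda>a b. a - b \<in> subgroup_gen S)"
    by (simp add: reflp_def subgroup_gen.zero)
  show "symp (\<lambda>a b. a - b \<in> subgroup_gen S)"
    using subgroup_gen_uminus by (fastforce simp: symp_def)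
  show "transp (\<lambda>a b. a - b \<in> subgroup_gen S)"
    using subgroup_gen_add by (fastforce simp: transp_def)
qed


section \<open>The algebra of quantum Minkowski space\<close>

datatype idx = I1 | I2

lemma UNIV_idx: "UNIV = {I1, I2}"
  using idx.exhaust by auto

instance idx :: finite
  by standard (simp add: UNIV_idx)

text \<open>Words in the generators form a free monoid, written additively so that finitely
  supported functions on words become the free algebra under convolution.\<close>

datatype mword = MWord (letters: "(idx \<times> idx) list")

instantiation mword :: monoid_add
begin

definition zero_mword :: mword where
  "0 = MWord []"

definition plus_mword :: "mword \<Rightarrow> mword \<Rightarrow> mword" where
  "u + v = MWord (letters u @ letters v)"

instance
  by standard (simp_all add: zero_mword_def plus_mword_def)

end

type_synonym free_alg = "mword \<Rightarrow>\<^sub>0 cq"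

definition free_x :: "idx \<Rightarrow> idx \<Rightarrow> free_alg" where
  "free_x i j = Poly_Mapping.single (MWord [(i, j)]) 1"

definition free_const :: "cq \<Rightarrow> free_alg" where
  "free_const c = Poly_Mapping.single 0 c"

definition mink_relators :: "free_alg set" where
  "mink_relators =
    (let x11 = free_x I1 I1; x12 = free_x I1 I2; x21 = free_x I2 I1; x22 = free_x I2 I2;
         q2 = free_const (q ^ 2); qm2 = free_const (inverse q ^ 2)
     in {x11 * x12 - x12 * x11,
         x21 * x22 - x22 * x21,
         (x11 * x22 - x22 * x11) + (x21 * x12 - x12 * x21),
         x11 * x21 - qm2 * x21 * x11,
         x12 * x22 - qm2 * x22 * x12,
         x21 * x12 - q2 * x12 * x21})"

definition mink_ideal :: "free_alg set" where
  "mink_ideal = subgroup_gen {a * r * b | a r b. r \<in> mink_relators}"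

definition mink_eq :: "free_alg \<Rightarrow> free_alg \<Rightarrow> bool" where
  "mink_eq f g \<longleftrightarrow> f - g \<in> mink_ideal"

lemma equivp_mink_eq: "equivp mink_eq"
  unfolding mink_eq_def[abs_def] mink_ideal_def by (rule equivp_subgroup_gen)

lemma mink_eqI: "f = g \<Longrightarrow> mink_eq f g"
  using equivp_reflp[OF equivp_mink_eq] by simp

lemma mink_ideal_add: "f \<in> mink_ideal \<Longrightarrow> g \<in> mink_ideal \<Longrightarrow> f + g \<in> mink_ideal"
  unfolding mink_ideal_def by (rule subgroup_gen_add)

lemma mink_ideal_mult_left: "f \<in> mink_ideal \<Longrightarrow> c * f \<in> mink_ideal"
  unfolding mink_ideal_def
  by (erule subgroup_gen_hom)
    (auto simp: algebra_simps intro!: subgroup_gen.base, metis mult.assoc)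

lemma mink_ideal_mult_right: "f \<in> mink_ideal \<Longrightarrow> f * c \<in> mink_ideal"
  unfolding mink_ideal_def
  by (erule subgroup_gen_hom)
    (auto simp: algebra_simps intro!: subgroup_gen.base, metis mult.assoc)

lemma mword_sum_eq_0: "0 = u + v \<longleftrightarrow> u = 0 \<and> v = (0::mword)"
  by (cases u; cases v) (auto simp: zero_mword_def plus_mword_def)

lemma lookup_mult_0:
  fixes f g :: free_alg
  shows "Poly_Mapping.lookup (f * g) 0 = Poly_Mapping.lookup f 0 * Poly_Mapping.lookup g 0"
proof -
  let ?f = "Poly_Mapping.lookup f" and ?g = "Poly_Mapping.lookup g"
  have "Poly_Mapping.lookup (f * g) 0
      = Sum_any (\<lambda>u. ?f u * Sum_any (\<lambda>v. ?g v when 0 = u + v))"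
    by (simp add: times_poly_mapping.rep_eq prod_fun_def)
  also have "\<dots> = Sum_any (\<lambda>u. ?f u * Sum_any (\<lambda>v. (?g v when v = 0) when u = 0))"
    by (simp add: mword_sum_eq_0 when_when conj_commute)
  also have "\<dots> = Sum_any (\<lambda>u. ?f u * (?g 0 when u = 0))"
    by (rule Sum_any.cong) (simp add: when_def)
  also have "\<dots> = Sum_any (\<lambda>u. ?f u * ?g 0 when u = 0)"
    by (simp add: mult_when)
  also have "\<dots> = ?f 0 * ?g 0"
    by simp
  finally show ?thesis .
qed

lemma lookup_free_x_0: "Poly_Mapping.lookup (free_x i j) 0 = 0"
  by (simp add: free_x_def lookup_single zero_mword_def)

lemma lookup_mink_ideal_0: "f \<in> mink_ideal \<Longrightarrow> Poly_Mapping.lookup f 0 = 0"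
  unfolding mink_ideal_def
  by (induction rule: subgroup_gen.induct)
    (auto simp: mink_relators_def Let_def lookup_minus lookup_add lookup_mult_0 lookup_free_x_0)

quotient_type qmink = free_alg / mink_eq
  by (rule equivp_mink_eq)

instantiation qmink :: ring_1
begin

lift_definition zero_qmink :: qmink is 0 .

lift_definition one_qmink :: qmink is 1 .

lift_definition plus_qmink :: "qmink \<Rightarrow> qmink \<Rightarrow> qmink" is "(+)"
  unfolding mink_eq_def mink_ideal_def
  by (simp add: add_diff_add subgroup_gen_add)

lift_definition uminus_qmink :: "qmink \<Rightarrow> qmink" is uminus
  unfolding mink_eq_def mink_ideal_def
  using subgroup_gen_uminus by fastforce

lift_definition minus_qmink :: "qmink \<Rightarrow> qmink \<Rightarrow> qmink" is "(-)"
proof -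
  fix a b c d :: free_alg
  assume "mink_eq a b" "mink_eq c d"
  moreover have "a - c - (b - d) = (a - b) - (c - d)" by simp
  ultimately show "mink_eq (a - c) (b - d)"
    unfolding mink_eq_def mink_ideal_def by (simp only: subgroup_gen.diff)
qed

lift_definition times_qmink :: "qmink \<Rightarrow> qmink \<Rightarrow> qmink" is "(*)"
proof -
  fix a b c d :: free_alg
  assume "mink_eq a b" "mink_eq c d"
  moreover have "a * c - b * d = (a - b) * c + b * (c - d)" by (simp add: algebra_simps)
  ultimately show "mink_eq (a * c) (b * d)"
    unfolding mink_eq_def
    by (simp only: mink_ideal_add mink_ideal_mult_left mink_ideal_mult_right)
qed

instance
proof
  fix a b c :: qmink
  show "a * b * c = a * (b * c)"
    by transfer (rule mink_eqI, rule mult.assoc)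
  show "a + b + c = a + (b + c)"
    by transfer (rule mink_eqI, rule add.assoc)
  show "a + b = b + a"
    by transfer (rule mink_eqI, rule add.commute)
  show "0 + a = a"
    by transfer (rule mink_eqI, rule add_0_left)
  show "- a + a = 0"
    by transfer (rule mink_eqI, rule left_minus)
  show "a - b = a + - b"
    by transfer (rule mink_eqI, rule diff_conv_add_uminus)
  show "(a + b) * c = a * c + b * c"
    by transfer (rule mink_eqI, rule distrib_right)
  show "a * (b + c) = a * b + a * c"
    by transfer (rule mink_eqI, rule distrib_left)
  show "1 * a = a"
    by transfer (rule mink_eqI, rule mult_1_left)
  show "a * 1 = a"
    by transfer (rule mink_eqI, rule mult_1_right)
  show "(0::qmink) \<noteq> 1"
  proof (transfer, rule notI)
    assume "mink_eq 0 1"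
    then have "Poly_Mapping.lookup (0 - 1 :: free_alg) 0 = 0"
      unfolding mink_eq_def by (rule lookup_mink_ideal_0)
    then show False by (simp add: lookup_minus lookup_one)
  qed
qed

end

lift_definition mink_x :: "idx \<Rightarrow> idx \<Rightarrow> qmink" is free_x .

lift_definition mink_const :: "cq \<Rightarrow> qmink" is free_const .

definition mink_scale :: "cq \<Rightarrow> qmink \<Rightarrow> qmink" where
  "mink_scale c f = mink_const c * f"

global_interpretation mink: vector_space mink_scale
proof
  fix a b :: cq and f g :: qmink
  show "mink_scale a (f + g) = mink_scale a f + mink_scale a g"
    by (simp add: mink_scale_def algebra_simps)
  have "mink_const (a + b) = mink_const a + mink_const b"
    by transfer (simp add: free_const_def single_add equivp_reflp[OF equivp_mink_eq])
  then show "mink_scale (a + b) f = mink_scale a f + mink_scale b f"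
    by (simp add: mink_scale_def algebra_simps)
  have "mink_const a * mink_const b = mink_const (a * b)"
    by transfer (simp add: free_const_def mult_single equivp_reflp[OF equivp_mink_eq])
  then show "mink_scale a (mink_scale b f) = mink_scale (a * b) f"
    by (simp add: mink_scale_def flip: mult.assoc)
  have "mink_const 1 = 1"
    by transfer (simp add: free_const_def equivp_reflp[OF equivp_mink_eq])
  then show "mink_scale 1 f = f"
    by (simp add: mink_scale_def)
qed


section \<open>Differential calculus\<close>

fun R_matrix :: "cq \<Rightarrow> idx \<Rightarrow> idx \<Rightarrow> idx \<Rightarrow> idx \<Rightarrow> cq" where
  "R_matrix p I1 I1 I1 I1 = inverse p"
| "R_matrix p I2 I2 I2 I2 = inverse p"
| "R_matrix p I1 I2 I1 I2 = q"
| "R_matrix p I2 I1 I2 I1 = inverse q"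
| "R_matrix p I1 I2 I2 I1 = inverse p - inverse q"
| "R_matrix p I2 I1 I1 I2 = inverse p - q"
| "R_matrix p _ _ _ _ = 0"

text \<open>The 1-forms depend on the parameter \<open>p\<close>, so they are not made into a type:
  they are represented by formal integer combinations of symbols \<open>(a, (r, s), b)\<close>, standing for
  \<open>a dx\<^sub>r\<^sub>s b\<close>, up to the congruence \<open>form_eq p\<close> presenting the bimodule.\<close>

type_synonym form = "(qmink \<times> (idx \<times> idx) \<times> qmink) \<Rightarrow>\<^sub>0 int"

definition lact :: "qmink \<Rightarrow> form \<Rightarrow> form" where
  "lact f = frag_extend (\<lambda>(a, g, b). frag_of (f * a, g, b))"

definition ract :: "form \<Rightarrow> qmink \<Rightarrow> form" where
  "ract \<omega> f = frag_extend (\<lambda>(a, g, b). frag_of (a, g, b * f)) \<omega>"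

definition dx :: "idx \<Rightarrow> idx \<Rightarrow> form" where
  "dx r s = frag_of (1, (r, s), 1)"

definition form_relators :: "cq \<Rightarrow> form set" where
  "form_relators p =
     {frag_of (a + a', g, b) - frag_of (a, g, b) - frag_of (a', g, b) | a a' g b. True} \<union>
     {frag_of (a, g, b + b') - frag_of (a, g, b) - frag_of (a, g, b') | a g b b'. True} \<union>
     {frag_of (a * mink_const c, g, b) - frag_of (a, g, mink_const c * b) | a c g b. True} \<union>
     {lact f (ract
        (ract (dx j l) (mink_x i k)
           - (\<Sum>m\<in>UNIV. \<Sum>n\<in>UNIV. \<Sum>a\<in>UNIV. \<Sum>b\<in>UNIV.
                lact (mink_scale (R_matrix p i j m n * R_matrix p b a l k) (mink_x m a)) (dx n b)))
        h) | f h i j k l. True}"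

definition form_eq :: "cq \<Rightarrow> form \<Rightarrow> form \<Rightarrow> bool" where
  "form_eq p \<omega> \<eta> \<longleftrightarrow> \<omega> - \<eta> \<in> subgroup_gen (form_relators p)"

definition de_rham :: "cq \<Rightarrow> (qmink \<Rightarrow> form) \<Rightarrow> bool" where
  "de_rham p d \<longleftrightarrow>
     (\<forall>f g. form_eq p (d (f + g)) (d f + d g)) \<and>
     (\<forall>c f. form_eq p (d (mink_scale c f)) (lact (mink_const c) (d f))) \<and>
     (\<forall>r s. form_eq p (d (mink_x r s)) (dx r s)) \<and>
     (\<forall>f g. form_eq p (d (f * g)) (ract (d f) g + lact f (d g)))"

text \<open>As 1-forms are free over the \<open>dx\<^sub>r\<^sub>s\<close> as a left module and the de Rham operator is unique
  up to \<open>form_eq p\<close>, the coefficients below are determined by \<open>f\<close>.\<close>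

definition quantum_partial :: "cq \<Rightarrow> idx \<Rightarrow> idx \<Rightarrow> qmink \<Rightarrow> qmink" where
  "quantum_partial p r s f =
     (THE c. \<exists>d. de_rham p d \<and>
        form_eq p (d f) (\<Sum>i\<in>UNIV. \<Sum>j\<in>UNIV. lact (c i j) (dx i j))) r s"

definition quantum_laplacian :: "cq \<Rightarrow> qmink \<Rightarrow> qmink" where
  "quantum_laplacian p f =
     quantum_partial p I1 I1 (quantum_partial p I2 I2 f)
     - quantum_partial p I2 I1 (quantum_partial p I1 I2 f)"


section \<open>Cech cohomology of \<open>\<O>(-2)\<close>\<close>

text \<open>The key \<open>(a, b, i, j)\<close> is the exponent of the Laurent monomial
  \<open>x\<^sup>a y\<^sup>b z\<^sup>i w\<^sup>j\<close>.\<close>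

type_synonym laurent = "(nat \<times> nat \<times> int \<times> int) \<Rightarrow>\<^sub>0 complex"

definition laurent_scale :: "complex \<Rightarrow> laurent \<Rightarrow> laurent" where
  "laurent_scale c = Poly_Mapping.map ((*) c)"

lemma lookup_laurent_scale [simp]: "Poly_Mapping.lookup (laurent_scale c f) k = c * Poly_Mapping.lookup f k"
  by (simp add: laurent_scale_def map.rep_eq when_def)

global_interpretation laurent: vector_space laurent_scale
  by standard (auto intro!: poly_mapping_eqI simp: lookup_add algebra_simps)

text \<open>The cover consists of the standard affine opens \<open>{z \<noteq> 0}\<close> and \<open>{w \<noteq> 0}\<close> of projective
  3-space, whose union is the complement of the line \<open>{z = w = 0}\<close>.
  Sections of \<open>\<O>(n)\<close> over \<open>{z \<noteq> 0, w \<noteq> 0}\<close>, over \<open>{z \<noteq> 0}\<close> and over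
  \<open>{w \<noteq> 0}\<close>: the degree \<open>n\<close> parts of the polynomial ring localized at \<open>zw\<close>, at \<open>z\<close>
  and at \<open>w\<close>.\<close>

definition sections_zw :: "int \<Rightarrow> laurent set" where
  "sections_zw n = {f. \<forall>(a, b, i, j) \<in> Poly_Mapping.keys f. int a + int b + i + j = n}"

definition sections_z :: "int \<Rightarrow> laurent set" where
  "sections_z n = {f \<in> sections_zw n. \<forall>(a, b, i, j) \<in> Poly_Mapping.keys f. 0 \<le> j}"

definition sections_w :: "int \<Rightarrow> laurent set" where
  "sections_w n = {f \<in> sections_zw n. \<forall>(a, b, i, j) \<in> Poly_Mapping.keys f. 0 \<le> i}"

definition coboundaries :: "int \<Rightarrow> laurent set" where
  "coboundaries n = {g - f | f g. f \<in> sections_z n \<and> g \<in> sections_w n}"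

lemma subspace_keys: "laurent.subspace {f. \<forall>k \<in> Poly_Mapping.keys f. P k}"
proof -
  have "{f :: laurent. \<forall>k \<in> Poly_Mapping.keys f. P k}
      = {f. \<forall>k. \<not> P k \<longrightarrow> Poly_Mapping.lookup f k = 0}"
    by (metis in_keys_iff)
  then show ?thesis
    by (simp add: laurent.subspace_def lookup_add)
qed

lemma subspace_sections_zw: "laurent.subspace (sections_zw n)"
  unfolding sections_zw_def by (rule subspace_keys)

lemma subspace_sections_z: "laurent.subspace (sections_z n)"
proof -
  have "sections_z n = {f. \<forall>k \<in> Poly_Mapping.keys f. (\<lambda>(a, b, i, j). int a + int b + i + j = n \<and> 0 \<le> j) k}"
    by (fastforce simp: sections_z_def sections_zw_def)
  then show ?thesis by (simp only: subspace_keys)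
qed

lemma subspace_sections_w: "laurent.subspace (sections_w n)"
proof -
  have "sections_w n = {f. \<forall>k \<in> Poly_Mapping.keys f. (\<lambda>(a, b, i, j). int a + int b + i + j = n \<and> 0 \<le> i) k}"
    by (fastforce simp: sections_w_def sections_zw_def)
  then show ?thesis by (simp only: subspace_keys)
qed

lemma subspace_coboundaries: "laurent.subspace (coboundaries n)"
proof -
  have "coboundaries n = {g + f | g f. g \<in> sections_w n \<and> f \<in> sections_z n}"
    (is "_ = ?R")
  proof -
    have "- f \<in> sections_z n \<longleftrightarrow> f \<in> sections_z n" for f
      using laurent.subspace_neg[OF subspace_sections_z] by fastforce
    then show ?thesis
      unfolding coboundaries_def by (metis (no_types, lifting) add.inverse_inverse diff_conv_add_uminus)
  qed
  then show ?thesis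
    by (simp add: laurent.subspace_sums subspace_sections_z subspace_sections_w)
qed

definition cech_eq :: "laurent \<Rightarrow> laurent \<Rightarrow> bool" where
  "cech_eq f g \<longleftrightarrow>
     f \<in> sections_zw (- 2) \<and> g \<in> sections_zw (- 2) \<and> f - g \<in> coboundaries (- 2)"

lemma part_equivp_cech_eq: "part_equivp cech_eq"
proof (rule part_equivpI)
  show "\<exists>f. cech_eq f f"
    by (rule exI[of _ 0])
      (simp add: cech_eq_def laurent.subspace_0 subspace_sections_zw subspace_coboundaries)
  show "symp cech_eq"
    unfolding symp_def cech_eq_def
    by (metis laurent.subspace_neg[OF subspace_coboundaries] minus_diff_eq)
  show "transp cech_eq"
    unfolding transp_def cech_eq_def
    using laurent.subspace_add[OF subspace_coboundaries, of "f - g" for f g] by fastforce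
qed

lemma cech_eq_add: "cech_eq a b \<Longrightarrow> cech_eq c d \<Longrightarrow> cech_eq (a + c) (b + d)"
  unfolding cech_eq_def
  by (simp add: add_diff_add laurent.subspace_add subspace_sections_zw subspace_coboundaries)

lemma cech_eq_scale:
  assumes "cech_eq a b"
  shows "cech_eq (laurent_scale c a) (laurent_scale c b)"
  using assms unfolding cech_eq_def
  by (simp flip: laurent.scale_right_diff_distrib
      add: laurent.subspace_scale subspace_sections_zw subspace_coboundaries)

text \<open>The first Cech cohomology \<open>C\<^sup>1 / B\<^sup>1\<close>; the quotient is partial because
  \<open>C\<^sup>1\<close> consists of the elements of degree \<open>-2\<close> only.\<close>

quotient_type cech_H1 = laurent / partial: cech_eq
  by (rule part_equivp_cech_eq)

abbreviation cohomology_class :: "laurent \<Rightarrow> cech_H1" where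
  "cohomology_class \<equiv> abs_cech_H1"

lemma cech_eq_refl: "f \<in> sections_zw (- 2) \<Longrightarrow> cech_eq f f"
  by (simp add: cech_eq_def laurent.subspace_0 subspace_coboundaries)

lemma cech_eq_uminus: "cech_eq a b \<Longrightarrow> cech_eq (- a) (- b)"
  using cech_eq_scale[of a b "- 1"] by simp

lemma cech_eq_minus: "cech_eq a b \<Longrightarrow> cech_eq c d \<Longrightarrow> cech_eq (a - c) (b - d)"
  using cech_eq_add[of a b "- c" "- d"] cech_eq_uminus by simp

instantiation cech_H1 :: ab_group_add
begin

lift_definition zero_cech_H1 :: cech_H1 is 0
  by (simp add: cech_eq_refl laurent.subspace_0 subspace_sections_zw)

lift_definition plus_cech_H1 :: "cech_H1 \<Rightarrow> cech_H1 \<Rightarrow> cech_H1" is "(+)"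
  by (rule cech_eq_add)

lift_definition uminus_cech_H1 :: "cech_H1 \<Rightarrow> cech_H1" is uminus
  by (rule cech_eq_uminus)

lift_definition minus_cech_H1 :: "cech_H1 \<Rightarrow> cech_H1 \<Rightarrow> cech_H1" is "(-)"
  by (rule cech_eq_minus)

instance
proof
  fix a b c :: cech_H1
  show "a + b + c = a + (b + c)"
    by transfer (simp add: cech_eq_refl cech_eq_add add.assoc)
  show "a + b = b + a"
    by transfer (simp add: cech_eq_add add.commute)
  show "0 + a = a"
    by transfer simp
  show "- a + a = 0"
    by transfer (simp add: cech_eq_refl laurent.subspace_0 subspace_sections_zw)
  show "a - b = a + - b"
    by transfer (simp add: cech_eq_minus)
qed

end

lift_definition H1_scale :: "complex \<Rightarrow> cech_H1 \<Rightarrow> cech_H1" is laurent_scale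
  by (rule cech_eq_scale)


section \<open>Extension of scalars\<close>

text \<open>\<open>H\<^sup>1 \<otimes>\<^sub>\<complex> \<complex>(q)\<close>, as formal integer combinations of pairs modulo the
  balanced bilinear relations.\<close>

definition tensor_relators :: "((cech_H1 \<times> cq) \<Rightarrow>\<^sub>0 int) set" where
  "tensor_relators =
     {frag_of (u + v, c) - frag_of (u, c) - frag_of (v, c) | u v c. True} \<union>
     {frag_of (u, c + c') - frag_of (u, c) - frag_of (u, c') | u c c'. True} \<union>
     {frag_of (H1_scale \<alpha> u, c) - frag_of (u, cq_of_complex \<alpha> * c) | \<alpha> u c. True}"

definition tensor_eq :: "((cech_H1 \<times> cq) \<Rightarrow>\<^sub>0 int) \<Rightarrow> ((cech_H1 \<times> cq) \<Rightarrow>\<^sub>0 int) \<Rightarrow> bool" where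
  "tensor_eq s t \<longleftrightarrow> s - t \<in> subgroup_gen tensor_relators"

lemma equivp_tensor_eq: "equivp tensor_eq"
  unfolding tensor_eq_def[abs_def] by (rule equivp_subgroup_gen)

lemma tensor_eqI: "s = t \<Longrightarrow> tensor_eq s t"
  using equivp_reflp[OF equivp_tensor_eq] by simp

quotient_type cech_H1q = "(cech_H1 \<times> cq) \<Rightarrow>\<^sub>0 int" / tensor_eq
  by (rule equivp_tensor_eq)

instantiation cech_H1q :: ab_group_add
begin

lift_definition zero_cech_H1q :: cech_H1q is 0 .

lift_definition plus_cech_H1q :: "cech_H1q \<Rightarrow> cech_H1q \<Rightarrow> cech_H1q" is "(+)"
  unfolding tensor_eq_def by (simp add: add_diff_add subgroup_gen_add)

lift_definition uminus_cech_H1q :: "cech_H1q \<Rightarrow> cech_H1q" is uminus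
  unfolding tensor_eq_def using subgroup_gen_uminus by fastforce

lift_definition minus_cech_H1q :: "cech_H1q \<Rightarrow> cech_H1q \<Rightarrow> cech_H1q" is "(-)"
proof -
  fix a b c d :: "(cech_H1 \<times> cq) \<Rightarrow>\<^sub>0 int"
  assume "tensor_eq a b" "tensor_eq c d"
  moreover have "a - c - (b - d) = (a - b) - (c - d)" by simp
  ultimately show "tensor_eq (a - c) (b - d)"
    unfolding tensor_eq_def by (simp only: subgroup_gen.diff)
qed

instance
proof
  fix a b c :: cech_H1q
  show "a + b + c = a + (b + c)"
    by transfer (rule tensor_eqI, rule add.assoc)
  show "a + b = b + a"
    by transfer (rule tensor_eqI, rule add.commute)
  show "0 + a = a"
    by transfer (rule tensor_eqI, rule add_0_left)
  show "- a + a = 0"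
    by transfer (rule tensor_eqI, rule left_minus)
  show "a - b = a + - b"
    by transfer (rule tensor_eqI, rule diff_conv_add_uminus)
qed

end

lift_definition tensor :: "cech_H1 \<Rightarrow> cq \<Rightarrow> cech_H1q" (infix \<open>\<otimes>\<^sub>q\<close> 75)
  is "\<lambda>(u::cech_H1) (c::cq). frag_of (u, c)" .

lift_definition H1q_scale :: "cq \<Rightarrow> cech_H1q \<Rightarrow> cech_H1q"
  is "\<lambda>c::cq. frag_extend (\<lambda>(u::cech_H1, c'). frag_of (u, c * c'))"
proof -
  fix c and s t :: "(cech_H1 \<times> cq) \<Rightarrow>\<^sub>0 int"
  let ?h = "frag_extend (\<lambda>(u, c'). frag_of (u, c * c')) :: _ \<Rightarrow> (cech_H1 \<times> cq) \<Rightarrow>\<^sub>0 int"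
  assume "tensor_eq s t"
  then have "?h (s - t) \<in> subgroup_gen tensor_relators"
    unfolding tensor_eq_def
  proof (rule subgroup_gen_hom)
    fix u
    assume "u \<in> tensor_relators"
    then consider
      v w c' where "u = frag_of (v + w, c') - frag_of (v, c') - frag_of (w, c')"
    | v c' c'' where "u = frag_of (v, c' + c'') - frag_of (v, c') - frag_of (v, c'')"
    | \<alpha> v c' where "u = frag_of (H1_scale \<alpha> v, c') - frag_of (v, cq_of_complex \<alpha> * c')"
      unfolding tensor_relators_def by blast
    then have "?h u \<in> tensor_relators"
    proof cases
      case 1
      then have "?h u = frag_of (v + w, c * c') - frag_of (v, c * c') - frag_of (w, c * c')"
        by (simp add: frag_extend_diff)
      then show ?thesis
        unfolding tensor_relators_def by blast
    next
      case 2
      then have "?h u = frag_of (v, c * c' + c * c'') - frag_of (v, c * c') - frag_of (v, c * c'')"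
        by (simp add: frag_extend_diff distrib_left)
      then show ?thesis
        unfolding tensor_relators_def by blast
    next
      case 3
      then have "?h u = frag_of (H1_scale \<alpha> v, c * c')
          - frag_of (v, cq_of_complex \<alpha> * (c * c'))"
        by (simp add: frag_extend_diff mult.left_commute)
      then show ?thesis
        unfolding tensor_relators_def by blast
    qed
    then show "?h u \<in> subgroup_gen tensor_relators"
      by (rule subgroup_gen.base)
  qed (rule frag_extend_diff)
  then show "tensor_eq (?h s) (?h t)"
    by (simp add: tensor_eq_def frag_extend_diff)
qed

lemma H1q_scale_0: "H1q_scale c 0 = 0"
  by transfer (simp add: tensor_eqI)

lemma H1q_scale_tensor: "H1q_scale c (u \<otimes>\<^sub>q c') = u \<otimes>\<^sub>q (c * c')"
  by transfer (simp add: tensor_eqI)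

lemma H1q_scale_diff: "H1q_scale c (x - y) = H1q_scale c x - H1q_scale c y"
  by transfer (simp add: tensor_eqI frag_extend_diff)

lemma tensor_add_right: "u \<otimes>\<^sub>q (c + c') = u \<otimes>\<^sub>q c + u \<otimes>\<^sub>q c'"
proof transfer
  fix u c c'
  have "frag_of (u, c + c') - frag_of (u, c) - frag_of (u, c') \<in> tensor_relators"
    unfolding tensor_relators_def by blast
  then show "tensor_eq (frag_of (u, c + c')) (frag_of (u, c) + frag_of (u, c'))"
    unfolding tensor_eq_def by (simp add: diff_diff_eq subgroup_gen.base)
qed

lemma cech_H1q_induct [case_names zero tensor diff]:
  assumes "P 0" and "\<And>u c. P (u \<otimes>\<^sub>q c)" and "\<And>x y. P x \<Longrightarrow> P y \<Longrightarrow> P (x - y)"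
  shows "P x"
proof -
  obtain s where x: "x = abs_cech_H1q s"
    by (metis Quotient3_abs_rep Quotient3_cech_H1q)
  have "P (abs_cech_H1q s)"
  proof (rule frag_induction[of s UNIV "\<lambda>s. P (abs_cech_H1q s)"])
    show "P (abs_cech_H1q 0)"
      using assms(1) by (simp add: zero_cech_H1q_def)
    show "P (abs_cech_H1q (frag_of a))" for a
      using assms(2)[of "fst a" "snd a"] by (simp add: tensor_def)
    show "P (abs_cech_H1q (s - t))" if "P (abs_cech_H1q s)" "P (abs_cech_H1q t)" for s t
      using assms(3)[OF that] by (simp add: minus_cech_H1q.abs_eq)
  qed simp
  then show ?thesis by (simp add: x)
qed

global_interpretation H1q: vector_space H1q_scale
proof
  fix a b :: cq and x y :: cech_H1q
  show "H1q_scale a (x + y) = H1q_scale a x + H1q_scale a y"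
    using H1q_scale_diff[of a x "- y"] H1q_scale_diff[of a 0 y] by (simp add: H1q_scale_0)
  show "H1q_scale (a + b) x = H1q_scale a x + H1q_scale b x"
    by (induction x rule: cech_H1q_induct)
      (simp_all add: H1q_scale_0 H1q_scale_tensor H1q_scale_diff tensor_add_right algebra_simps)
  show "H1q_scale a (H1q_scale b x) = H1q_scale (a * b) x"
    by (induction x rule: cech_H1q_induct)
      (simp_all add: H1q_scale_0 H1q_scale_tensor H1q_scale_diff mult.assoc)
  show "H1q_scale 1 x = x"
    by (induction x rule: cech_H1q_induct)
      (simp_all add: H1q_scale_0 H1q_scale_tensor H1q_scale_diff)
qed


section \<open>The integral formula\<close>

text \<open>The ring \<open>int \<Rightarrow>\<^sub>0 qmink\<close> consists of the Laurent polynomials in the central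
  variable \<open>s\<close> over the algebra; the contour integral around \<open>s = 0\<close> is the coefficient of
  \<open>s\<^sup>-\<^sup>1\<close>. The substitution sends \<open>z\<close> to \<open>s\<close> and \<open>w\<close> to \<open>1\<close>; the images of \<open>x\<close> and
  \<open>y\<close> commute, so their order is immaterial.\<close>

definition s_pow :: "int \<Rightarrow> int \<Rightarrow>\<^sub>0 qmink" where
  "s_pow i = Poly_Mapping.single i 1"

definition s_coeff :: "qmink \<Rightarrow> int \<Rightarrow>\<^sub>0 qmink" where
  "s_coeff f = Poly_Mapping.single 0 f"

definition twistor_eval :: "laurent \<Rightarrow> int \<Rightarrow>\<^sub>0 qmink" where
  "twistor_eval f =
     (\<Sum>(a, b, i, j) \<in> Poly_Mapping.keys f.
        s_coeff (mink_const (cq_of_complex (Poly_Mapping.lookup f (a, b, i, j))))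
        * (s_coeff (mink_x I1 I1) * s_pow 1 + s_coeff (mink_x I2 I1)) ^ a
        * (s_coeff (mink_x I1 I2) * s_pow 1 + s_coeff (mink_x I2 I2)) ^ b
        * s_pow i)"

definition twistor_integral :: "laurent \<Rightarrow> qmink" where
  "twistor_integral f = Poly_Mapping.lookup (twistor_eval f) (- 1)"

definition basis_monomials :: "laurent set" where
  "basis_monomials =
     {Poly_Mapping.single
        (nat \<lfloor>l - m\<rfloor>, nat \<lfloor>l + m\<rfloor>, - \<lfloor>l - n + 1\<rfloor>, - \<lfloor>l + n + 1\<rfloor>) 1 |
      l m n :: rat.
        2 * l \<in> \<nat> \<and> - l \<le> n \<and> n \<le> l \<and> - l \<le> m \<and> m \<le> l \<and> n - l \<in> \<int> \<and> m - l \<in> \<int>}"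

end

theory Submission
  imports
    Defs
    "HOL-Library.Function_Algebras"
    "HOL-Library.Product_Plus"
begin

text \<open>Ordered monomials \<open>x\<^sub>1\<^sub>1\<^sup>A x\<^sub>1\<^sub>2\<^sup>B x\<^sub>2\<^sub>1\<^sup>C x\<^sub>2\<^sub>2\<^sup>D\<close> form a basis of the algebra, and right multiplication by the
  generators, which determines the partial derivatives recursively through the Leibniz rule, is
  explicit on it. The Laplacian maps \<open>(A, B, C, D)\<close> to a combination of \<open>(A - 1, B, C, D - 1)\<close> and
  \<open>(A, B - 1, C - 1, D)\<close>; after rescaling by \<open>q\<close>-factorials the two coefficients are opposite. Hence an
  element is in the kernel if and only if its coefficients are constant on each finite line
  \<open>A + C = a\<close>, \<open>B + D = b\<close>, \<open>A + B = e\<close>, and the sums over these lines form a basis of the kernel. By the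
  \<open>q\<close>-binomial theorem the line sum is, up to the factor \<open>[a]! [b]!\<close>, the coefficient of \<open>s\<^sup>e\<close> in
  \<open>(x\<^sub>1\<^sub>1 s + x\<^sub>2\<^sub>1)\<^sup>a (x\<^sub>1\<^sub>2 s + x\<^sub>2\<^sub>2)\<^sup>b\<close>, that is, the integral of the cocycle
  \<open>x\<^sup>a y\<^sup>b z\<^sup>-\<^sup>1\<^sup>-\<^sup>e w\<^sup>e\<^sup>-\<^sup>1\<^sup>-\<^sup>a\<^sup>-\<^sup>b\<close>.\<close>

section \<open>Linear extension of functions on a basis\<close>

text \<open>The algebra and the 1-forms are quotients of formal sums, and
  \<open>quantum_partial\<close> is a definite description. Before any derivative can be computed,
  it must be shown that a de Rham operator exists and that left coefficients of 1-forms are unique.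
  The same device settles this and the independence of the ordered monomials: four operators obeying
  the relations of right multiplication make a vector space a right module over the quotient
  algebra. Acting on coefficient functions, they separate the monomials; acting on pairs of a
  function and the coefficients of a 1-form, they construct \<open>d\<close>. The rescaling of the
  monomials also contains \<open>Q^(2BC)\<close>. It gives the two terms of the Laplacian the same
  power of \<open>Q\<close>, and it is the factor produced by moving \<open>y21^C\<close> past
  \<open>y12^B\<close> when two q-binomial expansions are multiplied. This is why the line sums are
  integrals of cocycles. Injectivity of the integral comes from the target: the monomial classes
  span the cohomology, and their images are independent.\<close>

definition pm_extend :: "('k \<Rightarrow> 'c::zero \<Rightarrow> 'v::comm_monoid_add) \<Rightarrow> ('k \<Rightarrow>\<^sub>0 'c) \<Rightarrow> 'v" where
  "pm_extend g f = (\<Sum>k\<in>Poly_Mapping.keys f. g k (Poly_Mapping.lookup f k))"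

lemma pm_extend_superset:
  assumes "\<And>k. g k 0 = 0" "finite K" "Poly_Mapping.keys f \<subseteq> K"
  shows "pm_extend g f = (\<Sum>k\<in>K. g k (Poly_Mapping.lookup f k))"
  unfolding pm_extend_def
  by (rule sum.mono_neutral_left) (use assms in \<open>auto simp: in_keys_iff\<close>)

lemma pm_extend_0 [simp]: "pm_extend g 0 = 0"
  by (simp add: pm_extend_def)

lemma pm_extend_single: "g k 0 = 0 \<Longrightarrow> pm_extend g (Poly_Mapping.single k c) = g k c"
  by (simp add: pm_extend_def)

lemma pm_extend_add:
  assumes "\<And>k. g k 0 = 0" "\<And>k a b. g k (a + b) = g k a + g k b"
  shows "pm_extend g (f + h) = pm_extend g f + pm_extend g h"
proof -
  let ?K = "Poly_Mapping.keys f \<union> Poly_Mapping.keys h"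
  have "pm_extend g u = (\<Sum>k\<in>?K. g k (Poly_Mapping.lookup u k))" if "Poly_Mapping.keys u \<subseteq> ?K" for u
    by (rule pm_extend_superset) (use assms that in auto)
  moreover have "Poly_Mapping.keys (f + h) \<subseteq> ?K"
    by (rule Poly_Mapping.keys_add)
  ultimately show ?thesis
    by (simp add: lookup_add assms(2) sum.distrib)
qed

lemma pm_extend_diff:
  fixes g :: "'k \<Rightarrow> 'c::ab_group_add \<Rightarrow> 'v::ab_group_add"
  assumes "\<And>k. g k 0 = 0" "\<And>k a b. g k (a + b) = g k a + g k b"
  shows "pm_extend g (f - h) = pm_extend g f - pm_extend g h"
  using pm_extend_add[of g "f - h" h] assms by simp

lemma poly_mapping_single_induct [case_names zero single add]:
  fixes f :: "'k \<Rightarrow>\<^sub>0 'c::comm_monoid_add"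
  assumes "P 0" "\<And>k c. P (Poly_Mapping.single k c)" "\<And>f g. P f \<Longrightarrow> P g \<Longrightarrow> P (f + g)"
  shows "P f"
proof (induction f rule: update_induct)
  case const
  show ?case by (rule assms(1))
next
  case (update f k c)
  have "Poly_Mapping.update k c f = f + Poly_Mapping.single k c"
    by (rule poly_mapping_eqI)
      (use update(1) in \<open>auto simp: lookup_update lookup_add lookup_single in_keys_iff\<close>)
  then show ?case
    using assms(3)[OF update(3) assms(2)] by simp
qed

section \<open>The ground field\<close>

lemma q_power: "q ^ n = Fract (monom 1 n) 1"
proof (induction n)
  case 0
  then show ?case by (simp add: One_fract_def monom_0 one_pCons)
next
  case (Suc n)
  then show ?case by (simp add: q_def monom_Suc mult.commute)
qed

text \<open>A formal parameter is not a root of unity; this is what keeps all q-numbers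
  invertible.\<close>

lemma q_power_neq_1: "n > 0 \<Longrightarrow> q ^ n \<noteq> 1"
proof
  assume n: "n > 0" and "q ^ n = 1"
  then have "(monom 1 n :: complex poly) = 1"
    by (simp add: q_power One_fract_def eq_fract)
  then have "degree (monom 1 n :: complex poly) = 0" by simp
  then show False using n by (simp add: degree_monom_eq)
qed

lemma q_nonzero [simp]: "q \<noteq> 0"
  by (simp add: q_def Zero_fract_def eq_fract)

lemma cq_of_complex_0 [simp]: "cq_of_complex 0 = 0"
  and cq_of_complex_1 [simp]: "cq_of_complex 1 = 1"
  and cq_of_complex_add: "cq_of_complex (a + b) = cq_of_complex a + cq_of_complex b"
  and cq_of_complex_mult: "cq_of_complex (a * b) = cq_of_complex a * cq_of_complex b"
  by (simp_all add: cq_of_complex_def Zero_fract_def One_fract_def one_pCons eq_fract)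

section \<open>Calculating in the algebra\<close>

lemma mult_free_const: "F * free_const c = free_const c * F"
proof (induction F rule: poly_mapping_single_induct)
  case zero
  then show ?case by simp
next
  case (single k c)
  then show ?case by (simp add: free_const_def mult_single mult.commute)
next
  case (add f g)
  then show ?case by (simp add: algebra_simps)
qed

lemma mult_mink_const: "f * mink_const c = mink_scale c f"
  unfolding mink_scale_def by transfer (rule mink_eqI, rule mult_free_const)

lemma mink_scale_mult_left [simp]: "mink_scale c f * g = mink_scale c (f * g)"
  by (simp add: mink_scale_def mult.assoc)

lemma mink_scale_mult_right [simp]: "f * mink_scale c g = mink_scale c (f * g)"
  by (metis mink_scale_mult_left mult.assoc mult_mink_const)

lemma mink_const_eq: "mink_const c = mink_scale c 1"
  by (simp add: mink_scale_def)

lemma mink_const_1: "mink_const 1 = 1"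
  by (simp add: mink_const_eq)

lemma mink_relations:
  fixes x11 x12 x21 x22 :: qmink
  defines "x11 \<equiv> mink_x I1 I1" and "x12 \<equiv> mink_x I1 I2"
    and "x21 \<equiv> mink_x I2 I1" and "x22 \<equiv> mink_x I2 I2"
  shows "x12 * x11 = x11 * x12" and "x22 * x21 = x21 * x22"
    and "(x11 * x22 - x22 * x11) + (x21 * x12 - x12 * x21) = 0"
    and "x11 * x21 = mink_scale (inverse q ^ 2) (x21 * x11)"
    and "x12 * x22 = mink_scale (inverse q ^ 2) (x22 * x12)"
    and "x21 * x12 = mink_scale (q ^ 2) (x12 * x21)"
proof -
  have rel: "r \<in> mink_relators \<Longrightarrow> mink_eq r 0" for r
    unfolding mink_eq_def mink_ideal_def
    by (rule subgroup_gen.base) (force intro: exI[of _ 1])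
  note rels = mink_relators_def[unfolded Let_def]
  have "x11 * x12 - x12 * x11 = 0" unfolding assms by transfer (rule rel, simp add: rels)
  then show "x12 * x11 = x11 * x12" by simp
  have "x21 * x22 - x22 * x21 = 0" unfolding assms by transfer (rule rel, simp add: rels)
  then show "x22 * x21 = x21 * x22" by simp
  show "(x11 * x22 - x22 * x11) + (x21 * x12 - x12 * x21) = 0"
    unfolding assms by transfer (rule rel, simp add: rels)
  have "x11 * x21 - mink_const (inverse q ^ 2) * x21 * x11 = 0"
    unfolding assms by transfer (rule rel, simp add: rels)
  then show "x11 * x21 = mink_scale (inverse q ^ 2) (x21 * x11)" by (simp add: mink_scale_def mult.assoc)
  have "x12 * x22 - mink_const (inverse q ^ 2) * x22 * x12 = 0"
    unfolding assms by transfer (rule rel, simp add: rels)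
  then show "x12 * x22 = mink_scale (inverse q ^ 2) (x22 * x12)" by (simp add: mink_scale_def mult.assoc)
  have "x21 * x12 - mink_const (q ^ 2) * x12 * x21 = 0"
    unfolding assms by transfer (rule rel, simp add: rels)
  then show "x21 * x12 = mink_scale (q ^ 2) (x12 * x21)" by (simp add: mink_scale_def mult.assoc)
qed

text \<open>Words are built up at their right end, because module actions and derivatives are
  determined by right multiplication by a generator.\<close>

lemma qmink_induct [case_names const add mult]:
  assumes "\<And>c. P (mink_const c)" and add: "\<And>f g. P f \<Longrightarrow> P g \<Longrightarrow> P (f + g)"
    and mult: "\<And>f i j. P f \<Longrightarrow> P (f * mink_x i j)"
  shows "P f"
proof -
  have word: "P (abs_qmink (Poly_Mapping.single (MWord ls) c))" for ls c
  proof (induction ls rule: rev_induct)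
    case Nil
    show ?case
      using assms(1)[of c] by (simp add: mink_const.abs_eq free_const_def zero_mword_def)
  next
    case (snoc g ls)
    obtain i j where g: "g = (i, j)" by fastforce
    have "Poly_Mapping.single (MWord (ls @ [g])) c = Poly_Mapping.single (MWord ls) c * free_x i j"
      by (simp add: free_x_def mult_single plus_mword_def g)
    then show ?case
      using mult[OF snoc] by (simp add: mink_x.abs_eq times_qmink.abs_eq)
  qed
  have "P (abs_qmink F)" for F
  proof (induction F rule: poly_mapping_single_induct)
    case zero
    show ?case using word[of _ 0] by (metis single_zero)
  next
    case (single k c)
    show ?case using word by (cases k) simp
  next
    case (add F G)
    then show ?case using assms(2) by (simp flip: plus_qmink.abs_eq)
  qed
  then show ?thesis
    by (metis Quotient3_abs_rep Quotient3_qmink)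
qed

section \<open>Modules over the algebra\<close>

fun flip :: "idx \<Rightarrow> idx" where
  "flip I1 = I2"
| "flip I2 = I1"

text \<open>Exchanging both indices turns the relations for \<open>q\<close> into those for \<open>q\<^sup>-\<^sup>1\<close>, and the calculus with
  \<open>p = q\<close> into the one with \<open>p = q\<^sup>-\<^sup>1\<close>. In terms of the generators below, the two choices of \<open>p\<close>
  therefore become the single case \<open>p = Q\<^sup>-\<^sup>1\<close>.\<close>

locale chart =
  fixes \<sigma> :: "idx \<Rightarrow> idx" and Q :: cq
  assumes chart: "\<sigma> = id \<and> Q = q \<or> \<sigma> = flip \<and> Q = inverse q"
begin

definition y :: "idx \<Rightarrow> idx \<Rightarrow> qmink" where
  "y i j = mink_x (\<sigma> i) (\<sigma> j)"

lemma Q_nonzero [simp]: "Q \<noteq> 0"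
  using chart by auto

lemma Q_power_neq_1: "n > 0 \<Longrightarrow> Q ^ n \<noteq> 1"
  using chart q_power_neq_1[of n] by (auto simp: power_inverse)

lemma chart_cases:
  obtains "\<sigma> I1 = I1" "\<sigma> I2 = I2" "Q = q"
    | "\<sigma> I1 = I2" "\<sigma> I2 = I1" "Q = inverse q"
  using chart by auto

lemma \<sigma>_\<sigma> [simp]: "\<sigma> (\<sigma> i) = i"
  using chart by (cases i) auto

lemma mink_x_eq: "mink_x i j = y (\<sigma> i) (\<sigma> j)"
  by (simp add: y_def)

text \<open>Each relation is solved for the product that violates the order 11, 12, 21, 22. Only the
  last one does more than rescale.\<close>

lemma y_commute:
  "y I1 I2 * y I1 I1 = y I1 I1 * y I1 I2"
  "y I2 I2 * y I2 I1 = y I2 I1 * y I2 I2"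
  "y I2 I1 * y I1 I1 = mink_scale (Q ^ 2) (y I1 I1 * y I2 I1)"
  "y I2 I2 * y I1 I2 = mink_scale (Q ^ 2) (y I1 I2 * y I2 I2)"
  "y I2 I1 * y I1 I2 = mink_scale (Q ^ 2) (y I1 I2 * y I2 I1)"
  "y I2 I2 * y I1 I1 = y I1 I1 * y I2 I2 + mink_scale (Q ^ 2 - 1) (y I1 I2 * y I2 I1)"
proof -
  have swap: "b = a + mink_scale (r - 1) d" if "a - b + (c - d) = 0" "c = mink_scale r d" for a b c d r
  proof -
    have "b = a + (c - d)" using that(1) by (simp add: algebra_simps)
    then show ?thesis using that(2) by (simp add: mink.scale_left_diff_distrib)
  qed
  have inv: "x' * x = mink_scale (q ^ 2) (x * x')" if "x * x' = mink_scale (inverse q ^ 2) (x' * x)" for x x'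
    using that by (simp flip: power_mult_distrib)
  have inv': "x * x' = mink_scale (inverse q ^ 2) (x' * x)" if "x' * x = mink_scale (q ^ 2) (x * x')" for x x'
    using that by (simp flip: power_mult_distrib)
  note rels = mink_relations
  \<comment> \<open>Exchanging both indices negates the mixed relation.\<close>
  have rel3: "mink_x I2 I2 * mink_x I1 I1 - mink_x I1 I1 * mink_x I2 I2
      + (mink_x I1 I2 * mink_x I2 I1 - mink_x I2 I1 * mink_x I1 I2) = 0"
    using rels(3) by (simp add: algebra_simps)
  show "y I1 I2 * y I1 I1 = y I1 I1 * y I1 I2"
    "y I2 I2 * y I2 I1 = y I2 I1 * y I2 I2"
    using rels(1,2) by (cases rule: chart_cases; simp add: y_def)+
  show "y I2 I1 * y I1 I1 = mink_scale (Q ^ 2) (y I1 I1 * y I2 I1)"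
    "y I2 I2 * y I1 I2 = mink_scale (Q ^ 2) (y I1 I2 * y I2 I2)"
    "y I2 I1 * y I1 I2 = mink_scale (Q ^ 2) (y I1 I2 * y I2 I1)"
    "y I2 I2 * y I1 I1 = y I1 I1 * y I2 I2 + mink_scale (Q ^ 2 - 1) (y I1 I2 * y I2 I1)"
    subgoal by (cases rule: chart_cases) (simp_all only: y_def inv[OF rels(4)] rels(5) inverse_inverse_eq)
    subgoal by (cases rule: chart_cases) (simp_all only: y_def inv[OF rels(5)] rels(4) inverse_inverse_eq)
    subgoal
    proof (cases rule: chart_cases)
      case 1
      show ?thesis using rels(6) by (simp only: y_def 1)
    next
      case 2
      show ?thesis using inv'[OF rels(6)] by (simp only: y_def 2)
    qed
    subgoal
    proof (cases rule: chart_cases)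
      case 1
      show ?thesis
        using swap[OF rels(3) rels(6)] by (simp only: y_def 1)
    next
      case 2
      show ?thesis
        using swap[OF rel3 inv'[OF rels(6)]] by (simp only: y_def 2 inverse_inverse_eq)
    qed
    done
qed

lemma qmink_y_induct [case_names const add mult]:
  assumes "\<And>c. P (mink_const c)" "\<And>f g. P f \<Longrightarrow> P g \<Longrightarrow> P (f + g)" "\<And>f i j. P f \<Longrightarrow> P (f * y i j)"
  shows "P f"
  by (induction f rule: qmink_induct) (use assms in \<open>auto simp: mink_x_eq\<close>)

end

text \<open>\<open>R i j\<close> stands for right multiplication by \<open>y i j\<close>, so the
  innermost operator is the left factor of a product. Read in this way, the assumed relations are
  those of \<open>y_commute\<close>.\<close>

locale right_module = chart \<sigma> Q + vector_space sc
  for \<sigma> Q and sc :: "cq \<Rightarrow> 'v::ab_group_add \<Rightarrow> 'v" +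
  fixes R :: "idx \<Rightarrow> idx \<Rightarrow> 'v \<Rightarrow> 'v"
  assumes R_add: "R i j (u + v) = R i j u + R i j v"
    and R_scale: "R i j (sc c v) = sc c (R i j v)"
    and R_relations:
      "R I1 I1 (R I1 I2 v) = R I1 I2 (R I1 I1 v)"
      "R I2 I1 (R I2 I2 v) = R I2 I2 (R I2 I1 v)"
      "R I1 I1 (R I2 I1 v) = sc (Q ^ 2) (R I2 I1 (R I1 I1 v))"
      "R I1 I2 (R I2 I2 v) = sc (Q ^ 2) (R I2 I2 (R I1 I2 v))"
      "R I1 I2 (R I2 I1 v) = sc (Q ^ 2) (R I2 I1 (R I1 I2 v))"
      "R I1 I1 (R I2 I2 v) = R I2 I2 (R I1 I1 v) + sc (Q ^ 2 - 1) (R I2 I1 (R I1 I2 v))"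
begin

definition word_act :: "'v \<Rightarrow> mword \<Rightarrow> 'v" where
  "word_act v w = fold (\<lambda>(i, j). R (\<sigma> i) (\<sigma> j)) (letters w) v"

definition free_act :: "'v \<Rightarrow> free_alg \<Rightarrow> 'v" where
  "free_act v = pm_extend (\<lambda>w c. sc c (word_act v w))"

lemma R_0 [simp]: "R i j 0 = 0"
  using R_add[of i j 0 0] by simp

lemma word_act_add: "word_act (u + v) w = word_act u w + word_act v w"
proof -
  have "fold (\<lambda>(i, j). R (\<sigma> i) (\<sigma> j)) ls (u + v)
    = fold (\<lambda>(i, j). R (\<sigma> i) (\<sigma> j)) ls u + fold (\<lambda>(i, j). R (\<sigma> i) (\<sigma> j)) ls v" for ls
    by (induction ls arbitrary: u v) (auto simp: R_add)
  then show ?thesis by (simp add: word_act_def)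
qed

lemma word_act_scale: "word_act (sc c v) w = sc c (word_act v w)"
proof -
  have "fold (\<lambda>(i, j). R (\<sigma> i) (\<sigma> j)) ls (sc c v) = sc c (fold (\<lambda>(i, j). R (\<sigma> i) (\<sigma> j)) ls v)" for ls
    by (induction ls arbitrary: v) (auto simp: R_scale)
  then show ?thesis by (simp add: word_act_def)
qed

lemma word_act_plus: "word_act v (w + w') = word_act (word_act v w) w'"
  by (simp add: word_act_def plus_mword_def)

lemma free_act_single: "free_act v (Poly_Mapping.single w c) = sc c (word_act v w)"
  by (simp add: free_act_def pm_extend_single)

lemma free_act_plus: "free_act v (F + G) = free_act v F + free_act v G"
  unfolding free_act_def by (rule pm_extend_add) (simp_all add: scale_left_distrib)

lemma free_act_0 [simp]: "free_act v 0 = 0"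
  by (simp add: free_act_def)

lemma free_act_minus: "free_act v (F - G) = free_act v F - free_act v G"
  using free_act_plus[of v "F - G" G] by simp

lemma free_act_add_left: "free_act (u + v) F = free_act u F + free_act v F"
  by (simp add: free_act_def pm_extend_def word_act_add scale_right_distrib sum.distrib)

lemma free_act_scale_left: "free_act (sc c v) F = sc c (free_act v F)"
  by (simp add: free_act_def pm_extend_def word_act_scale scale_sum_right mult.commute)

lemma free_act_0_left [simp]: "free_act 0 F = 0"
  using free_act_add_left[of 0 0 F] by simp

lemma free_act_mult: "free_act v (F * G) = free_act (free_act v F) G"
proof (induction F rule: poly_mapping_single_induct)
  case zero
  then show ?case by simp
next
  case (single w c)
  show ?case
  proof (induction G rule: poly_mapping_single_induct)
    case zero
    then show ?case by simp
  next
    case (single w' c')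
    then show ?case
      by (simp add: mult_single free_act_single word_act_plus word_act_scale mult.commute)
  next
    case (add G H)
    then show ?case by (simp add: distrib_left free_act_plus)
  qed
next
  case (add F G)
  then show ?case by (simp add: distrib_right free_act_plus free_act_add_left)
qed

lemma free_act_const [simp]: "free_act v (free_const c) = sc c v"
  by (simp add: free_const_def free_act_single word_act_def zero_mword_def)

lemma free_act_x [simp]: "free_act v (free_x i j) = R (\<sigma> i) (\<sigma> j) v"
  by (simp add: free_x_def free_act_single word_act_def)

lemma free_act_relators: "r \<in> mink_relators \<Longrightarrow> free_act v r = 0"
proof -
  have cancel: "inverse c * (inverse c * (c * c)) = 1" "c * (c * (inverse c * inverse c)) = 1"
    if "c \<noteq> 0" for c :: cq
    using that by (simp_all add: field_simps)
  note act_simps = mink_relators_def Let_def free_act_plus free_act_minus free_act_mult R_relations R_scale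
    scale_left_diff_distrib power2_eq_square mult.assoc
  assume r: "r \<in> mink_relators"
  show ?thesis
  proof (cases rule: chart_cases)
    case 1
    show ?thesis using r unfolding mink_relators_def Let_def by (auto simp: act_simps 1 cancel)
  next
    case 2
    show ?thesis using r unfolding mink_relators_def Let_def by (auto simp: act_simps 2 cancel)
  qed
qed

text \<open>In \<open>a * r * b\<close> the relator acts on whatever vector \<open>a\<close> has
  produced, so it is essential that relators annihilate every vector; \<open>b\<close> then acts on
  zero.\<close>

lemma free_act_ideal: "F \<in> mink_ideal \<Longrightarrow> free_act v F = 0"
  unfolding mink_ideal_def
  by (induction rule: subgroup_gen.induct) (auto simp: free_act_minus free_act_mult free_act_relators)

definition act :: "'v \<Rightarrow> qmink \<Rightarrow> 'v" where
  "act v f = free_act v (rep_qmink f)"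

text \<open>Two representatives differ by an element of the ideal, which acts as zero, so the choice
  made by \<open>rep_qmink\<close> does not matter.\<close>

lemma act_abs: "act v (abs_qmink F) = free_act v F"
proof -
  have "mink_eq (rep_qmink (abs_qmink F)) F"
    by (simp add: Quotient3_rel_rep[OF Quotient3_qmink] Quotient3_rep_abs[OF Quotient3_qmink] mink_eqI)
  then have "free_act v (rep_qmink (abs_qmink F) - F) = 0"
    unfolding mink_eq_def by (rule free_act_ideal)
  then show ?thesis by (simp add: act_def free_act_minus)
qed

lemma act_add_left: "act (u + v) f = act u f + act v f"
  and act_scale_left: "act (sc c v) f = sc c (act v f)"
  by (simp_all add: act_def free_act_add_left free_act_scale_left)

lemma act_add: "act v (f + g) = act v f + act v g"
  by (induct f; induct g) (simp add: plus_qmink.abs_eq act_abs free_act_plus)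

lemma act_mult: "act v (f * g) = act (act v f) g"
  by (induct f; induct g) (simp add: times_qmink.abs_eq act_abs free_act_mult)

lemma act_const [simp]: "act v (mink_const c) = sc c v"
  by (simp add: mink_const.abs_eq act_abs)

lemma act_y [simp]: "act v (y i j) = R i j v"
  by (simp add: y_def mink_x.abs_eq act_abs)

lemma act_scale: "act v (mink_scale c f) = sc c (act v f)"
  by (simp add: mink_scale_def act_mult act_scale_left)

lemma act_1 [simp]: "act v 1 = v"
  using act_const[of v 1] by (simp add: mink_const_1)

end

section \<open>A basis of ordered monomials\<close>

lemma q_commute_power:
  assumes "b * a = mink_scale c (a * b)"
  shows "b ^ n * a ^ m = mink_scale (c ^ (n * m)) (a ^ m * b ^ n)"
proof -
  have b: "b * a ^ m = mink_scale (c ^ m) (a ^ m * b)" for m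
  proof (induction m)
    case (Suc m)
    have "b * a ^ Suc m = (b * a) * a ^ m" by (simp add: mult.assoc)
    also have "\<dots> = mink_scale c (a * (b * a ^ m))" by (simp add: assms mult.assoc)
    finally show ?case by (simp add: Suc mult.assoc)
  qed simp
  show ?thesis
  proof (induction n)
    case (Suc n)
    have "b ^ Suc n * a ^ m = b * (b ^ n * a ^ m)" by (simp add: mult.assoc)
    also have "\<dots> = mink_scale (c ^ (n * m)) ((b * a ^ m) * b ^ n)"
      by (simp add: Suc mult.assoc)
    finally show ?case by (simp add: b mult.assoc power_add mult.commute)
  qed simp
qed

definition fun_scale :: "cq \<Rightarrow> (nat \<Rightarrow> nat \<Rightarrow> nat \<Rightarrow> nat \<Rightarrow> cq) \<Rightarrow> nat \<Rightarrow> nat \<Rightarrow> nat \<Rightarrow> nat \<Rightarrow> cq" where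
  "fun_scale c v A B C D = c * v A B C D"

definition delta :: "nat \<Rightarrow> nat \<Rightarrow> nat \<Rightarrow> nat \<Rightarrow> nat \<Rightarrow> nat \<Rightarrow> nat \<Rightarrow> nat \<Rightarrow> cq" where
  "delta a b c d A B C D = of_bool ((A, B, C, D) = (a, b, c, d))"

context chart
begin

definition pbw :: "nat \<Rightarrow> nat \<Rightarrow> nat \<Rightarrow> nat \<Rightarrow> qmink" where
  "pbw A B C D = y I1 I1 ^ A * y I1 I2 ^ B * y I2 I1 ^ C * y I2 I2 ^ D"

lemma power_commute:
  "y I1 I2 ^ n * y I1 I1 ^ m = y I1 I1 ^ m * y I1 I2 ^ n"
  "y I2 I2 ^ n * y I2 I1 ^ m = y I2 I1 ^ m * y I2 I2 ^ n"
  "y I2 I1 ^ n * y I1 I1 ^ m = mink_scale (Q ^ (2 * n * m)) (y I1 I1 ^ m * y I2 I1 ^ n)"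
  "y I2 I2 ^ n * y I1 I2 ^ m = mink_scale (Q ^ (2 * n * m)) (y I1 I2 ^ m * y I2 I2 ^ n)"
  "y I2 I1 ^ n * y I1 I2 ^ m = mink_scale (Q ^ (2 * n * m)) (y I1 I2 ^ m * y I2 I1 ^ n)"
  using q_commute_power[of "y I1 I2" "y I1 I1" 1] q_commute_power[of "y I2 I2" "y I2 I1" 1]
    q_commute_power[OF y_commute(3)] q_commute_power[OF y_commute(4)] q_commute_power[OF y_commute(5)]
  by (simp_all add: y_commute(1,2) mult.assoc flip: power_mult)

text \<open>Each further \<open>y22\<close> contributes a correction term, and these telescope:
  \<open>(Q^2 - 1) (1 + Q^2 + ... + Q^(2n)) = Q^(2n+2) - 1\<close>.\<close>

lemma power_commute_22_11:
  "y I2 I2 ^ Suc n * y I1 I1 = y I1 I1 * y I2 I2 ^ Suc n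
    + mink_scale (Q ^ (2 * n + 2) - 1) (y I1 I2 * y I2 I1 * y I2 I2 ^ n)"
proof (induction n)
  case 0
  show ?case using y_commute(6) by (simp add: power2_eq_square)
next
  case (Suc n)
  have "y I2 I2 ^ Suc (Suc n) * y I1 I1 = y I2 I2 ^ Suc n * (y I2 I2 * y I1 I1)"
    by (simp add: power_Suc2 mult.assoc del: power_Suc)
  also have "\<dots> = (y I2 I2 ^ Suc n * y I1 I1) * y I2 I2
      + mink_scale (Q ^ 2 - 1) ((y I2 I2 ^ Suc n * y I1 I2) * y I2 I1)"
    by (simp only: y_commute(6) distrib_left mink_scale_mult_right mult.assoc)
  also have "(y I2 I2 ^ Suc n * y I1 I2) * y I2 I1
      = mink_scale (Q ^ (2 * n + 2)) (y I1 I2 * y I2 I1 * y I2 I2 ^ Suc n)"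
    using power_commute(4)[of "Suc n" 1] power_commute(2)[of "Suc n" 1] by (simp add: mult.assoc)
  also have "(y I2 I2 ^ Suc n * y I1 I1) * y I2 I2 = y I1 I1 * y I2 I2 ^ Suc (Suc n)
      + mink_scale (Q ^ (2 * n + 2) - 1) (y I1 I2 * y I2 I1 * y I2 I2 ^ Suc n)"
    unfolding Suc by (simp only: distrib_right mink_scale_mult_left mult.assoc power_Suc2)
  finally have "y I2 I2 ^ Suc (Suc n) * y I1 I1 = y I1 I1 * y I2 I2 ^ Suc (Suc n)
      + mink_scale (Q ^ (2 * n + 2) - 1 + (Q ^ 2 - 1) * Q ^ (2 * n + 2)) (y I1 I2 * y I2 I1 * y I2 I2 ^ Suc n)"
    by (simp only: mink.scale_left_distrib mink.scale_scale add.assoc)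
  also have "Q ^ (2 * n + 2) - 1 + (Q ^ 2 - 1) * Q ^ (2 * n + 2) = Q ^ (2 * Suc n + 2) - 1"
    by (simp add: algebra_simps power2_eq_square)
  finally show ?case .
qed

lemma pbw_mult_y:
  "pbw A B C D * y I2 I2 = pbw A B C (Suc D)"
  "pbw A B C D * y I2 I1 = pbw A B (Suc C) D"
  "pbw A B C D * y I1 I2 = mink_scale (Q ^ (2 * (C + D))) (pbw A (Suc B) C D)"
  "pbw A B C 0 * y I1 I1 = mink_scale (Q ^ (2 * C)) (pbw (Suc A) B C 0)"
  "pbw A B C (Suc D) * y I1 I1 = mink_scale (Q ^ (2 * C)) (pbw (Suc A) B C (Suc D))
    + mink_scale (Q ^ (2 * C) * (Q ^ (2 * D + 2) - 1)) (pbw A (Suc B) (Suc C) D)"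
proof -
  note pc = power_commute[of _ 1, simplified]
  show "pbw A B C D * y I2 I2 = pbw A B C (Suc D)"
    by (simp add: pbw_def mult.assoc power_Suc2 del: power_Suc)
  show "pbw A B C D * y I2 I1 = pbw A B (Suc C) D"
    by (simp add: pbw_def mult.assoc pc power_Suc2 del: power_Suc)
  have right: "u * v * z = u * w" if "v * z = w" for u v w z :: qmink
    using that by (simp add: mult.assoc)
  have y12: "y I1 I1 ^ A * y I1 I2 ^ B * y I2 I1 ^ C * y I1 I2
      = mink_scale (Q ^ (2 * C)) (y I1 I1 ^ A * y I1 I2 ^ Suc B * y I2 I1 ^ C)"
    by (simp only: right[OF pc(5)]) (simp add: mult.assoc power_Suc2 del: power_Suc)
  then show "pbw A B C D * y I1 I2 = mink_scale (Q ^ (2 * (C + D))) (pbw A (Suc B) C D)"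
    unfolding pbw_def
    by (simp only: right[OF pc(4)] mink_scale_mult_right mink_scale_mult_left mink.scale_scale
      flip: mult.assoc) (simp add: power_add distrib_left mult.commute)
  have y11: "y I1 I1 ^ A * y I1 I2 ^ B * y I2 I1 ^ C * y I1 I1
      = mink_scale (Q ^ (2 * C)) (y I1 I1 ^ Suc A * y I1 I2 ^ B * y I2 I1 ^ C)"
  proof -
    have "y I1 I1 ^ A * y I1 I2 ^ B * y I2 I1 ^ C * y I1 I1
        = mink_scale (Q ^ (2 * C)) ((y I1 I1 ^ A * y I1 I2 ^ B * y I1 I1) * y I2 I1 ^ C)"
      by (simp only: right[OF pc(3)]) (simp add: mult.assoc)
    also have "y I1 I1 ^ A * y I1 I2 ^ B * y I1 I1 = y I1 I1 ^ Suc A * y I1 I2 ^ B"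
      by (simp only: right[OF pc(1)]) (simp add: mult.assoc power_Suc2 del: power_Suc)
    finally show ?thesis .
  qed
  then show "pbw A B C 0 * y I1 I1 = mink_scale (Q ^ (2 * C)) (pbw (Suc A) B C 0)"
    by (simp add: pbw_def)
  have "pbw A B C (Suc D) * y I1 I1
      = (y I1 I1 ^ A * y I1 I2 ^ B * y I2 I1 ^ C * y I1 I1) * y I2 I2 ^ Suc D
        + mink_scale (Q ^ (2 * D + 2) - 1) ((y I1 I1 ^ A * y I1 I2 ^ B * y I2 I1 ^ C * y I1 I2) * y I2 I1 * y I2 I2 ^ D)"
    unfolding pbw_def right[OF power_commute_22_11]
    by (simp only: distrib_left mink_scale_mult_right mult.assoc)
  then show "pbw A B C (Suc D) * y I1 I1 = mink_scale (Q ^ (2 * C)) (pbw (Suc A) B C (Suc D))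
    + mink_scale (Q ^ (2 * C) * (Q ^ (2 * D + 2) - 1)) (pbw A (Suc B) (Suc C) D)"
    unfolding y11 y12 by (simp add: pbw_def mult.assoc power_Suc2 mult.commute[of "Q ^ (2 * C)"] del: power_Suc)
qed

lemma mink_span_pbw: "f \<in> mink.span {f. \<exists>A B C D. f = pbw A B C D}" (is "f \<in> mink.span ?S")
proof (induction f rule: qmink_y_induct)
  case (const c)
  have "pbw 0 0 0 0 \<in> mink.span ?S" by (rule mink.span_base) blast
  then have "mink_scale c (pbw 0 0 0 0) \<in> mink.span ?S" by (rule mink.span_scale)
  then show ?case by (simp add: pbw_def mink_const_eq)
next
  case (add f g)
  then show ?case by (rule mink.span_add)
next
  case (mult f i j)
  have span: "pbw A B C D \<in> mink.span ?S" for A B C D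
    by (rule mink.span_base) blast
  have right: "pbw A B C D * y i j \<in> mink.span ?S" for A B C D
    by (cases i; cases j; cases D) (auto simp: pbw_mult_y intro!: mink.span_add mink.span_scale span)
  from mult show ?case
  proof (induction f rule: mink.span_induct)
    case base
    show ?case
      by (auto simp: mink.subspace_def distrib_right intro: mink.span_zero mink.span_add mink.span_scale)
  qed (auto intro: right)
qed

text \<open>Right multiplication on coefficient functions with respect to the ordered monomials. It makes
  sense without finite support, and letting it act on \<open>delta 0 0 0 0\<close> separates the monomials.\<close>

definition coeff_act :: "idx \<Rightarrow> idx \<Rightarrow> (nat \<Rightarrow> nat \<Rightarrow> nat \<Rightarrow> nat \<Rightarrow> cq) \<Rightarrow> nat \<Rightarrow> nat \<Rightarrow> nat \<Rightarrow> nat \<Rightarrow> cq" where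
  "coeff_act i j v A B C D =
    (case (i, j) of
      (I1, I1) \<Rightarrow> (case A of 0 \<Rightarrow> 0 | Suc A' \<Rightarrow> Q ^ (2 * C) * v A' B C D)
        + (case B of 0 \<Rightarrow> 0 | Suc B' \<Rightarrow> (case C of 0 \<Rightarrow> 0 | Suc C' \<Rightarrow>
            Q ^ (2 * C') * (Q ^ (2 * D + 2) - 1) * v A B' C' (Suc D)))
    | (I1, I2) \<Rightarrow> (case B of 0 \<Rightarrow> 0 | Suc B' \<Rightarrow> Q ^ (2 * (C + D)) * v A B' C D)
    | (I2, I1) \<Rightarrow> (case C of 0 \<Rightarrow> 0 | Suc C' \<Rightarrow> v A B C' D)
    | (I2, I2) \<Rightarrow> (case D of 0 \<Rightarrow> 0 | Suc D' \<Rightarrow> v A B C D'))"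

end

text \<open>That the six relations hold on coefficient functions says that the reordering rules are
  consistent, which is what the diamond lemma would check on overlapping words.\<close>

sublocale chart \<subseteq> model: right_module \<sigma> Q fun_scale coeff_act
proof unfold_locales
  fix i j c u and v :: "nat \<Rightarrow> nat \<Rightarrow> nat \<Rightarrow> nat \<Rightarrow> cq"
  show "coeff_act i j (u + v) = coeff_act i j u + coeff_act i j v"
    by (intro ext, cases i; cases j) (auto simp: coeff_act_def algebra_simps split: nat.split)
  show "coeff_act i j (fun_scale c v) = fun_scale c (coeff_act i j v)"
    by (intro ext, cases i; cases j) (auto simp: coeff_act_def fun_scale_def algebra_simps split: nat.split)
qed (intro ext, force simp: coeff_act_def fun_scale_def algebra_simps power_add power2_eq_square split: nat.split)+

context chart
begin

definition pbw_coeff :: "qmink \<Rightarrow> nat \<Rightarrow> nat \<Rightarrow> nat \<Rightarrow> nat \<Rightarrow> cq" where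
  "pbw_coeff f = model.act (delta 0 0 0 0) f"

text \<open>The generators arrive in the order 11, 12, 21, 22. When one of them acts, all later
  exponents are still zero, so it shifts a single index without any factor.\<close>

lemma pbw_coeff_pbw: "pbw_coeff (pbw a b c d) = delta a b c d"
proof -
  have delta_act: "coeff_act I1 I1 (delta a 0 0 0) = delta (Suc a) 0 0 0"
    "coeff_act I1 I2 (delta a b 0 0) = delta a (Suc b) 0 0"
    "coeff_act I2 I1 (delta a b c 0) = delta a b (Suc c) 0"
    "coeff_act I2 I2 (delta a b c d) = delta a b c (Suc d)" for a b c d
    by (intro ext, auto simp: coeff_act_def delta_def split: nat.split)+
  have "model.act (delta a 0 0 0) (y I1 I1 ^ n) = delta (a + n) 0 0 0" for a n
    by (induction n) (simp_all add: power_Suc2 model.act_mult delta_act del: power_Suc)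
  moreover have "model.act (delta a b 0 0) (y I1 I2 ^ n) = delta a (b + n) 0 0" for a b n
    by (induction n) (simp_all add: power_Suc2 model.act_mult delta_act del: power_Suc)
  moreover have "model.act (delta a b c 0) (y I2 I1 ^ n) = delta a b (c + n) 0" for a b c n
    by (induction n) (simp_all add: power_Suc2 model.act_mult delta_act del: power_Suc)
  moreover have "model.act (delta a b c d) (y I2 I2 ^ n) = delta a b c (d + n)" for a b c d n
    by (induction n) (simp_all add: power_Suc2 model.act_mult delta_act del: power_Suc)
  ultimately show ?thesis by (simp add: pbw_coeff_def pbw_def model.act_mult)
qed

lemma pbw_coeff_add: "pbw_coeff (f + g) A B C D = pbw_coeff f A B C D + pbw_coeff g A B C D"
  and pbw_coeff_scale: "pbw_coeff (mink_scale c f) A B C D = c * pbw_coeff f A B C D"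
  by (simp_all add: pbw_coeff_def model.act_add model.act_scale fun_scale_def)

end

section \<open>The differential calculus\<close>

type_synonym jet = "qmink \<times> (idx \<Rightarrow> idx \<Rightarrow> qmink)"

definition jet_scale :: "cq \<Rightarrow> jet \<Rightarrow> jet" where
  "jet_scale c v = (mink_scale c (fst v), \<lambda>r s. mink_scale c (snd v r s))"

definition jet_mult :: "qmink \<Rightarrow> jet \<Rightarrow> jet" where
  "jet_mult f v = (f * fst v, \<lambda>r s. f * snd v r s)"

lemma jet_scale_sel [simp]: "fst (jet_scale c v) = mink_scale c (fst v)"
  "snd (jet_scale c v) r s = mink_scale c (snd v r s)"
  by (simp_all add: jet_scale_def)

lemma jet_mult_sel [simp]: "fst (jet_mult f v) = f * fst v" "snd (jet_mult f v) r s = f * snd v r s"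
  by (simp_all add: jet_mult_def)

lemma jet_eqI: "fst u = fst v \<Longrightarrow> (\<And>m n. snd u m n = snd v m n) \<Longrightarrow> u = (v :: jet)"
  by (simp add: prod_eq_iff fun_eq_iff)

lemma mink_scale_2: "mink_scale 2 f = f + f"
  using mink.scale_left_distrib[of 1 1 f] by simp

context chart
begin

definition Rc :: "idx \<Rightarrow> idx \<Rightarrow> idx \<Rightarrow> idx \<Rightarrow> cq" where
  "Rc i j m n = R_matrix (inverse Q) (\<sigma> i) (\<sigma> j) (\<sigma> m) (\<sigma> n)"

text \<open>With \<open>p = Q^-1\<close>, exactly one of the two off-diagonal entries survives, and
  it is the same one in both charts. This makes the calculus triangular.\<close>

lemma Rc_values:
  "Rc I1 I1 I1 I1 = Q" "Rc I2 I2 I2 I2 = Q" "Rc I1 I2 I1 I2 = Q" "Rc I2 I1 I2 I1 = inverse Q"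
  "Rc I1 I2 I2 I1 = Q - inverse Q" "Rc I2 I1 I1 I2 = 0"
  "Rc I1 I1 I1 I2 = 0" "Rc I1 I1 I2 I1 = 0" "Rc I1 I1 I2 I2 = 0"
  "Rc I2 I2 I1 I2 = 0" "Rc I2 I2 I2 I1 = 0" "Rc I2 I2 I1 I1 = 0"
  "Rc I1 I2 I1 I1 = 0" "Rc I1 I2 I2 I2 = 0" "Rc I2 I1 I1 I1 = 0" "Rc I2 I1 I2 I2 = 0"
  unfolding Rc_def by (cases rule: chart_cases; simp)+

text \<open>A pair \<open>(f, w)\<close> stands for \<open>f\<close> together with the 1-form with coefficients \<open>w\<close>. Right multiplication
  is arranged such that \<open>(f, df) g = (f g, d(f g))\<close>.\<close>

definition jet_act :: "idx \<Rightarrow> idx \<Rightarrow> jet \<Rightarrow> jet" where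
  "jet_act i k v =
    (fst v * y i k,
     \<lambda>n b. (\<Sum>j\<in>UNIV. \<Sum>l\<in>UNIV. \<Sum>m\<in>UNIV. \<Sum>a\<in>UNIV.
        mink_scale (Rc i j m n * Rc b a l k) (snd v j l * y m a)) + (if (n, b) = (i, k) then fst v else 0))"

lemma fst_jet_act [simp]: "fst (jet_act i k v) = fst v * y i k"
  by (simp add: jet_act_def)

text \<open>Among the form coefficients, the one at \<open>I2 I2\<close> depends only on itself,
  those at \<open>I2 I1\<close> and \<open>I1 I2\<close> also on that one, and the one at
  \<open>I1 I1\<close> on all four; the derivatives are later computed in this order. The two
  bracketed scalars in the first formula combine to \<open>(Q - Q^-1)^2\<close>.\<close>

lemma jet_act_values:
  "snd (jet_act I1 I1 v) I1 I1 = mink_scale (Q * Q) (snd v I1 I1 * y I1 I1)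
    + mink_scale (Q * Q - 1) (snd v I1 I2 * y I1 I2) + mink_scale (Q * Q - 1) (snd v I2 I1 * y I2 I1)
    + (mink_scale (Q * Q - 1) (snd v I2 I2 * y I2 I2)
      - mink_scale (1 - inverse Q * inverse Q) (snd v I2 I2 * y I2 I2)) + fst v"
  "snd (jet_act I1 I1 v) I1 I2 = snd v I1 I2 * y I1 I1
    + mink_scale (1 - inverse Q * inverse Q) (snd v I2 I2 * y I2 I1)"
  "snd (jet_act I1 I1 v) I2 I1 = mink_scale (Q * Q) (snd v I2 I1 * y I1 I1)
    + mink_scale (Q * Q - 1) (snd v I2 I2 * y I1 I2)"
  "snd (jet_act I1 I1 v) I2 I2 = snd v I2 I2 * y I1 I1"
  "snd (jet_act I1 I2 v) I1 I1 = mink_scale (Q * Q) (snd v I1 I1 * y I1 I2)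
    + mink_scale (Q * Q - 1) (snd v I2 I1 * y I2 I2)"
  "snd (jet_act I1 I2 v) I1 I2 = mink_scale (Q * Q) (snd v I1 I2 * y I1 I2)
    + mink_scale (Q * Q - 1) (snd v I2 I2 * y I2 I2) + fst v"
  "snd (jet_act I1 I2 v) I2 I1 = mink_scale (Q * Q) (snd v I2 I1 * y I1 I2)"
  "snd (jet_act I1 I2 v) I2 I2 = mink_scale (Q * Q) (snd v I2 I2 * y I1 I2)"
  "snd (jet_act I2 I1 v) I1 I1 = snd v I1 I1 * y I2 I1
    + mink_scale (1 - inverse Q * inverse Q) (snd v I1 I2 * y I2 I2)"
  "snd (jet_act I2 I1 v) I1 I2 = mink_scale (inverse Q * inverse Q) (snd v I1 I2 * y I2 I1)"
  "snd (jet_act I2 I1 v) I2 I1 = mink_scale (Q * Q) (snd v I2 I1 * y I2 I1)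
    + mink_scale (Q * Q - 1) (snd v I2 I2 * y I2 I2) + fst v"
  "snd (jet_act I2 I1 v) I2 I2 = snd v I2 I2 * y I2 I1"
  "snd (jet_act I2 I2 v) I1 I1 = snd v I1 I1 * y I2 I2"
  "snd (jet_act I2 I2 v) I1 I2 = snd v I1 I2 * y I2 I2"
  "snd (jet_act I2 I2 v) I2 I1 = mink_scale (Q * Q) (snd v I2 I1 * y I2 I2)"
  "snd (jet_act I2 I2 v) I2 I2 = mink_scale (Q * Q) (snd v I2 I2 * y I2 I2) + fst v"
  by (simp_all add: jet_act_def UNIV_idx Rc_values algebra_simps mink_scale_2)

end

text \<open>This is the consistency of the calculus. The terms in the form coefficients show that
  the commutation rule of forms respects the relations of the algebra; the terms in
  \<open>fst v\<close> show that \<open>d\<close> respects them.\<close>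

sublocale chart \<subseteq> calc: right_module \<sigma> Q jet_scale jet_act
proof unfold_locales
  fix a b c :: cq and i j and u v :: jet
  show "jet_scale a (u + v) = jet_scale a u + jet_scale a v"
    "jet_scale (a + b) u = jet_scale a u + jet_scale b u"
    "jet_scale a (jet_scale b u) = jet_scale (a * b) u"
    "jet_scale 1 u = u"
    by (rule jet_eqI; simp add: mink.scale_right_distrib mink.scale_left_distrib)+
  show "jet_act i j (u + v) = jet_act i j u + jet_act i j v"
    by (rule jet_eqI)
      (simp_all add: jet_act_def distrib_right mink.scale_right_distrib sum.distrib algebra_simps)
  show "jet_act i j (jet_scale c v) = jet_scale c (jet_act i j v)"
    by (rule jet_eqI)
      (simp_all add: jet_act_def mink.scale_right_distrib mink.scale_sum_right mult.commute)
  have cancel: "Q * (inverse Q * c) = c" "inverse Q * (Q * c) = c" for c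
    by simp_all
  note simps = jet_act_values distrib_right mult.assoc y_commute mink.scale_right_distrib
    mink.scale_left_distrib mink.scale_left_diff_distrib mink.scale_right_diff_distrib
    power2_eq_square algebra_simps cancel
  show "jet_act I1 I1 (jet_act I1 I2 v) = jet_act I1 I2 (jet_act I1 I1 v)"
    by (rule jet_eqI, simp add: simps, (case_tac m; case_tac n; simp add: simps))
  show "jet_act I2 I1 (jet_act I2 I2 v) = jet_act I2 I2 (jet_act I2 I1 v)"
    by (rule jet_eqI, simp add: simps, (case_tac m; case_tac n; simp add: simps))
  show "jet_act I1 I1 (jet_act I2 I1 v) = jet_scale (Q ^ 2) (jet_act I2 I1 (jet_act I1 I1 v))"
    by (rule jet_eqI, simp add: simps, (case_tac m; case_tac n; simp add: simps))
  show "jet_act I1 I2 (jet_act I2 I2 v) = jet_scale (Q ^ 2) (jet_act I2 I2 (jet_act I1 I2 v))"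
    by (rule jet_eqI, simp add: simps, (case_tac m; case_tac n; simp add: simps))
  show "jet_act I1 I2 (jet_act I2 I1 v) = jet_scale (Q ^ 2) (jet_act I2 I1 (jet_act I1 I2 v))"
    by (rule jet_eqI, simp add: simps, (case_tac m; case_tac n; simp add: simps))
  show "jet_act I1 I1 (jet_act I2 I2 v)
      = jet_act I2 I2 (jet_act I1 I1 v) + jet_scale (Q ^ 2 - 1) (jet_act I2 I1 (jet_act I1 I2 v))"
    by (rule jet_eqI, simp add: simps, (case_tac m; case_tac n; simp add: simps))
qed

section \<open>Formal 1-forms up to congruence\<close>

lemma form_eq_refl: "form_eq p \<omega> \<omega>"
  by (simp add: form_eq_def subgroup_gen.zero)

lemma form_eq_sym: "form_eq p \<omega> \<eta> \<Longrightarrow> form_eq p \<eta> \<omega>"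
  unfolding form_eq_def using subgroup_gen_uminus by fastforce

lemma form_eq_trans [trans]: "form_eq p \<omega> \<eta> \<Longrightarrow> form_eq p \<eta> \<theta> \<Longrightarrow> form_eq p \<omega> \<theta>"
  unfolding form_eq_def using subgroup_gen_add by fastforce

lemma form_eq_add: "form_eq p \<omega> \<eta> \<Longrightarrow> form_eq p \<omega>' \<eta>' \<Longrightarrow> form_eq p (\<omega> + \<omega>') (\<eta> + \<eta>')"
  unfolding form_eq_def by (simp add: add_diff_add subgroup_gen_add)

lemma form_eq_sum: "(\<And>i. i \<in> I \<Longrightarrow> form_eq p (F i) (G i)) \<Longrightarrow> form_eq p (sum F I) (sum G I)"
  by (induction I rule: infinite_finite_induct) (simp_all add: form_eq_refl form_eq_add)

lemma lact_diff: "lact f (\<omega> - \<eta>) = lact f \<omega> - lact f \<eta>"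
  and lact_add: "lact f (\<omega> + \<eta>) = lact f \<omega> + lact f \<eta>"
  and lact_0: "lact f 0 = 0"
  and lact_frag: "lact f (frag_of (a, g, b)) = frag_of (f * a, g, b)"
  by (simp_all add: lact_def frag_extend_diff frag_extend_add)

lemma ract_diff: "ract (\<omega> - \<eta>) f = ract \<omega> f - ract \<eta> f"
  and ract_add: "ract (\<omega> + \<eta>) f = ract \<omega> f + ract \<eta> f"
  and ract_0: "ract 0 f = 0"
  and ract_frag: "ract (frag_of (a, g, b)) f = frag_of (a, g, b * f)"
  by (simp_all add: ract_def frag_extend_diff frag_extend_add)

lemma lact_sum: "lact f (sum F I) = (\<Sum>i\<in>I. lact f (F i))"
  and ract_sum: "ract (sum F I) f = (\<Sum>i\<in>I. ract (F i) f)"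
  by (induction I rule: infinite_finite_induct) (simp_all add: lact_add lact_0 ract_add ract_0)

lemma lact_lact: "lact f (lact g \<omega>) = lact (f * g) \<omega>"
  by (induction \<omega> rule: frag_induction[OF subset_UNIV])
    (auto simp: lact_0 lact_diff lact_frag mult.assoc)

lemma ract_ract: "ract (ract \<omega> f) g = ract \<omega> (f * g)"
  by (induction \<omega> rule: frag_induction[OF subset_UNIV])
    (auto simp: ract_0 ract_diff ract_frag mult.assoc)

lemma ract_lact: "ract (lact f \<omega>) g = lact f (ract \<omega> g)"
  by (induction \<omega> rule: frag_induction[OF subset_UNIV])
    (auto simp: lact_0 lact_diff lact_frag ract_0 ract_diff ract_frag)

lemma lact_1: "lact 1 \<omega> = \<omega>"
  by (induction \<omega> rule: frag_induction[OF subset_UNIV])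
    (auto simp: lact_0 lact_diff lact_frag)

lemma ract_1: "ract \<omega> 1 = \<omega>"
  by (induction \<omega> rule: frag_induction[OF subset_UNIV])
    (auto simp: ract_0 ract_diff ract_frag)

definition commutation_form :: "cq \<Rightarrow> idx \<Rightarrow> idx \<Rightarrow> idx \<Rightarrow> idx \<Rightarrow> form" where
  "commutation_form p i j k l = ract (dx j l) (mink_x i k)
    - (\<Sum>m\<in>UNIV. \<Sum>n\<in>UNIV. \<Sum>a\<in>UNIV. \<Sum>b\<in>UNIV.
        lact (mink_scale (R_matrix p i j m n * R_matrix p b a l k) (mink_x m a)) (dx n b))"

lemma form_relators_cases:
  assumes "\<omega> \<in> form_relators p"
  obtains a a' g b where "\<omega> = frag_of (a + a', g, b) - frag_of (a, g, b) - frag_of (a', g, b)"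
    | a g b b' where "\<omega> = frag_of (a, g, b + b') - frag_of (a, g, b) - frag_of (a, g, b')"
    | a c g b where "\<omega> = frag_of (a * mink_const c, g, b) - frag_of (a, g, mink_const c * b)"
    | f h i j k l where "\<omega> = lact f (ract (commutation_form p i j k l) h)"
  using assms unfolding form_relators_def commutation_form_def by blast

lemma form_relatorsI:
  "frag_of (a + a', g, b) - frag_of (a, g, b) - frag_of (a', g, b) \<in> form_relators p"
  "frag_of (a, g, b + b') - frag_of (a, g, b) - frag_of (a, g, b') \<in> form_relators p"
  "frag_of (a * mink_const c, g, b) - frag_of (a, g, mink_const c * b) \<in> form_relators p"
  "lact f (ract (commutation_form p i j k l) h) \<in> form_relators p"
  unfolding form_relators_def commutation_form_def by blast+

lemma form_eq_relator: "\<omega> - \<eta> \<in> form_relators p \<Longrightarrow> form_eq p \<omega> \<eta>"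
  unfolding form_eq_def by (rule subgroup_gen.base)

text \<open>Right multiplication sends each relator to a relator of the same kind.\<close>

lemma form_eq_ract:
  assumes "form_eq p \<omega> \<eta>"
  shows "form_eq p (ract \<omega> g) (ract \<eta> g)"
proof -
  have "ract (\<omega> - \<eta>) g \<in> subgroup_gen (form_relators p)"
    using assms unfolding form_eq_def
  proof (rule subgroup_gen_hom)
    fix \<theta>
    assume "\<theta> \<in> form_relators p"
    then show "ract \<theta> g \<in> subgroup_gen (form_relators p)"
      by (cases rule: form_relators_cases)
        (auto simp: ract_diff ract_frag ract_ract ract_lact distrib_right mult.assoc
          intro!: subgroup_gen.base form_relatorsI)
  qed (rule ract_diff)
  then show ?thesis by (simp add: form_eq_def ract_diff)
qed

lemma form_eq_lact_add: "form_eq p (lact (f + g) (dx i j)) (lact f (dx i j) + lact g (dx i j))"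
  unfolding dx_def lact_frag
  by (rule form_eq_relator) (use form_relatorsI(1)[of f g "(i, j)" 1] in \<open>simp add: diff_diff_eq\<close>)

lemma form_eq_lact_0: "form_eq p (lact 0 (dx i j)) 0"
  using form_eq_lact_add[of p 0 0 i j] unfolding form_eq_def
  by (simp, metis add.inverse_inverse subgroup_gen_uminus)

definition expand_form :: "(idx \<Rightarrow> idx \<Rightarrow> qmink) \<Rightarrow> form" where
  "expand_form c = (\<Sum>i\<in>UNIV. \<Sum>j\<in>UNIV. lact (c i j) (dx i j))"

lemma expand_form_add: "form_eq p (expand_form (\<lambda>i j. u i j + v i j)) (expand_form u + expand_form v)"
  unfolding expand_form_def sum.distrib[symmetric] by (intro form_eq_sum form_eq_lact_add)

lemma lact_expand_form: "lact f (expand_form c) = expand_form (\<lambda>i j. f * c i j)"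
  by (simp add: expand_form_def lact_sum lact_lact)

text \<open>A zero coefficient leaves the symbol \<open>0 dx\<close>, which is congruent to zero
  without being zero as a formal sum.\<close>

lemma expand_form_unit: "form_eq p (expand_form (\<lambda>i j. if (i, j) = (m, n) then f else 0)) (lact f (dx m n))"
proof -
  have "form_eq p (expand_form (\<lambda>i j. if (i, j) = (m, n) then f else 0))
      (\<Sum>i\<in>UNIV. \<Sum>j\<in>UNIV. if (i, j) = (m, n) then lact f (dx m n) else 0)"
    unfolding expand_form_def by (intro form_eq_sum) (simp add: form_eq_refl form_eq_lact_0)
  also have "(\<Sum>i\<in>UNIV. \<Sum>j\<in>UNIV. if (i, j) = (m, n) then lact f (dx m n) else 0) = lact f (dx m n)"
    by (cases m; cases n) (simp_all add: UNIV_idx)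
  finally show ?thesis .
qed

lemma expand_form_0: "form_eq p (expand_form (\<lambda>i j. 0)) 0"
  using form_eq_trans[OF expand_form_unit[of p I1 I1 0] form_eq_lact_0] by simp

lemma expand_form_sum:
  "form_eq p (expand_form (\<lambda>i j. \<Sum>t\<in>T. c t i j)) (\<Sum>t\<in>T. expand_form (c t))"
proof (induction T rule: infinite_finite_induct)
  case (insert t T)
  have "form_eq p (expand_form (\<lambda>i j. c t i j + (\<Sum>t\<in>T. c t i j)))
      (expand_form (c t) + expand_form (\<lambda>i j. \<Sum>t\<in>T. c t i j))"
    by (rule expand_form_add)
  also have "form_eq p \<dots> (expand_form (c t) + (\<Sum>t\<in>T. expand_form (c t)))"
    by (intro form_eq_add form_eq_refl insert)
  finally show ?case using insert by simp
qed (simp_all add: expand_form_0)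

section \<open>Left coefficients of 1-forms and uniqueness of the de Rham operator\<close>

context chart
begin

lemma sum_\<sigma>: "(\<Sum>i\<in>UNIV. F (\<sigma> i)) = (\<Sum>i\<in>UNIV. F i)"
  by (rule sum.reindex_bij_witness[of _ \<sigma> \<sigma>]) auto

lemma sum2_\<sigma>: "(\<Sum>i\<in>UNIV. \<Sum>j\<in>UNIV. F i j) = (\<Sum>i\<in>UNIV. \<Sum>j\<in>UNIV. F (\<sigma> i) (\<sigma> j))"
  using sum_\<sigma>[of "\<lambda>i. \<Sum>j\<in>UNIV. F i j"] by (simp add: sum_\<sigma>)

lemma sum4_\<sigma>: "(\<Sum>i\<in>UNIV. \<Sum>j\<in>UNIV. \<Sum>k\<in>UNIV. \<Sum>l\<in>UNIV. F i j k l)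
    = (\<Sum>i\<in>UNIV. \<Sum>j\<in>UNIV. \<Sum>k\<in>UNIV. \<Sum>l\<in>UNIV. F (\<sigma> i) (\<sigma> j) (\<sigma> k) (\<sigma> l))"
  unfolding sum2_\<sigma>[of "\<lambda>i j. \<Sum>k\<in>UNIV. \<Sum>l\<in>UNIV. F i j k l"] by (intro sum.cong refl sum2_\<sigma>)

lemma \<sigma>_eq_iff: "\<sigma> i = j \<longleftrightarrow> i = \<sigma> j"
  by auto

lemma jet_act_jet_mult: "jet_act i k (jet_mult f v) = jet_mult f (jet_act i k v)"
  by (rule jet_eqI) (simp_all add: jet_act_def sum_distrib_left distrib_left mult.assoc)

lemma act_jet_mult: "calc.act (jet_mult f v) g = jet_mult f (calc.act v g)"
proof (induction g rule: qmink_y_induct)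
  case (const c)
  show ?case by (rule jet_eqI) simp_all
next
  case (add g h)
  then show ?case by (intro jet_eqI) (simp_all add: calc.act_add distrib_left)
next
  case (mult g i j)
  then show ?case by (simp add: calc.act_mult jet_act_jet_mult)
qed

lemma fst_act: "fst (calc.act v g) = fst v * g"
proof (induction g rule: qmink_y_induct)
  case (const c)
  show ?case by (simp add: mult_mink_const)
next
  case (add g h)
  then show ?case by (simp add: calc.act_add distrib_left)
next
  case (mult g i j)
  then show ?case by (simp add: calc.act_mult mult.assoc)
qed

definition form_act :: "(idx \<Rightarrow> idx \<Rightarrow> qmink) \<Rightarrow> qmink \<Rightarrow> idx \<Rightarrow> idx \<Rightarrow> qmink" where
  "form_act w g = snd (calc.act (0, w) g)"

lemma act_form: "calc.act (0, w) g = (0, form_act w g)"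
  by (rule jet_eqI) (simp_all add: form_act_def fst_act)

lemma form_act_mult: "form_act w (f * g) = form_act (form_act w f) g"
  by (simp add: form_act_def[of w "f * g"] calc.act_mult act_form)

lemma form_act_add: "form_act w (f + g) m n = form_act w f m n + form_act w g m n"
  by (simp add: form_act_def calc.act_add)

lemma form_act_add_left: "form_act (u + v) g m n = form_act u g m n + form_act v g m n"
proof -
  have "((0, u + v) :: jet) = (0, u) + (0, v)" by simp
  then show ?thesis by (simp only: form_act_def calc.act_add_left snd_add plus_fun_apply)
qed

lemma form_act_mult_left: "form_act (\<lambda>r s. f * w r s) g = (\<lambda>m n. f * form_act w g m n)"
proof -
  have "((0, \<lambda>r s. f * w r s) :: jet) = jet_mult f (0, w)" by (simp add: jet_mult_def)
  then show ?thesis by (simp add: form_act_def act_jet_mult fun_eq_iff)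
qed

lemma form_act_const [simp]: "form_act w (mink_const c) m n = mink_scale c (w m n)"
  by (simp add: form_act_def)

lemma form_act_0 [simp]: "form_act 0 g = 0"
  using form_act_mult_left[of 0 0 g] by (simp add: fun_eq_iff zero_fun_def)

lemma form_act_1 [simp]: "form_act w 1 = w"
  by (simp add: form_act_def)

definition dcoeff :: "qmink \<Rightarrow> idx \<Rightarrow> idx \<Rightarrow> qmink" where
  "dcoeff f = snd (calc.act (1, 0) f)"

lemma act_1_0: "calc.act (1, 0) f = (f, dcoeff f)"
  by (rule jet_eqI) (simp_all add: dcoeff_def fst_act)

text \<open>Split \<open>(f, df)\<close> as \<open>f (1, 0) + (0, df)\<close>. Acting with
  \<open>g\<close>, the first summand contributes \<open>f dg\<close> because left and right
  multiplication commute, and the second contributes \<open>(df) g\<close>.\<close>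

lemma dcoeff_mult: "dcoeff (f * g) m n = form_act (dcoeff f) g m n + f * dcoeff g m n"
proof -
  have "((f, dcoeff f) :: jet) = jet_mult f (1, 0) + (0, dcoeff f)"
    by (simp add: jet_mult_def fun_eq_iff)
  then have "calc.act (f, dcoeff f) g = jet_mult f (g, dcoeff g) + (0, form_act (dcoeff f) g)"
    by (simp only: calc.act_add_left act_jet_mult act_form act_1_0)
  then show ?thesis
    by (simp add: dcoeff_def[of "f * g"] calc.act_mult act_1_0)
qed

lemma dcoeff_mult_y: "dcoeff (f * y i k) = snd (jet_act i k (f, dcoeff f))"
  by (simp add: dcoeff_def[of "f * y i k"] calc.act_mult act_1_0)

lemma dcoeff_add: "dcoeff (f + g) m n = dcoeff f m n + dcoeff g m n"
  by (simp add: dcoeff_def calc.act_add)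

lemma dcoeff_scale: "dcoeff (mink_scale c f) m n = mink_scale c (dcoeff f m n)"
  by (simp add: dcoeff_def calc.act_scale)

lemma dcoeff_const: "dcoeff (mink_const c) m n = 0"
  by (simp add: dcoeff_def)

lemma dcoeff_y: "dcoeff (y i k) m n = (if (m, n) = (i, k) then 1 else 0)"
  by (simp add: dcoeff_def jet_act_def)

definition unit :: "idx \<Rightarrow> idx \<Rightarrow> idx \<Rightarrow> idx \<Rightarrow> qmink" where
  "unit i j m n = (if (m, n) = (i, j) then 1 else 0)"

text \<open>A symbol \<open>a dx b\<close> is evaluated by letting \<open>b\<close> act on the
  coefficient vector of \<open>dx\<close>. That this annihilates the relators is the left
  independence of the four \<open>dx\<close>.\<close>

definition form_coeff :: "form \<Rightarrow> idx \<Rightarrow> idx \<Rightarrow> qmink" where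
  "form_coeff \<omega> m n =
    pm_extend (\<lambda>(a, (i, j), b) k. of_int k * (a * form_act (unit (\<sigma> i) (\<sigma> j)) b m n)) \<omega>"

lemma form_coeff_diff: "form_coeff (\<omega> - \<eta>) m n = form_coeff \<omega> m n - form_coeff \<eta> m n"
  unfolding form_coeff_def by (rule pm_extend_diff) (auto simp: distrib_right)

lemma form_coeff_add: "form_coeff (\<omega> + \<eta>) m n = form_coeff \<omega> m n + form_coeff \<eta> m n"
  unfolding form_coeff_def by (rule pm_extend_add) (auto simp: distrib_right)

lemma form_coeff_0: "form_coeff 0 m n = 0"
  by (simp add: form_coeff_def)

lemma form_coeff_sum: "form_coeff (sum F I) m n = (\<Sum>i\<in>I. form_coeff (F i) m n)"
  by (induction I rule: infinite_finite_induct) (simp_all add: form_coeff_add form_coeff_0)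

lemma form_coeff_frag:
  "form_coeff (frag_of (a, (i, j), b)) m n = a * form_act (unit (\<sigma> i) (\<sigma> j)) b m n"
  unfolding form_coeff_def by (subst pm_extend_single) auto

lemma form_coeff_lact: "form_coeff (lact f \<omega>) m n = f * form_coeff \<omega> m n"
  by (induction \<omega> rule: frag_induction[OF subset_UNIV])
    (auto simp: form_coeff_0 form_coeff_diff form_coeff_frag lact_0 lact_diff lact_frag
      mult.assoc right_diff_distrib)

lemma form_coeff_ract: "form_coeff (ract \<omega> g) = form_act (form_coeff \<omega>) g"
proof (induction \<omega> rule: frag_induction[OF subset_UNIV])
  case 1
  have "form_coeff 0 = 0" by (simp add: fun_eq_iff form_coeff_0)
  then show ?case by (simp only: ract_0 form_act_0)
next
  case (2 x)
  obtain a i j b where x: "x = (a, (i, j), b)" by (cases x) auto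
  have "form_coeff (frag_of x) = (\<lambda>m n. a * form_act (unit (\<sigma> i) (\<sigma> j)) b m n)"
    by (simp add: x fun_eq_iff form_coeff_frag)
  then show ?case
    by (simp add: x fun_eq_iff ract_frag form_coeff_frag form_act_mult form_act_mult_left)
next
  case (3 \<omega> \<eta>)
  have "form_coeff \<omega> = form_coeff (\<omega> - \<eta>) + form_coeff \<eta>"
    by (simp add: fun_eq_iff form_coeff_diff)
  then have "form_act (form_coeff \<omega>) g m n = form_act (form_coeff (\<omega> - \<eta>)) g m n + form_act (form_coeff \<eta>) g m n" for m n
    by (simp add: form_act_add_left)
  then show ?case
    using 3 by (intro ext) (simp add: ract_diff form_coeff_diff[of "ract \<omega> g" "ract \<eta> g"])
qed

lemma form_coeff_dx: "form_coeff (dx i j) = unit (\<sigma> i) (\<sigma> j)"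
  by (simp add: dx_def fun_eq_iff form_coeff_frag)

lemma form_act_y:
  "form_act w (y i k) = (\<lambda>n b. \<Sum>j\<in>UNIV. \<Sum>l\<in>UNIV. \<Sum>m\<in>UNIV. \<Sum>a\<in>UNIV.
        mink_scale (Rc i j m n * Rc b a l k) (w j l * y m a))"
  by (simp add: form_act_def jet_act_def fun_eq_iff)

lemma form_act_unit_y:
  "form_act (unit j l) (y i k) n b = (\<Sum>m\<in>UNIV. \<Sum>a\<in>UNIV. mink_scale (Rc i j m n * Rc b a l k) (y m a))"
  by (cases j; cases l) (simp_all add: form_act_y unit_def UNIV_idx)

lemma form_coeff_commutation: "form_coeff (commutation_form (inverse Q) i j k l) n b = 0"
proof -
  have "form_coeff (\<Sum>m\<in>UNIV. \<Sum>n\<in>UNIV. \<Sum>a\<in>UNIV. \<Sum>b\<in>UNIV.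
        lact (mink_scale (R_matrix (inverse Q) i j m n * R_matrix (inverse Q) b a l k) (mink_x m a)) (dx n b)) n b
    = (\<Sum>m\<in>UNIV. \<Sum>n'\<in>UNIV. \<Sum>a\<in>UNIV. \<Sum>b'\<in>UNIV.
        mink_scale (R_matrix (inverse Q) i j m n' * R_matrix (inverse Q) b' a l k) (mink_x m a) * unit (\<sigma> n') (\<sigma> b') n b)"
    by (simp only: form_coeff_sum form_coeff_lact form_coeff_dx)
  also have "\<dots> = (\<Sum>m\<in>UNIV. \<Sum>n'\<in>UNIV. \<Sum>a\<in>UNIV. \<Sum>b'\<in>UNIV.
        mink_scale (R_matrix (inverse Q) i j (\<sigma> m) (\<sigma> n') * R_matrix (inverse Q) (\<sigma> b') (\<sigma> a) l k)
          (mink_x (\<sigma> m) (\<sigma> a)) * unit (\<sigma> (\<sigma> n')) (\<sigma> (\<sigma> b')) n b)"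
    by (rule sum4_\<sigma>)
  also have "\<dots> = (\<Sum>m\<in>UNIV. \<Sum>n'\<in>UNIV. \<Sum>a\<in>UNIV. \<Sum>b'\<in>UNIV.
        mink_scale (Rc (\<sigma> i) (\<sigma> j) m n' * Rc b' a (\<sigma> l) (\<sigma> k)) (y m a) * unit n' b' n b)"
    by (simp add: Rc_def y_def)
  also have "\<dots> = form_act (unit (\<sigma> j) (\<sigma> l)) (y (\<sigma> i) (\<sigma> k)) n b"
    unfolding form_act_unit_y by (cases n; cases b) (simp_all add: unit_def UNIV_idx)
  finally show ?thesis
    by (simp add: commutation_form_def form_coeff_diff form_coeff_ract form_coeff_dx mink_x_eq)
qed

lemma form_coeff_relators: "\<omega> \<in> form_relators (inverse Q) \<Longrightarrow> form_coeff \<omega> m n = 0"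
proof -
  assume "\<omega> \<in> form_relators (inverse Q)"
  then show ?thesis
  proof (cases rule: form_relators_cases)
    case (1 a a' g b)
    then show ?thesis by (cases g) (simp add: form_coeff_diff form_coeff_frag distrib_right)
  next
    case (2 a g b b')
    then show ?thesis by (cases g) (simp add: form_coeff_diff form_coeff_frag form_act_add distrib_left)
  next
    case (3 a c g b)
    have "form_act w (mink_const c * b) = (\<lambda>m n. mink_const c * form_act w b m n)" for w
    proof -
      have "form_act w (mink_const c) = (\<lambda>m n. mink_const c * w m n)"
        by (simp add: fun_eq_iff mink_scale_def)
      then show ?thesis by (simp add: form_act_mult form_act_mult_left)
    qed
    then show ?thesis
      using 3 by (cases g) (simp add: form_coeff_diff form_coeff_frag mult.assoc)
  next
    case (4 f h i j k l)
    have "form_coeff (commutation_form (inverse Q) i j k l) = 0"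
      by (simp add: fun_eq_iff form_coeff_commutation)
    then show ?thesis by (simp add: 4 form_coeff_lact form_coeff_ract)
  qed
qed

lemma form_coeff_cong:
  assumes "form_eq (inverse Q) \<omega> \<eta>"
  shows "form_coeff \<omega> = form_coeff \<eta>"
proof (intro ext)
  fix m n
  have "form_coeff \<theta> m n = 0" if "\<theta> \<in> subgroup_gen (form_relators (inverse Q))" for \<theta>
    using that
    by (induction rule: subgroup_gen.induct) (simp_all add: form_coeff_relators form_coeff_0 form_coeff_diff)
  then have "form_coeff (\<omega> - \<eta>) m n = 0"
    using assms by (simp add: form_eq_def)
  then show "form_coeff \<omega> m n = form_coeff \<eta> m n" by (simp add: form_coeff_diff)
qed

lemma form_coeff_expand_form: "form_coeff (expand_form c) m n = c (\<sigma> m) (\<sigma> n)"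
proof -
  have "form_coeff (expand_form c) m n = (\<Sum>i\<in>UNIV. \<Sum>j\<in>UNIV. c i j * unit (\<sigma> i) (\<sigma> j) m n)"
    by (simp add: expand_form_def form_coeff_sum form_coeff_lact form_coeff_dx)
  also have "\<dots> = (\<Sum>i\<in>UNIV. \<Sum>j\<in>UNIV. c (\<sigma> i) (\<sigma> j) * unit (\<sigma> (\<sigma> i)) (\<sigma> (\<sigma> j)) m n)"
    by (rule sum2_\<sigma>)
  also have "\<dots> = c (\<sigma> m) (\<sigma> n)"
    by (cases m; cases n) (simp_all add: unit_def UNIV_idx)
  finally show ?thesis .
qed

text \<open>Both sides obey the same Leibniz rule and agree on generators, so they agree by
  induction along right multiplication.\<close>

lemma form_coeff_de_rham:
  assumes d: "de_rham (inverse Q) d"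
  shows "form_coeff (d f) = dcoeff f"
proof -
  note cong = form_coeff_cong
  have leibniz: "form_coeff (d (f * g)) m n = form_act (form_coeff (d f)) g m n + f * form_coeff (d g) m n" for f g m n
  proof -
    have "form_eq (inverse Q) (d (f * g)) (ract (d f) g + lact f (d g))"
      using d unfolding de_rham_def by blast
    then show ?thesis by (simp add: cong form_coeff_add form_coeff_ract form_coeff_lact)
  qed
  have scale: "form_coeff (d (mink_scale c f)) m n = mink_scale c (form_coeff (d f) m n)" for c f m n
  proof -
    have "form_eq (inverse Q) (d (mink_scale c f)) (lact (mink_const c) (d f))"
      using d unfolding de_rham_def by blast
    then show ?thesis by (simp add: cong form_coeff_lact mink_scale_def)
  qed
  \<comment> \<open>Applied to \<open>1 * 1 = 1\<close>, the Leibniz rule makes the coefficient of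
    \<open>d 1\<close> equal to twice itself.\<close>
  have one: "form_coeff (d 1) m n = 0" for m n
    using leibniz[of 1 1 m n] by simp
  show ?thesis
  proof (induction f rule: qmink_y_induct)
    case (const c)
    show ?case by (simp add: fun_eq_iff mink_const_eq scale one dcoeff_const[unfolded mink_const_eq])
  next
    case (add f g)
    have "form_eq (inverse Q) (d (f + g)) (d f + d g)"
      using d unfolding de_rham_def by blast
    then show ?case using add by (simp add: fun_eq_iff cong form_coeff_add dcoeff_add)
  next
    case (mult f i j)
    have "form_eq (inverse Q) (d (y i j)) (dx (\<sigma> i) (\<sigma> j))"
      using d unfolding de_rham_def y_def by blast
    then have "form_coeff (d (y i j)) = dcoeff (y i j)"
      by (simp add: cong form_coeff_dx fun_eq_iff unit_def dcoeff_y)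
    then show ?case
      using mult.IH by (intro ext) (simp add: leibniz dcoeff_mult)
  qed
qed

section \<open>Existence of the de Rham operator\<close>

definition chart_form :: "(idx \<Rightarrow> idx \<Rightarrow> qmink) \<Rightarrow> form" where
  "chart_form w = expand_form (\<lambda>i j. w (\<sigma> i) (\<sigma> j))"

lemma ract_dx_y: "form_eq (inverse Q) (ract (lact f (dx (\<sigma> j) (\<sigma> l))) (y i k))
    (chart_form (\<lambda>n b. f * form_act (unit j l) (y i k) n b))"
proof -
  let ?c = "\<lambda>m n a b. R_matrix (inverse Q) (\<sigma> i) (\<sigma> j) m n * R_matrix (inverse Q) b a (\<sigma> l) (\<sigma> k)"
  let ?S = "\<Sum>m\<in>UNIV. \<Sum>n\<in>UNIV. \<Sum>a\<in>UNIV. \<Sum>b\<in>UNIV. lact (f * mink_scale (?c m n a b) (mink_x m a)) (dx n b)"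
  have "ract (lact f (dx (\<sigma> j) (\<sigma> l))) (y i k) - ?S
      = lact f (ract (commutation_form (inverse Q) (\<sigma> i) (\<sigma> j) (\<sigma> k) (\<sigma> l)) 1)"
    by (simp add: commutation_form_def ract_1 lact_diff lact_sum lact_lact ract_lact y_def)
  then have "form_eq (inverse Q) (ract (lact f (dx (\<sigma> j) (\<sigma> l))) (y i k)) ?S"
    by (intro form_eq_relator) (simp add: form_relatorsI(4))
  \<comment> \<open>Moving the sums over \<open>n\<close> and \<open>b\<close> inside turns each
    summand into an expanded form with left coefficients.\<close>
  also have "?S = (\<Sum>m\<in>UNIV. \<Sum>a\<in>UNIV. expand_form (\<lambda>n b. f * mink_scale (?c m n a b) (mink_x m a)))"
    by (simp add: expand_form_def UNIV_idx algebra_simps)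
  also have "form_eq (inverse Q) \<dots>
      (\<Sum>m\<in>UNIV. expand_form (\<lambda>n b. \<Sum>a\<in>UNIV. f * mink_scale (?c m n a b) (mink_x m a)))"
    by (intro form_eq_sum form_eq_sym[OF expand_form_sum])
  also have "form_eq (inverse Q) \<dots>
      (expand_form (\<lambda>n b. \<Sum>m\<in>UNIV. \<Sum>a\<in>UNIV. f * mink_scale (?c m n a b) (mink_x m a)))"
    by (rule form_eq_sym[OF expand_form_sum])
  also have "\<dots> = chart_form (\<lambda>n b. f * form_act (unit j l) (y i k) n b)"
  proof -
    have "(\<Sum>m\<in>UNIV. \<Sum>a\<in>UNIV. f * mink_scale (?c m n a b) (mink_x m a))
        = f * form_act (unit j l) (y i k) (\<sigma> n) (\<sigma> b)" for n b
    proof -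
      have "(\<Sum>m\<in>UNIV. \<Sum>a\<in>UNIV. f * mink_scale (?c m n a b) (mink_x m a))
          = (\<Sum>m\<in>UNIV. \<Sum>a\<in>UNIV. f * mink_scale (?c (\<sigma> m) n (\<sigma> a) b) (mink_x (\<sigma> m) (\<sigma> a)))"
        by (rule sum2_\<sigma>)
      also have "\<dots> = f * form_act (unit j l) (y i k) (\<sigma> n) (\<sigma> b)"
        unfolding form_act_unit_y by (simp add: sum_distrib_left Rc_def y_def)
      finally show ?thesis .
    qed
    then show ?thesis by (simp add: chart_form_def)
  qed
  finally show ?thesis .
qed

lemma chart_form_eq: "chart_form w = (\<Sum>i\<in>UNIV. \<Sum>j\<in>UNIV. lact (w i j) (dx (\<sigma> i) (\<sigma> j)))"
proof -
  have "(\<Sum>i\<in>UNIV. \<Sum>j\<in>UNIV. lact (w (\<sigma> i) (\<sigma> j)) (dx i j))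
      = (\<Sum>i\<in>UNIV. \<Sum>j\<in>UNIV. lact (w (\<sigma> (\<sigma> i)) (\<sigma> (\<sigma> j))) (dx (\<sigma> i) (\<sigma> j)))"
    by (rule sum2_\<sigma>)
  then show ?thesis by (simp add: chart_form_def expand_form_def)
qed

lemma ract_chart_form_y: "form_eq (inverse Q) (ract (chart_form w) (y i k)) (chart_form (form_act w (y i k)))"
proof -
  have "form_eq (inverse Q) (ract (chart_form w) (y i k))
      (\<Sum>j\<in>UNIV. \<Sum>l\<in>UNIV. chart_form (\<lambda>n b. w j l * form_act (unit j l) (y i k) n b))"
    unfolding chart_form_eq[of w] ract_sum by (intro form_eq_sum ract_dx_y)
  also have "form_eq (inverse Q) \<dots>
      (\<Sum>j\<in>UNIV. chart_form (\<lambda>n b. \<Sum>l\<in>UNIV. w j l * form_act (unit j l) (y i k) n b))"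
    unfolding chart_form_def by (intro form_eq_sum form_eq_sym[OF expand_form_sum])
  also have "form_eq (inverse Q) \<dots>
      (chart_form (\<lambda>n b. \<Sum>j\<in>UNIV. \<Sum>l\<in>UNIV. w j l * form_act (unit j l) (y i k) n b))"
    unfolding chart_form_def by (intro form_eq_sym[OF expand_form_sum])
  also have "(\<lambda>n b. \<Sum>j\<in>UNIV. \<Sum>l\<in>UNIV. w j l * form_act (unit j l) (y i k) n b) = form_act w (y i k)"
    unfolding form_act_unit_y by (simp add: form_act_y sum_distrib_left)
  finally show ?thesis .
qed

text \<open>The counterpart of \<open>form_coeff_ract\<close>: the relators suffice to bring a form
  times \<open>g\<close> back to left coefficients, and these are the ones given by the module
  action.\<close>

lemma ract_chart_form: "form_eq (inverse Q) (ract (chart_form w) g) (chart_form (form_act w g))"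
proof (induction g rule: qmink_y_induct)
  case (const c)
  have "form_eq (inverse Q) (ract (lact f (dx i j)) (mink_const c)) (lact (mink_scale c f) (dx i j))" for f i j
    unfolding dx_def lact_frag ract_frag
    by (rule form_eq_sym, rule form_eq_relator)
      (use form_relatorsI(3)[of f c "(i, j)" 1] in \<open>simp add: mult_mink_const[of f]\<close>)
  then show ?case
    unfolding chart_form_eq ract_sum form_act_const by (intro form_eq_sum)
next
  case (add g h)
  have "form_eq (inverse Q) (ract \<omega> (g + h)) (ract \<omega> g + ract \<omega> h)" for \<omega>
  proof -
    have "ract \<omega> (g + h) - ract \<omega> g - ract \<omega> h \<in> subgroup_gen (form_relators (inverse Q))"
    proof (induction \<omega> rule: frag_induction[OF subset_UNIV])
      case 1
      show ?case by (simp add: ract_0 subgroup_gen.zero)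
    next
      case (2 x)
      show ?case
        by (cases x) (simp add: ract_frag distrib_left form_relatorsI subgroup_gen.base)
    next
      case (3 \<omega> \<eta>)
      from subgroup_gen.diff[OF 3] show ?case by (simp add: ract_diff algebra_simps)
    qed
    then show ?thesis by (simp add: form_eq_def diff_diff_eq)
  qed
  also have "form_eq (inverse Q) (ract (chart_form w) g + ract (chart_form w) h)
      (chart_form (form_act w g) + chart_form (form_act w h))"
    by (intro form_eq_add add)
  also have "form_eq (inverse Q) \<dots> (chart_form (form_act w (g + h)))"
    unfolding chart_form_def form_act_add by (rule form_eq_sym[OF expand_form_add])
  finally show ?case .
next
  case (mult g i j)
  have "form_eq (inverse Q) (ract (chart_form w) (g * y i j)) (ract (chart_form (form_act w g)) (y i j))"
    unfolding ract_ract[symmetric] by (intro form_eq_ract mult)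
  also have "form_eq (inverse Q) \<dots> (chart_form (form_act w (g * y i j)))"
    unfolding form_act_mult by (rule ract_chart_form_y)
  finally show ?case .
qed

lemma de_rham_dcoeff: "de_rham (inverse Q) (\<lambda>f. chart_form (dcoeff f))"
  unfolding de_rham_def
proof (intro conjI allI)
  fix f g :: qmink and c i j
  show "form_eq (inverse Q) (chart_form (dcoeff (f + g))) (chart_form (dcoeff f) + chart_form (dcoeff g))"
    unfolding chart_form_def dcoeff_add by (rule expand_form_add)
  show "form_eq (inverse Q) (chart_form (dcoeff (mink_scale c f))) (lact (mink_const c) (chart_form (dcoeff f)))"
    by (simp add: chart_form_def lact_expand_form dcoeff_scale form_eq_refl flip: mink_scale_def)
  have "form_eq (inverse Q) (chart_form (dcoeff (mink_x i j))) (lact 1 (dx i j))"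
    unfolding chart_form_def mink_x_eq dcoeff_y
    using expand_form_unit[of "inverse Q" i j 1] by (simp add: \<sigma>_eq_iff)
  then show "form_eq (inverse Q) (chart_form (dcoeff (mink_x i j))) (dx i j)"
    by (simp add: lact_1)
  have "form_eq (inverse Q) (chart_form (dcoeff (f * g)))
      (chart_form (form_act (dcoeff f) g) + chart_form (\<lambda>m n. f * dcoeff g m n))"
    unfolding chart_form_def dcoeff_mult by (rule expand_form_add)
  also have "form_eq (inverse Q) \<dots> (ract (chart_form (dcoeff f)) g + lact f (chart_form (dcoeff g)))"
    by (intro form_eq_add form_eq_sym[OF ract_chart_form])
      (simp add: chart_form_def lact_expand_form form_eq_refl)
  finally show "form_eq (inverse Q) (chart_form (dcoeff (f * g)))
      (ract (chart_form (dcoeff f)) g + lact f (chart_form (dcoeff g)))" .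
qed

text \<open>\<open>de_rham_dcoeff\<close> supplies a witness. Conversely, \<open>form_coeff\<close>
  recovers the coefficients from any admissible expansion, and every de Rham operator has the same
  ones, so the definite description is justified.\<close>

theorem quantum_partial_eq: "quantum_partial (inverse Q) i j f = dcoeff f (\<sigma> i) (\<sigma> j)"
proof -
  have "(THE c. \<exists>d. de_rham (inverse Q) d \<and> form_eq (inverse Q) (d f) (expand_form c))
      = (\<lambda>i j. dcoeff f (\<sigma> i) (\<sigma> j))"
  proof (rule the_equality)
    show "\<exists>d. de_rham (inverse Q) d \<and> form_eq (inverse Q) (d f) (expand_form (\<lambda>i j. dcoeff f (\<sigma> i) (\<sigma> j)))"
      using de_rham_dcoeff form_eq_refl chart_form_def by metis
    fix c
    assume "\<exists>d. de_rham (inverse Q) d \<and> form_eq (inverse Q) (d f) (expand_form c)"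
    then obtain d where "de_rham (inverse Q) d" "form_eq (inverse Q) (d f) (expand_form c)"
      by blast
    then have "dcoeff f = form_coeff (expand_form c)"
      using form_coeff_de_rham form_coeff_cong by metis
    then show "c = (\<lambda>i j. dcoeff f (\<sigma> i) (\<sigma> j))"
      by (simp add: fun_eq_iff form_coeff_expand_form)
  qed
  then show ?thesis by (simp add: quantum_partial_def expand_form_def)
qed

end

section \<open>The kernel of the Laplacian\<close>

text \<open>The functional \<open>\<phi> i\<close> vanishes on the span of all other vectors but not
  on \<open>v i\<close>.\<close>

lemma (in vector_space) independent_dual_family:
  assumes add: "\<And>i x y. \<phi> i (x + y) = \<phi> i x + \<phi> i y" and scale: "\<And>i c x. \<phi> i (scale c x) = c * \<phi> i x"
    and diag: "\<And>i. i \<in> I \<Longrightarrow> \<phi> i (v i) \<noteq> 0"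
    and off: "\<And>i j. i \<in> I \<Longrightarrow> j \<in> I \<Longrightarrow> i \<noteq> j \<Longrightarrow> \<phi> i (v j) = 0"
  shows "inj_on v I" "independent (v ` I)"
proof -
  show inj: "inj_on v I"
    by (rule inj_onI) (metis diag off)
  show "independent (v ` I)"
    unfolding dependent_def
  proof clarify
    fix i
    assume i: "i \<in> I" and v: "v i \<in> span (v ` I - {v i})"
    have "\<phi> i x = 0" if "x \<in> span (v ` I - {v i})" for x
      using that
    proof (induction rule: span_induct)
      case base
      show ?case
        using scale[of i 0 0] by (simp add: subspace_def add scale)
    next
      case (step x)
      then show ?case using off i by auto
    qed
    from this[OF v] have "\<phi> i (v i) = 0" .
    then show False using diag i by blast
  qed
qed

text \<open>The bound singles out the lines that contain a point with natural coordinates, see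
  \<open>lines_eq\<close>.\<close>

definition lines :: "(nat \<times> nat \<times> nat) set" where
  "lines = {(a, b, e). e \<le> a + b}"

section \<open>q-numbers and the derivatives of ordered monomials\<close>

context chart
begin

definition qnum :: "nat \<Rightarrow> cq" where
  "qnum n = (\<Sum>i<n. Q ^ (2 * i))"

lemma qnum_0 [simp]: "qnum 0 = 0"
  and qnum_Suc: "qnum (Suc n) = qnum n + Q ^ (2 * n)"
  by (simp_all add: qnum_def)

lemma Q_square_neq_1: "Q * Q - 1 \<noteq> 0"
  using Q_power_neq_1[of 2] by (simp add: power2_eq_square)

lemma qnum_eq: "qnum n = (Q ^ (2 * n) - 1) / (Q * Q - 1)"
proof -
  have "(Q * Q - 1) * qnum n = Q ^ (2 * n) - 1"
    by (induction n) (simp_all add: qnum_Suc algebra_simps)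
  then show ?thesis using Q_square_neq_1 by (simp add: field_simps)
qed

lemma qnum_Suc': "qnum (Suc n) = Q * Q * qnum n + 1"
  using Q_square_neq_1 unfolding qnum_eq by (simp add: divide_simps) (simp add: algebra_simps)

lemma qnum_nonzero [simp]: "qnum (Suc n) \<noteq> 0"
  using Q_power_neq_1[of "2 * Suc n"] Q_square_neq_1 by (simp add: qnum_eq)

definition qfact :: "nat \<Rightarrow> cq" where
  "qfact n = (\<Prod>i<n. qnum (Suc i))"

lemma qfact_0 [simp]: "qfact 0 = 1"
  and qfact_Suc: "qfact (Suc n) = qnum (Suc n) * qfact n"
  by (simp_all add: qfact_def)

lemma qfact_nonzero [simp]: "qfact n \<noteq> 0"
  by (simp add: qfact_def)

text \<open>A monomial is extended at its right end only, where multiplication by the generator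
  produces no factor (\<open>pbw_steps\<close>).\<close>

lemma pbw_induct [case_names zero A B C D]:
  assumes "P 0 0 0 0" "\<And>A. P A 0 0 0 \<Longrightarrow> P (Suc A) 0 0 0" "\<And>A B. P A B 0 0 \<Longrightarrow> P A (Suc B) 0 0"
    "\<And>A B C. P A B C 0 \<Longrightarrow> P A B (Suc C) 0" "\<And>A B C D. P A B C D \<Longrightarrow> P A B C (Suc D)"
  shows "P A B C D"
proof -
  have "P A 0 0 0" by (induction A) (use assms in auto)
  then have "P A B 0 0" by (induction B) (use assms in auto)
  then have "P A B C 0" by (induction C) (use assms in auto)
  then show ?thesis by (induction D) (use assms in auto)
qed

lemma pbw_steps:
  "pbw A B C (Suc D) = pbw A B C D * y I2 I2"
  "pbw A B (Suc C) 0 = pbw A B C 0 * y I2 I1"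
  "pbw A (Suc B) 0 0 = pbw A B 0 0 * y I1 I2"
  "pbw (Suc A) 0 0 0 = pbw A 0 0 0 * y I1 I1"
  by (simp_all add: pbw_mult_y)

lemma pbw_0: "pbw 0 0 0 0 = 1"
  by (simp add: pbw_def)

lemma dcoeff_1: "dcoeff 1 m n = 0"
  using dcoeff_const[of 1 m n] by (simp add: mink_const_1)

lemma dcoeff_0: "dcoeff 0 m n = 0"
  using dcoeff_add[of 0 0 m n] by simp

text \<open>For exponent zero the truncated predecessor does not restore the monomial, but its
  factor \<open>qnum 0\<close> vanishes. The same convention makes the derivative formulas below
  valid for all exponents.\<close>

lemma pbw_pred_mult_y:
  "mink_scale (c * qnum D) (pbw A B C (D - Suc 0)) * y I2 I2 = mink_scale (c * qnum D) (pbw A B C D)"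
  "mink_scale (c * qnum C) (pbw A B (C - Suc 0) D) * y I2 I1 = mink_scale (c * qnum C) (pbw A B C D)"
  "mink_scale (c * qnum B) (pbw A (B - Suc 0) 0 0) * y I1 I2 = mink_scale (c * qnum B) (pbw A B 0 0)"
  "mink_scale (c * qnum A) (pbw (A - Suc 0) 0 0 0) * y I1 I1 = mink_scale (c * qnum A) (pbw A 0 0 0)"
  subgoal by (cases D) (simp_all add: pbw_mult_y)
  subgoal by (cases C) (simp_all add: pbw_mult_y)
  subgoal by (cases B) (simp_all add: pbw_mult_y)
  subgoal by (cases A) (simp_all add: pbw_mult_y)
  done

lemma dcoeff_22_pbw: "dcoeff (pbw A B C D) I2 I2 = mink_scale (qnum D) (pbw A B C (D - 1))"
proof (induction A B C D rule: pbw_induct)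
  case (D A B C D)
  show ?case
    unfolding pbw_steps(1)[of A B C D] dcoeff_mult_y jet_act_values
    using pbw_pred_mult_y(1)[of 1 D A B C] D
    by (simp add: qnum_Suc' mink.scale_left_distrib)
qed (simp_all add: pbw_steps dcoeff_mult_y jet_act_values pbw_0 dcoeff_1)

lemma dcoeff_21_pbw: "dcoeff (pbw A B C D) I2 I1 = mink_scale (Q ^ (2 * D) * qnum C) (pbw A B (C - 1) D)"
proof (induction A B C D rule: pbw_induct)
  case (C A B C)
  show ?case
    unfolding pbw_steps(2)[of A B C] dcoeff_mult_y jet_act_values
    using pbw_pred_mult_y(2)[of 1 C A B 0] C
    by (simp add: qnum_Suc' mink.scale_left_distrib dcoeff_22_pbw)
next
  case (D A B C D)
  show ?case
    unfolding pbw_steps(1)[of A B C D] dcoeff_mult_y jet_act_values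
    using D by (simp add: pbw_mult_y)
qed (simp_all add: pbw_steps(3,4) dcoeff_mult_y jet_act_values pbw_0 dcoeff_1 dcoeff_22_pbw)

lemma dcoeff_12_pbw: "dcoeff (pbw A B C D) I1 I2 = mink_scale (inverse Q ^ (2 * C) * qnum B) (pbw A (B - 1) C D)"
proof (induction A B C D rule: pbw_induct)
  case (B A B)
  show ?case
    unfolding pbw_steps(3)[of A B] dcoeff_mult_y jet_act_values
    using pbw_pred_mult_y(3)[of 1 B A] B
    by (simp add: qnum_Suc' mink.scale_left_distrib dcoeff_22_pbw)
next
  case (C A B C)
  show ?case
    unfolding pbw_steps(2)[of A B C] dcoeff_mult_y jet_act_values
    using C by (simp add: pbw_mult_y mult.assoc)
next
  case (D A B C D)
  show ?case
    unfolding pbw_steps(1)[of A B C D] dcoeff_mult_y jet_act_values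
    using D by (simp add: pbw_mult_y)
qed (simp_all add: pbw_steps(4) dcoeff_mult_y jet_act_values pbw_0 dcoeff_1 dcoeff_22_pbw)

text \<open>The second summand originates in the off-diagonal entry of \<open>Rc\<close>. Appending
  a further \<open>y21\<close> to \<open>C\<close> of them adds
  \<open>(1 - Q^-2) Q^(-2C) qnum B\<close>, and these contributions telescope to
  \<open>(1 - Q^(-2C)) qnum B\<close>.\<close>

lemma dcoeff_11_pbw: "dcoeff (pbw A B C D) I1 I1 = mink_scale (Q ^ (2 * B) * qnum A) (pbw (A - 1) B C D)
    + mink_scale ((1 - inverse Q ^ (2 * C)) * qnum B) (pbw A (B - 1) (C - 1) (Suc D))"
proof (induction A B C D rule: pbw_induct)
  case (A A)
  show ?case
    unfolding pbw_steps(4)[of A] dcoeff_mult_y jet_act_values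
    using pbw_pred_mult_y(4)[of 1 A] A
    by (simp add: qnum_Suc' mink.scale_left_distrib dcoeff_22_pbw dcoeff_21_pbw dcoeff_12_pbw)
next
  case (B A B)
  show ?case
    unfolding pbw_steps(3)[of A B] dcoeff_mult_y jet_act_values
    using B by (simp add: pbw_mult_y dcoeff_21_pbw mult.assoc)
next
  case (C A B C)
  \<comment> \<open>For \<open>C = 0\<close> the truncated predecessor is harmless because the first
    factor is zero.\<close>
  have pred: "mink_scale ((1 - inverse Q ^ (2 * C)) * qnum B) (pbw A (B - 1) (C - 1) (Suc 0)) * y I2 I1
      = mink_scale ((1 - inverse Q ^ (2 * C)) * qnum B) (pbw A (B - 1) C (Suc 0))"
    by (cases C) (simp_all add: pbw_mult_y)
  have "dcoeff (pbw A B (Suc C) 0) I1 I1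
      = (mink_scale (Q ^ (2 * B) * qnum A) (pbw (A - 1) B C 0)
          + mink_scale ((1 - inverse Q ^ (2 * C)) * qnum B) (pbw A (B - 1) (C - 1) (Suc 0))) * y I2 I1
        + mink_scale (1 - inverse Q * inverse Q) (mink_scale (inverse Q ^ (2 * C) * qnum B) (pbw A (B - 1) C 0) * y I2 I2)"
    by (simp only: pbw_steps(2) dcoeff_mult_y jet_act_values snd_conv C dcoeff_12_pbw)
  also have "\<dots> = mink_scale (Q ^ (2 * B) * qnum A) (pbw (A - 1) B (Suc C) 0)
      + mink_scale ((1 - inverse Q ^ (2 * C)) * qnum B
          + (1 - inverse Q * inverse Q) * (inverse Q ^ (2 * C) * qnum B)) (pbw A (B - 1) C (Suc 0))"
    unfolding distrib_right pred
    by (simp only: mink_scale_mult_left pbw_mult_y mink.scale_left_distrib mink.scale_scale add.assoc)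
  also have "(1 - inverse Q ^ (2 * C)) * qnum B + (1 - inverse Q * inverse Q) * (inverse Q ^ (2 * C) * qnum B)
      = (1 - inverse Q ^ (2 * Suc C)) * qnum B"
    by (simp add: algebra_simps)
  finally show ?case by simp
next
  case (D A B C D)
  show ?case
    unfolding pbw_steps(1)[of A B C D] dcoeff_mult_y jet_act_values
    using D by (simp add: pbw_mult_y distrib_right)
qed (simp_all add: pbw_0 dcoeff_1)

section \<open>The Laplacian in the monomial basis\<close>

definition laplacian :: "qmink \<Rightarrow> qmink" where
  "laplacian f = quantum_laplacian (inverse Q) f"

lemma laplacian_eq:
  "laplacian f = dcoeff (dcoeff f (\<sigma> I2) (\<sigma> I2)) (\<sigma> I1) (\<sigma> I1) - dcoeff (dcoeff f (\<sigma> I1) (\<sigma> I2)) (\<sigma> I2) (\<sigma> I1)"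
  by (simp add: laplacian_def quantum_laplacian_def quantum_partial_eq)

lemma laplacian_add: "laplacian (f + g) = laplacian f + laplacian g"
  and laplacian_scale: "laplacian (mink_scale c f) = mink_scale c (laplacian f)"
  by (simp_all add: laplacian_eq dcoeff_add dcoeff_scale mink.scale_right_diff_distrib)

text \<open>The contributions to the second monomial merge by
  \<open>1 - Q^(-2C) = (Q^2 - 1) Q^(-2C) qnum C\<close> and
  \<open>(Q^2 - 1) qnum D = Q^(2D) - 1\<close>. In the flipped chart the derivatives are composed in
  the opposite order and \<open>qnum (D + 1)\<close> takes the place of \<open>qnum D\<close>, but
  the result is the same.\<close>

lemma laplacian_pbw:
  "laplacian (pbw A B C D) = mink_scale (Q ^ (2 * B) * qnum A * qnum D) (pbw (A - 1) B C (D - 1))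
    - mink_scale (inverse Q ^ (2 * C) * qnum B * qnum C) (pbw A (B - 1) (C - 1) D)"
proof -
  have Y: "Q ^ (2 * n) * inverse Q ^ (2 * n) = 1" for n
    by (simp flip: power_mult_distrib)
  have combine: "f + mink_scale u g - mink_scale v g = f - mink_scale w g" if "v - u = w" for f g u v w
    by (simp add: mink.scale_left_diff_distrib flip: that)
  show ?thesis
  proof (cases rule: chart_cases)
    case 1
    have "dcoeff (dcoeff (pbw A B C D) I2 I2) I1 I1
        = mink_scale (Q ^ (2 * B) * qnum A * qnum D) (pbw (A - 1) B C (D - 1))
          + mink_scale (qnum D * (1 - inverse Q ^ (2 * C)) * qnum B) (pbw A (B - 1) (C - 1) D)"
      by (cases D) (simp_all add: dcoeff_0 dcoeff_22_pbw dcoeff_11_pbw dcoeff_scale mink.scale_right_distrib mult_ac)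
    moreover have "dcoeff (dcoeff (pbw A B C D) I1 I2) I2 I1
        = mink_scale (inverse Q ^ (2 * C) * Q ^ (2 * D) * qnum B * qnum C) (pbw A (B - 1) (C - 1) D)"
      by (simp add: dcoeff_12_pbw dcoeff_21_pbw dcoeff_scale mult_ac)
    moreover have "inverse Q ^ (2 * C) * Q ^ (2 * D) * qnum B * qnum C - qnum D * (1 - inverse Q ^ (2 * C)) * qnum B
        = inverse Q ^ (2 * C) * qnum B * qnum C"
    proof -
      have "inverse Q ^ (2 * C) * Q ^ (2 * D) * qnum C - qnum D * (1 - inverse Q ^ (2 * C)) = inverse Q ^ (2 * C) * qnum C"
        using Q_square_neq_1 Y[of C] unfolding qnum_eq by (simp add: divide_simps) (simp add: algebra_simps)
      then have "(inverse Q ^ (2 * C) * Q ^ (2 * D) * qnum C - qnum D * (1 - inverse Q ^ (2 * C))) * qnum B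
        = (inverse Q ^ (2 * C) * qnum C) * qnum B" by simp
      then show ?thesis by (simp add: algebra_simps)
    qed
    ultimately show ?thesis
      unfolding laplacian_eq 1(1,2) by (simp only: combine)
  next
    case 2
    have "dcoeff (dcoeff (pbw A B C D) I1 I1) I2 I2
        = mink_scale (Q ^ (2 * B) * qnum A * qnum D) (pbw (A - 1) B C (D - 1))
          + mink_scale ((1 - inverse Q ^ (2 * C)) * qnum B * qnum (Suc D)) (pbw A (B - 1) (C - 1) D)"
      by (simp add: dcoeff_22_pbw dcoeff_11_pbw dcoeff_scale dcoeff_add mult_ac)
    moreover have "dcoeff (dcoeff (pbw A B C D) I2 I1) I1 I2
        = mink_scale (Q ^ (2 * D) * qnum C * inverse Q ^ (2 * (C - 1)) * qnum B) (pbw A (B - 1) (C - 1) D)"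
      by (simp add: dcoeff_12_pbw dcoeff_21_pbw dcoeff_scale mult_ac)
    moreover have "Q ^ (2 * D) * qnum C * inverse Q ^ (2 * (C - 1)) * qnum B - (1 - inverse Q ^ (2 * C)) * qnum B * qnum (Suc D)
        = inverse Q ^ (2 * C) * qnum B * qnum C"
    proof (cases C)
      case (Suc C')
      have "Q ^ (2 * D) * qnum C * inverse Q ^ (2 * C') - (1 - inverse Q ^ (2 * C)) * qnum (Suc D) = inverse Q ^ (2 * C) * qnum C"
        using Q_square_neq_1 Y[of C] Y[of C'] unfolding qnum_eq Suc by (simp add: divide_simps) (simp add: algebra_simps)
      then have "(Q ^ (2 * D) * qnum C * inverse Q ^ (2 * C') - (1 - inverse Q ^ (2 * C)) * qnum (Suc D)) * qnum B
        = (inverse Q ^ (2 * C) * qnum C) * qnum B" by simp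
      then show ?thesis by (simp add: algebra_simps Suc)
    qed simp
    ultimately show ?thesis
      unfolding laplacian_eq 2(1,2) by (simp only: combine)
  qed
qed

text \<open>With this normalization the Laplacian has, up to a factor depending only on the target, the
  coefficients \<open>1\<close> and \<open>-1\<close>, see \<open>basis_coeff_laplacian\<close>.\<close>

definition weight :: "nat \<Rightarrow> nat \<Rightarrow> nat \<Rightarrow> nat \<Rightarrow> cq" where
  "weight A B C D = Q ^ (2 * B * C) / (qfact A * qfact B * qfact C * qfact D)"

lemma weight_nonzero [simp]: "weight A B C D \<noteq> 0"
  by (simp add: weight_def)

fun basis :: "nat \<times> nat \<times> nat \<times> nat \<Rightarrow> qmink" where
  "basis (A, B, C, D) = mink_scale (weight A B C D) (pbw A B C D)"

fun basis_coeff :: "qmink \<Rightarrow> nat \<times> nat \<times> nat \<times> nat \<Rightarrow> cq" where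
  "basis_coeff f (A, B, C, D) = pbw_coeff f A B C D / weight A B C D"

lemma basis_coeff_add: "basis_coeff (f + g) v = basis_coeff f v + basis_coeff g v"
  by (cases v) (simp add: pbw_coeff_add add_divide_distrib)

lemma basis_coeff_scale: "basis_coeff (mink_scale c f) v = c * basis_coeff f v"
  by (cases v) (simp add: pbw_coeff_scale)

lemma basis_coeff_0 [simp]: "basis_coeff 0 v = 0"
  using basis_coeff_scale[of 0 0 v] by simp

lemma basis_coeff_diff: "basis_coeff (f - g) v = basis_coeff f v - basis_coeff g v"
  using basis_coeff_add[of "f - g" g v] by simp

lemma basis_coeff_sum: "basis_coeff (sum F S) v = (\<Sum>i\<in>S. basis_coeff (F i) v)"
  by (induction S rule: infinite_finite_induct) (simp_all add: basis_coeff_add)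

lemma basis_coeff_basis: "basis_coeff (basis u) v = of_bool (u = v)"
  by (cases u; cases v) (auto simp: pbw_coeff_scale pbw_coeff_pbw delta_def)

lemma basis_induct [case_names zero step]:
  assumes "P 0" and step: "\<And>c v f. P f \<Longrightarrow> P (mink_scale c (basis v) + f)"
  shows "P f"
  using mink_span_pbw[of f]
proof (induction f rule: mink.span_induct_alt)
  case base
  show ?case by (rule assms(1))
next
  case (step c x f)
  then obtain A B C D where "x = pbw A B C D" by blast
  then have x: "mink_scale c x = mink_scale (c / weight A B C D) (basis (A, B, C, D))"
    by simp
  show ?case
    unfolding x by (rule assms(2)) (rule step)
qed

lemma basis_expansion:
  "\<exists>S. finite S \<and> (\<forall>T. finite T \<longrightarrow> S \<subseteq> T \<longrightarrow> f = (\<Sum>v\<in>T. mink_scale (basis_coeff f v) (basis v)))"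
proof (induction f rule: basis_induct)
  case zero
  show ?case by (rule exI[of _ "{}"]) simp
next
  case (step c u f)
  then obtain S where S: "finite S"
    "\<And>T. finite T \<Longrightarrow> S \<subseteq> T \<Longrightarrow> f = (\<Sum>v\<in>T. mink_scale (basis_coeff f v) (basis v))"
    by blast
  have "mink_scale c (basis u) + f
      = (\<Sum>v\<in>T. mink_scale (basis_coeff (mink_scale c (basis u) + f) v) (basis v))"
    if T: "finite T" "insert u S \<subseteq> T" for T
  proof -
    have "(\<Sum>v\<in>T. mink_scale (c * of_bool (u = v)) (basis v)) = (\<Sum>v\<in>{u}. mink_scale (c * of_bool (u = v)) (basis v))"
      by (rule sum.mono_neutral_right) (use T in auto)
    then show ?thesis
      using S(2)[of T] T
      by (simp add: basis_coeff_add basis_coeff_scale basis_coeff_basis mink.scale_left_distrib sum.distrib)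
  qed
  then show ?case using S(1) by (intro exI[of _ "insert u S"]) auto
qed

lemma basis_coeff_eqI: "(\<And>v. basis_coeff f v = 0) \<Longrightarrow> f = 0"
  using basis_expansion[of f] by auto

lemma laplacian_0 [simp]: "laplacian 0 = 0"
  using laplacian_scale[of 0 0] by simp

text \<open>The q-factorials absorb the q-numbers. In the second term the exponent of
  \<open>Q\<close> becomes \<open>2BC - 2C - 2(B-1)(C-1) = 2(B-1)\<close>; as in the first term,
  this is twice the \<open>y12\<close>-exponent of the target.\<close>

lemma laplacian_basis:
  "laplacian (basis (A, B, C, D)) =
    (case (A, D) of (Suc A', Suc D') \<Rightarrow> mink_scale (Q ^ (2 * B)) (basis (A', B, C, D')) | _ \<Rightarrow> 0)
    - (case (B, C) of (Suc B', Suc C') \<Rightarrow> mink_scale (Q ^ (2 * B')) (basis (A, B', C', D)) | _ \<Rightarrow> 0)"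
proof -
  have "mink_scale (weight A B C D * (Q ^ (2 * B) * qnum A * qnum D)) (pbw (A - 1) B C (D - 1))
      = (case (A, D) of (Suc A', Suc D') \<Rightarrow> mink_scale (Q ^ (2 * B)) (basis (A', B, C, D')) | _ \<Rightarrow> 0)"
    by (auto simp: weight_def qfact_Suc divide_simps split: nat.split)
  moreover have "mink_scale (weight A B C D * (inverse Q ^ (2 * C) * qnum B * qnum C)) (pbw A (B - 1) (C - 1) D)
      = (case (B, C) of (Suc B', Suc C') \<Rightarrow> mink_scale (Q ^ (2 * B')) (basis (A, B', C', D)) | _ \<Rightarrow> 0)"
    by (auto simp: weight_def qfact_Suc divide_simps power_add power_mult_distrib split: nat.split)
  ultimately show ?thesis
    by (simp add: laplacian_scale laplacian_pbw mink.scale_right_diff_distrib)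
qed

lemma basis_coeff_laplacian:
  "basis_coeff (laplacian f) (A, B, C, D)
    = Q ^ (2 * B) * (basis_coeff f (Suc A, B, C, Suc D) - basis_coeff f (A, Suc B, Suc C, D))"
proof (induction f rule: basis_induct)
  case zero
  show ?case by (simp del: basis_coeff.simps)
next
  case (step c v f)
  obtain A' B' C' D' where v: "v = (A', B', C', D')" by (cases v)
  have "basis_coeff (laplacian (basis v)) (A, B, C, D)
      = Q ^ (2 * B) * (of_bool (v = (Suc A, B, C, Suc D)) - of_bool (v = (A, Suc B, Suc C, D)))"
    unfolding v laplacian_basis
    by (auto simp: basis_coeff_diff basis_coeff_scale basis_coeff_basis split: nat.split
        simp del: basis_coeff.simps basis.simps)
  then show ?case
    by (simp only: laplacian_add laplacian_scale basis_coeff_add basis_coeff_scale basis_coeff_basis step)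
      (simp only: algebra_simps)
qed

section \<open>Lines and the kernel\<close>

fun line_of :: "nat \<times> nat \<times> nat \<times> nat \<Rightarrow> nat \<times> nat \<times> nat" where
  "line_of (A, B, C, D) = (A + C, B + D, A + B)"

definition line_sum :: "nat \<times> nat \<times> nat \<Rightarrow> qmink" where
  "line_sum k = (\<Sum>v | line_of v = k. basis v)"

lemma finite_line: "finite {v. line_of v = k}"
proof -
  obtain a b e where k: "k = (a, b, e)" by (cases k)
  have "{v. line_of v = k} \<subseteq> {..a} \<times> {..b} \<times> {..a} \<times> {..b}"
    by (auto simp: k)
  then show ?thesis by (rule finite_subset) simp
qed

lemma basis_coeff_line_sum: "basis_coeff (line_sum k) v = of_bool (line_of v = k)"
proof -
  have "basis_coeff (line_sum k) v = (\<Sum>u | line_of u = k. if u = v then 1 else 0)"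
    by (simp add: line_sum_def basis_coeff_sum basis_coeff_basis of_bool_def)
  also have "\<dots> = of_bool (line_of v = k)"
    using finite_line[of k] by (simp add: sum.delta)
  finally show ?thesis .
qed

lemma laplacian_line_sum: "laplacian (line_sum k) = 0"
proof (rule basis_coeff_eqI)
  fix v
  show "basis_coeff (laplacian (line_sum k)) v = 0"
    by (cases v) (simp add: basis_coeff_laplacian basis_coeff_line_sum del: basis_coeff.simps)
qed

text \<open>Points on one line differ by a multiple of \<open>(1, -1, -1, 1)\<close>. The vanishing
  of the Laplacian equates the coefficients of neighbouring points, and all points between two
  natural ones are natural.\<close>

lemma basis_coeff_constant_on_line:
  assumes lap: "laplacian f = 0" and "line_of u = line_of v"
  shows "basis_coeff f u = basis_coeff f v"
proof -
  have step: "basis_coeff f (Suc A, B, C, Suc D) = basis_coeff f (A, Suc B, Suc C, D)" for A B C D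
    using basis_coeff_laplacian[of f A B C D] lap by (simp del: basis_coeff.simps)
  have steps: "basis_coeff f (A + n, B, C, D + n) = basis_coeff f (A, B + n, C + n, D)" for A B C D n
  proof (induction n arbitrary: B C)
    case (Suc n)
    then show ?case
      using step[of "A + n" B C "D + n"] Suc[of "Suc B" "Suc C"] by (simp del: basis_coeff.simps)
  qed simp
  have le: "basis_coeff f (A, B, C, D) = basis_coeff f (A', B', C', D')"
    if "line_of (A, B, C, D) = line_of (A', B', C', D')" "A' \<le> A" for A B C D A' B' C' D'
  proof -
    have "A = A' + (A - A')" "D = D' + (A - A')" "B' = B + (A - A')" "C' = C + (A - A')"
      using that by auto
    then show ?thesis using steps by metis
  qed
  show ?thesis
  proof (cases u; cases v)
    fix A B C D A' B' C' D'
    assume "u = (A, B, C, D)" "v = (A', B', C', D')"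
    then show ?thesis
      using le[of A B C D A' B' C' D'] le[of A' B' C' D' A B C D] assms(2) by (cases "A' \<le> A") auto
  qed
qed

lemma lines_eq: "lines = range line_of"
proof (intro set_eqI iffI)
  fix k
  assume "k \<in> lines"
  then obtain a b e where k: "k = (a, b, e)" "e \<le> a + b" by (auto simp: lines_def)
  \<comment> \<open>The point with the largest possible first coordinate;
    \<open>e \<le> a + b\<close> keeps the last coordinate from being truncated.\<close>
  have "line_of (min a e, e - min a e, a - min a e, b - (e - min a e)) = k"
    using k by auto
  then show "k \<in> range line_of" by (metis rangeI)
next
  fix k
  assume "k \<in> range line_of"
  then show "k \<in> lines" by (auto simp: lines_def)
qed

lemma ker_laplacian: "{f. laplacian f = 0} = mink.span (line_sum ` lines)"
proof (intro set_eqI iffI)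
  fix f
  assume "f \<in> mink.span (line_sum ` lines)"
  then have "laplacian f = 0"
  proof (induction f rule: mink.span_induct)
    case base
    show ?case by (auto simp: mink.subspace_def laplacian_add laplacian_scale)
  qed (auto simp: laplacian_line_sum)
  then show "f \<in> {f. laplacian f = 0}" by simp
next
  fix f
  assume "f \<in> {f. laplacian f = 0}"
  then have f: "laplacian f = 0" by simp
  obtain S where S: "finite S"
    "\<And>T. finite T \<Longrightarrow> S \<subseteq> T \<Longrightarrow> f = (\<Sum>v\<in>T. mink_scale (basis_coeff f v) (basis v))"
    using basis_expansion[of f] by blast
  \<comment> \<open>\<open>T\<close> contains with each point its whole line, so the expansion of
    \<open>f\<close> splits into sums over complete lines.\<close>
  define T where "T = (\<Union>k\<in>line_of ` S. {v. line_of v = k})"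
  have T: "finite T" "S \<subseteq> T"
    using S(1) finite_line by (auto simp: T_def)
  have line: "{v \<in> T. line_of v = line_of u} = {v. line_of v = line_of u}" if "u \<in> T" for u
  proof -
    have mem: "v \<in> T \<longleftrightarrow> line_of v \<in> line_of ` S" for v
      by (simp only: T_def UN_iff mem_Collect_eq) blast
    show ?thesis
      using that unfolding mem by (intro Collect_cong) metis
  qed
  have "f = (\<Sum>v\<in>T. mink_scale (basis_coeff f v) (basis v))"
    using S(2) T by blast
  also have "\<dots> = (\<Sum>k\<in>line_of ` T. \<Sum>v\<in>{v \<in> T. line_of v = k}. mink_scale (basis_coeff f v) (basis v))"
    using T(1) by (rule sum.image_gen)
  also have "\<dots> \<in> mink.span (line_sum ` lines)"
  proof (rule mink.span_sum)
    fix k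
    assume "k \<in> line_of ` T"
    then obtain u where u: "u \<in> T" "k = line_of u" by blast
    have "(\<Sum>v\<in>{v \<in> T. line_of v = k}. mink_scale (basis_coeff f v) (basis v))
        = (\<Sum>v | line_of v = k. mink_scale (basis_coeff f u) (basis v))"
      unfolding u(2) line[OF u(1)]
      by (intro sum.cong refl arg_cong2[of _ _ _ _ mink_scale] basis_coeff_constant_on_line[OF f]) simp
    also have "\<dots> = mink_scale (basis_coeff f u) (line_sum k)"
      by (simp add: line_sum_def mink.scale_sum_right)
    also have "\<dots> \<in> mink.span (line_sum ` lines)"
      using u by (intro mink.span_scale mink.span_base) (auto simp: lines_eq)
    finally show "(\<Sum>v\<in>{v \<in> T. line_of v = k}. mink_scale (basis_coeff f v) (basis v)) \<in> mink.span (line_sum ` lines)" .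
  qed
  finally show "f \<in> mink.span (line_sum ` lines)" .
qed

text \<open>A rescaling and a permutation of the lines are allowed because the integrals of the
  monomials are line sums only up to q-factorials and, in the flipped chart, up to relabelling. The
  dual functionals are the coefficients at one chosen point of each line.\<close>

lemma ker_laplacian_basis:
  assumes G: "\<And>k. k \<in> lines \<Longrightarrow> G k = mink_scale (c k) (line_sum (\<pi> k))" and c: "\<And>k. c k \<noteq> 0"
    and \<pi>: "bij_betw \<pi> lines lines"
  shows "inj_on G lines" "mink.independent (G ` lines)" "mink.span (G ` lines) = {f. laplacian f = 0}"
proof -
  have "\<exists>v. line_of v = \<pi> k" if "k \<in> lines" for k
    using bij_betw_apply[OF \<pi> that] unfolding lines_eq by (metis imageE)
  then obtain v where v: "\<And>k. k \<in> lines \<Longrightarrow> line_of (v k) = \<pi> k"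
    by metis
  have eval: "basis_coeff (G k') (v k) = c k' * of_bool (k = k')" if "k \<in> lines" "k' \<in> lines" for k k'
    using that v bij_betw_imp_inj_on[OF \<pi>]
    by (auto simp: G basis_coeff_scale basis_coeff_line_sum inj_on_def)
  show "inj_on G lines" "mink.independent (G ` lines)"
    by (rule mink.independent_dual_family[where \<phi> = "\<lambda>k f. basis_coeff f (v k)" and I = lines];
        simp add: basis_coeff_add basis_coeff_scale eval c)+
  have "mink.span (G ` lines) = mink.span (line_sum ` lines)"
  proof (rule antisym)
    have "G k \<in> mink.span (line_sum ` lines)" if "k \<in> lines" for k
      unfolding G[OF that] by (intro mink.span_scale mink.span_base imageI bij_betw_apply[OF \<pi>] that)
    then show "mink.span (G ` lines) \<subseteq> mink.span (line_sum ` lines)"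
      by (intro mink.span_minimal) auto
    have "line_sum k' \<in> mink.span (G ` lines)" if "k' \<in> lines" for k'
    proof -
      have "k' \<in> \<pi> ` lines"
        using that by (simp only: bij_betw_imp_surj_on[OF \<pi>])
      then obtain k where k: "k \<in> lines" "k' = \<pi> k" by (rule imageE)
      have "line_sum k' = mink_scale (inverse (c k)) (G k)"
        unfolding G[OF k(1)] k(2) by (simp add: c)
      then show ?thesis
        using k(1) by (simp only: mink.span_scale mink.span_base imageI)
    qed
    then show "mink.span (line_sum ` lines) \<subseteq> mink.span (G ` lines)"
      by (intro mink.span_minimal) auto
  qed
  then show "mink.span (G ` lines) = {f. laplacian f = 0}"
    by (simp add: ker_laplacian)
qed

end

section \<open>The integral formula on monomials\<close>

definition twistor_power :: "nat \<Rightarrow> nat \<Rightarrow> int \<Rightarrow>\<^sub>0 qmink" where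
  "twistor_power a b =
    (s_coeff (mink_x I1 I1) * s_pow 1 + s_coeff (mink_x I2 I1)) ^ a
    * (s_coeff (mink_x I1 I2) * s_pow 1 + s_coeff (mink_x I2 I2)) ^ b"

lemma s_coeff_const_single:
  "s_coeff (mink_const c) * Poly_Mapping.single i f = Poly_Mapping.single i (mink_scale c f)"
  by (simp add: s_coeff_def mult_single mink_scale_def)

lemma s_coeff_const_commute: "F * s_coeff (mink_const c) = s_coeff (mink_const c) * F"
proof (induction F rule: poly_mapping_single_induct)
  case (single k f)
  show ?case by (simp add: s_coeff_def mult_single mult_mink_const mink_scale_def)
qed (simp_all add: distrib_left distrib_right)

lemma s_coeff_const_mult:
  "s_coeff (mink_const c) * (s_coeff (mink_const d) * F) = s_coeff (mink_const (c * d)) * F"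
proof -
  have "s_coeff (mink_const c) * s_coeff (mink_const d) = s_coeff (mink_const (c * d))"
    by (simp add: s_coeff_def mult_single mink_const_eq mult.commute)
  then show ?thesis by (simp flip: mult.assoc)
qed

context chart
begin

text \<open>Dividing by q-factorials keeps q-binomial coefficients out of the expansions. The
  degrees \<open>i\<close> and \<open>j\<close> in \<open>s\<close> stay free because the flipped
  chart attaches \<open>s\<close> to the second summand instead of the first.\<close>

definition divided_term :: "qmink \<Rightarrow> qmink \<Rightarrow> int \<Rightarrow> int \<Rightarrow> nat \<Rightarrow> nat \<Rightarrow> int \<Rightarrow>\<^sub>0 qmink" where
  "divided_term u v i j k l =
    Poly_Mapping.single (int k * i + int l * j) (mink_scale (1 / (qfact k * qfact l)) (u ^ k * v ^ l))"

lemma qnum_add: "qnum (k + l) = Q ^ (2 * l) * qnum k + qnum l"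
  by (induction k) (simp_all add: qnum_Suc power_add algebra_simps)

text \<open>For \<open>k + l = n + 1\<close>, the term \<open>(k, l)\<close> arises from
  \<open>(k - 1, l)\<close> with factor \<open>Q^(2l) qnum k\<close> and from
  \<open>(k, l - 1)\<close> with factor \<open>qnum l\<close>. By \<open>qnum_add\<close> the two
  factors add up to \<open>qnum (n + 1)\<close>.\<close>

lemma q_binomial:
  assumes vu: "v * u = mink_scale (Q ^ 2) (u * v)"
  shows "(Poly_Mapping.single i u + Poly_Mapping.single j v) ^ n
    = s_coeff (mink_const (qfact n)) * (\<Sum>k\<le>n. divided_term u v i j k (n - k))"
proof (induction n)
  case 0
  show ?case
    by (simp add: divided_term_def s_coeff_def mink_const_1)
next
  case (Suc n)
  let ?t = "divided_term u v i j" and ?c = "\<lambda>c. s_coeff (mink_const c)"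
  have c_add: "?c (a + b) = ?c a + ?c b" for a b
    by (simp add: s_coeff_def mink_const_eq mink.scale_left_distrib single_add)
  have c_0: "?c 0 = 0"
    by (simp add: s_coeff_def mink_const_eq)
  have u: "?t k l * Poly_Mapping.single i u = ?c (Q ^ (2 * l) * qnum (Suc k)) * ?t (Suc k) l" for k l
  proof -
    have "u ^ k * v ^ l * u = mink_scale (Q ^ (2 * l)) (u ^ Suc k * v ^ l)"
      using q_commute_power[OF vu, of l 1]
      by (simp add: mult.assoc power_Suc2 del: power_Suc flip: power_mult)
    then show ?thesis
      by (simp add: divided_term_def mult_single s_coeff_const_single qfact_Suc algebra_simps)
  qed
  have v: "?t k l * Poly_Mapping.single j v = ?c (qnum (Suc l)) * ?t k (Suc l)" for k l
    by (simp add: divided_term_def mult_single s_coeff_const_single qfact_Suc algebra_simps power_Suc2 mult.assoc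
        del: power_Suc)
  have "(\<Sum>k\<le>n. ?t k (n - k)) * Poly_Mapping.single i u
      = (\<Sum>k\<le>n. ?c (Q ^ (2 * (Suc n - Suc k)) * qnum (Suc k)) * ?t (Suc k) (Suc n - Suc k))"
    by (simp add: sum_distrib_right u)
  \<comment> \<open>The additional term \<open>k = 0\<close> vanishes with \<open>qnum 0\<close>; in
    the second sum below the same happens at \<open>k = Suc n\<close>.\<close>
  also have "\<dots> = (\<Sum>k\<le>Suc n. ?c (Q ^ (2 * (Suc n - k)) * qnum k) * ?t k (Suc n - k))"
    unfolding sum.atMost_Suc_shift by (simp add: c_0)
  finally have 1: "(\<Sum>k\<le>n. ?t k (n - k)) * Poly_Mapping.single i u = \<dots>" .
  have "(\<Sum>k\<le>n. ?t k (n - k)) * Poly_Mapping.single j v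
      = (\<Sum>k\<le>n. ?c (qnum (Suc n - k)) * ?t k (Suc n - k))"
    by (simp add: sum_distrib_right v Suc_diff_le)
  also have "\<dots> = (\<Sum>k\<le>Suc n. ?c (qnum (Suc n - k)) * ?t k (Suc n - k))"
    by (simp add: c_0)
  finally have 2: "(\<Sum>k\<le>n. ?t k (n - k)) * Poly_Mapping.single j v = \<dots>" .
  have "(\<Sum>k\<le>n. ?t k (n - k)) * (Poly_Mapping.single i u + Poly_Mapping.single j v)
      = (\<Sum>k\<le>Suc n. ?c (Q ^ (2 * (Suc n - k)) * qnum k + qnum (Suc n - k)) * ?t k (Suc n - k))"
    unfolding distrib_left 1 2 by (simp only: c_add distrib_right sum.distrib)
  also have "\<dots> = (\<Sum>k\<le>Suc n. ?c (qnum (Suc n)) * ?t k (Suc n - k))"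
  proof (rule sum.cong[OF refl])
    fix k
    assume "k \<in> {..Suc n}"
    then have "qnum (Suc n) = Q ^ (2 * (Suc n - k)) * qnum k + qnum (Suc n - k)"
      using qnum_add[of k "Suc n - k"] by simp
    then show "?c (Q ^ (2 * (Suc n - k)) * qnum k + qnum (Suc n - k)) * ?t k (Suc n - k)
        = ?c (qnum (Suc n)) * ?t k (Suc n - k)" by simp
  qed
  finally show ?case
    unfolding power_Suc2 Suc mult.assoc
    by (simp only: s_coeff_const_mult qfact_Suc flip: sum_distrib_left) (simp only: mult.commute)
qed

lemma line_sum_eq: "line_sum (a, b, e) = (\<Sum>k\<le>a. \<Sum>l\<le>b. if k + l = e then basis (k, l, a - k, b - l) else 0)"
proof -
  have "line_sum (a, b, e) = (\<Sum>(k, l) \<in> {p \<in> {..a} \<times> {..b}. fst p + snd p = e}. basis (k, l, a - k, b - l))"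
    unfolding line_sum_def
    by (rule sum.reindex_bij_witness[of _ "\<lambda>(k, l). (k, l, a - k, b - l)" "\<lambda>(A, B, C, D). (A, B)"]) auto
  also have "\<dots> = (\<Sum>p\<in>{..a} \<times> {..b}. if fst p + snd p = e then basis (fst p, snd p, a - fst p, b - snd p) else 0)"
    by (simp only: case_prod_unfold sum.inter_filter finite_cartesian_product finite_atMost)
  also have "\<dots> = (\<Sum>k\<le>a. \<Sum>l\<le>b. if k + l = e then basis (k, l, a - k, b - l) else 0)"
    by (simp add: sum.cartesian_product case_prod_unfold)
  finally show ?thesis .
qed

lemma lookup_power_product:
  "Poly_Mapping.lookup ((Poly_Mapping.single i (y I1 I1) + Poly_Mapping.single j (y I2 I1)) ^ a
      * (Poly_Mapping.single i (y I1 I2) + Poly_Mapping.single j (y I2 I2)) ^ b) n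
    = mink_scale (qfact a * qfact b) (\<Sum>k\<le>a. \<Sum>l\<le>b.
        if int (k + l) * i + int (a + b - (k + l)) * j = n then basis (k, l, a - k, b - l) else 0)"
proof -
  let ?c = "\<lambda>c. s_coeff (mink_const c)"
  let ?t1 = "divided_term (y I1 I1) (y I2 I1) i j" and ?t2 = "divided_term (y I1 I2) (y I2 I2) i j"
  have t: "?t1 k k' * ?t2 l l' = Poly_Mapping.single (int (k + l) * i + int (k' + l') * j) (basis (k, l, k', l'))" for k k' l l'
  proof -
    have "y I1 I1 ^ k * y I2 I1 ^ k' * (y I1 I2 ^ l * y I2 I2 ^ l')
        = y I1 I1 ^ k * (y I2 I1 ^ k' * y I1 I2 ^ l) * y I2 I2 ^ l'"
      by (simp add: mult.assoc)
    \<comment> \<open>This reordering factor is exactly the power of \<open>Q\<close> in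
      \<open>weight k l k' l'\<close>.\<close>
    also have "\<dots> = mink_scale (Q ^ (2 * k' * l)) (pbw k l k' l')"
      unfolding power_commute(5) by (simp add: pbw_def mult.assoc)
    finally have "y I1 I1 ^ k * y I2 I1 ^ k' * (y I1 I2 ^ l * y I2 I2 ^ l') = \<dots>" .
    then show ?thesis
      by (simp add: divided_term_def mult_single weight_def algebra_simps)
  qed
  have "(Poly_Mapping.single i (y I1 I1) + Poly_Mapping.single j (y I2 I1)) ^ a
      * (Poly_Mapping.single i (y I1 I2) + Poly_Mapping.single j (y I2 I2)) ^ b
    = (?c (qfact a) * (\<Sum>k\<le>a. ?t1 k (a - k))) * (?c (qfact b) * (\<Sum>l\<le>b. ?t2 l (b - l)))"
    by (simp only: q_binomial[OF y_commute(3)] q_binomial[OF y_commute(4)])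
  also have "\<dots> = ?c (qfact a) * ((\<Sum>k\<le>a. ?t1 k (a - k)) * ?c (qfact b)) * (\<Sum>l\<le>b. ?t2 l (b - l))"
    by (simp only: mult.assoc)
  also have "\<dots> = ?c (qfact a * qfact b) * ((\<Sum>k\<le>a. ?t1 k (a - k)) * (\<Sum>l\<le>b. ?t2 l (b - l)))"
    unfolding s_coeff_const_commute by (simp only: mult.assoc s_coeff_const_mult)
  also have "(\<Sum>k\<le>a. ?t1 k (a - k)) * (\<Sum>l\<le>b. ?t2 l (b - l))
      = (\<Sum>k\<le>a. \<Sum>l\<le>b. Poly_Mapping.single (int (k + l) * i + int (a + b - (k + l)) * j) (basis (k, l, a - k, b - l)))"
    unfolding sum_product t by (intro sum.cong refl) (auto simp: add.commute simp del: basis.simps)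
  also have "?c (qfact a * qfact b) * \<dots>
      = (\<Sum>k\<le>a. \<Sum>l\<le>b. Poly_Mapping.single (int (k + l) * i + int (a + b - (k + l)) * j)
          (mink_scale (qfact a * qfact b) (basis (k, l, a - k, b - l))))"
    by (simp only: sum_distrib_left s_coeff_const_single)
  finally show ?thesis
    by (simp add: lookup_sum lookup_single when_def mink.scale_sum_right if_distrib[of "mink_scale _"]
        del: basis.simps of_nat_add cong: if_cong)
qed

lemma lookup_power_product_range:
  assumes "i \<in> {0, 1}" "j = 1 - i" "n < 0 \<or> int (a + b) < n"
  shows "Poly_Mapping.lookup ((Poly_Mapping.single i (y I1 I1) + Poly_Mapping.single j (y I2 I1)) ^ a
      * (Poly_Mapping.single i (y I1 I2) + Poly_Mapping.single j (y I2 I2)) ^ b) n = 0"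
  unfolding lookup_power_product using assms
  by (auto intro!: sum.neutral simp del: basis.simps)

lemma twistor_power_unflipped:
  assumes "\<sigma> I1 = I1" "\<sigma> I2 = I2"
  shows "twistor_power a b = (Poly_Mapping.single 1 (y I1 I1) + Poly_Mapping.single 0 (y I2 I1)) ^ a
      * (Poly_Mapping.single 1 (y I1 I2) + Poly_Mapping.single 0 (y I2 I2)) ^ b"
  by (simp add: twistor_power_def s_coeff_def s_pow_def mult_single y_def assms)

text \<open>Here \<open>x11 s + x21\<close> is \<open>y22 s + y12\<close>, so the two factors come
  in the order opposite to that of \<open>lookup_power_product\<close>. They commute, the
  coefficient of \<open>s\<close> being settled by the mixed relation.\<close>

lemma twistor_power_flipped:
  assumes "\<sigma> I1 = I2" "\<sigma> I2 = I1"
  shows "twistor_power a b = (Poly_Mapping.single 0 (y I1 I1) + Poly_Mapping.single 1 (y I2 I1)) ^ b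
      * (Poly_Mapping.single 0 (y I1 I2) + Poly_Mapping.single 1 (y I2 I2)) ^ a"
proof -
  let ?L = "Poly_Mapping.single 0 (y I1 I2) + Poly_Mapping.single (1 :: int) (y I2 I2)"
  let ?M = "Poly_Mapping.single 0 (y I1 I1) + Poly_Mapping.single (1 :: int) (y I2 I1)"
  have "y I2 I1 * y I1 I2 + y I1 I1 * y I2 I2 = y I2 I2 * y I1 I1 + y I1 I2 * y I2 I1"
    by (simp add: y_commute(5,6) mink.scale_left_diff_distrib)
  then have "?L * ?M = ?M * ?L"
    by (simp add: distrib_left distrib_right mult_single y_commute(1,2) add.assoc add.left_commute
        flip: single_add)
      (simp add: add.commute)
  then have "?L ^ a * ?M ^ b = ?M ^ b * ?L ^ a"
    by (metis power_commuting_commutes)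
  then show ?thesis
    by (simp add: twistor_power_def s_coeff_def s_pow_def mult_single y_def assms add.commute)
qed

lemma lookup_twistor_power_range:
  assumes "n < 0 \<or> int (a + b) < n"
  shows "Poly_Mapping.lookup (twistor_power a b) n = 0"
proof (cases rule: chart_cases)
  case 1
  show ?thesis
    unfolding twistor_power_unflipped[OF 1(1,2)] using assms by (intro lookup_power_product_range) auto
next
  case 2
  show ?thesis
    unfolding twistor_power_flipped[OF 2(1,2)] using assms by (intro lookup_power_product_range) auto
qed

text \<open>In the flipped chart \<open>a\<close> and \<open>b\<close> change roles and
  \<open>s\<close> accompanies \<open>y21\<close> and \<open>y22\<close>, so the degree in
  \<open>s\<close> counts \<open>C + D\<close>, which is \<open>a + b - (A + B)\<close>.\<close>

definition line_flip :: "nat \<times> nat \<times> nat \<Rightarrow> nat \<times> nat \<times> nat" where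
  "line_flip k = (case k of (a, b, e) \<Rightarrow> if \<sigma> I1 = I1 then (a, b, e) else (b, a, a + b - e))"

lemma bij_line_flip: "bij_betw line_flip lines lines"
  by (rule bij_betw_byWitness[where f' = line_flip]) (auto simp: line_flip_def lines_def split: if_splits)

lemma lookup_twistor_power:
  assumes "(a, b, e) \<in> lines"
  shows "Poly_Mapping.lookup (twistor_power a b) (int e) = mink_scale (qfact a * qfact b) (line_sum (line_flip (a, b, e)))"
proof (cases rule: chart_cases)
  case 1
  show ?thesis
    unfolding twistor_power_unflipped[OF 1(1,2)] lookup_power_product
    by (simp add: line_flip_def 1(1) line_sum_eq del: of_nat_add basis.simps)
next
  case 2
  have eq: "int (k + l) * 0 + int (b + a - (k + l)) * 1 = int e \<longleftrightarrow> k + l = a + b - e"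
    if "k \<le> b" "l \<le> a" for k l
    using that assms by (auto simp: lines_def)
  have "(\<Sum>k\<le>b. \<Sum>l\<le>a. if int (k + l) * 0 + int (b + a - (k + l)) * 1 = int e then basis (k, l, b - k, a - l) else 0)
      = line_sum (b, a, a + b - e)"
    unfolding line_sum_eq by (intro sum.cong refl if_cong eq) auto
  then show ?thesis
    unfolding twistor_power_flipped[OF 2(1,2)] lookup_power_product
    by (simp add: line_flip_def 2(1) mult.commute)
qed

end

section \<open>The isomorphism\<close>

lemma chart_exists:
  assumes "p \<in> {q, inverse q}"
  obtains \<sigma> Q where "chart \<sigma> Q" "p = inverse Q"
proof (cases "p = q")
  case True
  then show ?thesis using that[of flip "inverse q"] by (simp add: chart_def)
next
  case False
  then show ?thesis using that[of id q] assms by (simp add: chart_def)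
qed

lemma lookup_mult_s_pow: "Poly_Mapping.lookup (F * s_pow i) n = Poly_Mapping.lookup F (n - i)"
proof (induction F rule: poly_mapping_single_induct)
  case (single k c)
  show ?case by (auto simp: s_pow_def mult_single lookup_single when_def)
qed (simp_all add: distrib_right lookup_add)

lemma lookup_s_coeff_const_mult:
  "Poly_Mapping.lookup (s_coeff (mink_const c) * F) n = mink_scale c (Poly_Mapping.lookup F n)"
proof (induction F rule: poly_mapping_single_induct)
  case (single k f)
  show ?case by (auto simp: s_coeff_const_single lookup_single when_def)
qed (simp_all add: distrib_left lookup_add mink.scale_right_distrib)

definition monomial_integral :: "nat \<Rightarrow> nat \<Rightarrow> int \<Rightarrow> qmink" where
  "monomial_integral a b i = Poly_Mapping.lookup (twistor_power a b) (- 1 - i)"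

lemma twistor_integral_eq:
  "twistor_integral f = pm_extend (\<lambda>(a, b, i, j) c. mink_scale (cq_of_complex c) (monomial_integral a b i)) f"
  by (simp add: twistor_integral_def twistor_eval_def pm_extend_def lookup_sum case_prod_unfold
      lookup_mult_s_pow lookup_s_coeff_const_mult monomial_integral_def twistor_power_def mult.assoc)
    (simp add: lookup_mult_s_pow lookup_s_coeff_const_mult flip: mult.assoc)

lemma twistor_integral_add: "twistor_integral (f + g) = twistor_integral f + twistor_integral g"
  unfolding twistor_integral_eq
  by (rule pm_extend_add) (auto simp: cq_of_complex_add mink.scale_left_distrib)

lemma twistor_integral_diff: "twistor_integral (f - g) = twistor_integral f - twistor_integral g"
  using twistor_integral_add[of "f - g" g] by simp

lemma twistor_integral_single:
  "twistor_integral (Poly_Mapping.single (a, b, i, j) c) = mink_scale (cq_of_complex c) (monomial_integral a b i)"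
  unfolding twistor_integral_eq by (subst pm_extend_single) auto

lemma laurent_scale_single: "laurent_scale c (Poly_Mapping.single k d) = Poly_Mapping.single k (c * d)"
  by (rule poly_mapping_eqI) (simp add: lookup_single when_def)

lemma twistor_integral_scale: "twistor_integral (laurent_scale c f) = mink_scale (cq_of_complex c) (twistor_integral f)"
proof (induction f rule: poly_mapping_single_induct)
  case zero
  show ?case by (simp add: twistor_integral_eq)
next
  case (single k d)
  obtain a b i j where "k = (a, b, i, j)" by (cases k)
  then show ?case by (simp add: laurent_scale_single twistor_integral_single cq_of_complex_mult)
next
  case (add f g)
  then show ?case
    by (simp add: laurent.scale_right_distrib twistor_integral_add mink.scale_right_distrib)
qed

lemma monomial_integral_0: "0 \<le> i \<or> i < - 1 - int (a + b) \<Longrightarrow> monomial_integral a b i = 0"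
proof -
  \<comment> \<open>The integral does not involve \<open>p\<close>, so either chart can be used to
    compute it.\<close>
  interpret chart id q by (simp add: chart_def)
  assume "0 \<le> i \<or> i < - 1 - int (a + b)"
  then show ?thesis
    unfolding monomial_integral_def by (intro lookup_twistor_power_range) auto
qed

text \<open>On sections over \<open>w \<noteq> 0\<close> one has \<open>i \<ge> 0\<close>; over
  \<open>z \<noteq> 0\<close>, \<open>j \<ge> 0\<close> and total degree \<open>-2\<close> force
  \<open>i < -1 - (a + b)\<close>. Either way the required exponent \<open>-1 - i\<close> of
  \<open>s\<close> lies outside the range from \<open>0\<close> to \<open>a + b\<close>.\<close>

lemma twistor_integral_coboundary: "f \<in> coboundaries (- 2) \<Longrightarrow> twistor_integral f = 0"
proof -
  have "twistor_integral g = 0" if "g \<in> sections_z (- 2) \<or> g \<in> sections_w (- 2)" for g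
  proof -
    have "monomial_integral a b i = 0" if "(a, b, i, j) \<in> Poly_Mapping.keys g" for a b i j
      using \<open>g \<in> _ \<or> _\<close> that
      by (intro monomial_integral_0) (fastforce simp: sections_z_def sections_w_def sections_zw_def)
    then show ?thesis
      unfolding twistor_integral_eq pm_extend_def by (intro sum.neutral) fastforce
  qed
  moreover assume "f \<in> coboundaries (- 2)"
  ultimately show ?thesis
    by (auto simp: coboundaries_def twistor_integral_diff)
qed

section \<open>Descent to cohomology and extension of scalars\<close>

lift_definition cech_integral :: "cech_H1 \<Rightarrow> qmink" is twistor_integral
  using twistor_integral_coboundary by (fastforce simp: cech_eq_def twistor_integral_diff)

lemma cech_integral_add: "cech_integral (u + v) = cech_integral u + cech_integral v"
  by transfer (rule twistor_integral_add)

lemma cech_integral_scale: "cech_integral (H1_scale c u) = mink_scale (cq_of_complex c) (cech_integral u)"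
  by transfer (rule twistor_integral_scale)

lemma cech_integral_class: "f \<in> sections_zw (- 2) \<Longrightarrow> cech_integral (cohomology_class f) = twistor_integral f"
  by (simp add: cech_integral.abs_eq cech_eq_refl)

definition free_integral :: "((cech_H1 \<times> cq) \<Rightarrow>\<^sub>0 int) \<Rightarrow> qmink" where
  "free_integral = pm_extend (\<lambda>(u, c) n. of_int n * mink_scale c (cech_integral u))"

lemma free_integral_diff: "free_integral (s - t) = free_integral s - free_integral t"
  unfolding free_integral_def
  by (rule pm_extend_diff) (auto simp: distrib_right mink.scale_right_distrib)

lemma free_integral_0: "free_integral 0 = 0"
  by (simp add: free_integral_def)

lemma free_integral_frag: "free_integral (frag_of (u, c)) = mink_scale c (cech_integral u)"
  unfolding free_integral_def by (subst pm_extend_single) auto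

lemma free_integral_cong: "tensor_eq s t \<Longrightarrow> free_integral s = free_integral t"
proof -
  have rel: "free_integral s = 0" if "s \<in> tensor_relators" for s
    using that
    by (auto simp: tensor_relators_def free_integral_diff free_integral_frag cech_integral_add
        cech_integral_scale mink.scale_right_distrib mink.scale_left_distrib mult.commute)
  have "free_integral s = 0" if "s \<in> subgroup_gen tensor_relators" for s
    using that
    by (induction rule: subgroup_gen.induct) (simp_all add: rel free_integral_diff free_integral_0)
  moreover assume "tensor_eq s t"
  ultimately show ?thesis
    unfolding tensor_eq_def by (metis eq_iff_diff_eq_0 free_integral_diff)
qed

lift_definition H1q_integral :: "cech_H1q \<Rightarrow> qmink" is free_integral
  by (rule free_integral_cong)

lemma H1q_integral_tensor: "H1q_integral (u \<otimes>\<^sub>q c) = mink_scale c (cech_integral u)"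
  by transfer (rule free_integral_frag)

lemma H1q_integral_diff: "H1q_integral (x - y) = H1q_integral x - H1q_integral y"
  by transfer (rule free_integral_diff)

lemma H1q_integral_0: "H1q_integral 0 = 0"
  using H1q_integral_diff[of 0 0] by simp

lemma linear_H1q_integral: "Vector_Spaces.linear H1q_scale mink_scale H1q_integral"
proof -
  have "H1q_integral (x + y) = H1q_integral x + H1q_integral y" for x y
    using H1q_integral_diff[of "x + y" y] by simp
  moreover have "H1q_integral (H1q_scale c x) = mink_scale c (H1q_integral x)" for c x
    by (induction x rule: cech_H1q_induct)
      (simp_all add: H1q_scale_0 H1q_integral_0 H1q_scale_tensor H1q_integral_tensor H1q_scale_diff
        H1q_integral_diff mink.scale_right_diff_distrib)
  ultimately show ?thesis
    by (intro Vector_Spaces.linear.intro module_hom.intro module_hom_axioms.intro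
        H1q.vector_space_axioms mink.vector_space_axioms H1q.module_axioms mink.module_axioms)
qed

lemma tensor_add_left: "(u + v) \<otimes>\<^sub>q c = u \<otimes>\<^sub>q c + v \<otimes>\<^sub>q c"
proof transfer
  fix u v c
  have "frag_of (u + v, c) - frag_of (u, c) - frag_of (v, c) \<in> tensor_relators"
    unfolding tensor_relators_def by blast
  then show "tensor_eq (frag_of (u + v, c)) (frag_of (u, c) + frag_of (v, c))"
    unfolding tensor_eq_def by (simp add: diff_diff_eq subgroup_gen.base)
qed

lemma tensor_scale_left: "H1_scale \<alpha> u \<otimes>\<^sub>q c = u \<otimes>\<^sub>q (cq_of_complex \<alpha> * c)"
proof transfer
  fix \<alpha> u c
  have "frag_of (H1_scale \<alpha> u, c) - frag_of (u, cq_of_complex \<alpha> * c) \<in> tensor_relators"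
    unfolding tensor_relators_def by blast
  then show "tensor_eq (frag_of (H1_scale \<alpha> u, c)) (frag_of (u, cq_of_complex \<alpha> * c))"
    unfolding tensor_eq_def by (rule subgroup_gen.base)
qed

lemma tensor_0_left: "0 \<otimes>\<^sub>q c = 0"
  using tensor_add_left[of 0 0 c] by simp

section \<open>Monomial classes span the cohomology\<close>

fun line_class :: "nat \<times> nat \<times> nat \<Rightarrow> cech_H1q" where
  "line_class (a, b, e) =
    cohomology_class (Poly_Mapping.single (a, b, - 1 - int e, int e - 1 - int (a + b)) 1) \<otimes>\<^sub>q 1"

lemma class_add:
  assumes "f \<in> sections_zw (- 2)" "g \<in> sections_zw (- 2)"
  shows "cohomology_class (f + g) = cohomology_class f + cohomology_class g"
  using assms by (simp add: plus_cech_H1.abs_eq cech_eq_refl)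

lemma single_sections_zw: "int a + int b + i + j = n \<Longrightarrow> Poly_Mapping.single (a, b, i, j) c \<in> sections_zw n"
  by (simp add: sections_zw_def)

text \<open>If \<open>i\<close> and \<open>j\<close> are both negative, the monomial belongs to the
  line with \<open>e = -1 - i\<close>. Otherwise it is regular on one of the two opens and hence a
  coboundary.\<close>

lemma class_single_in_span:
  assumes deg: "int a + int b + i + j = - 2"
  shows "cohomology_class (Poly_Mapping.single (a, b, i, j) c) \<otimes>\<^sub>q 1 \<in> H1q.span (line_class ` lines)"
proof (cases "i < 0 \<and> j < 0")
  case True
  define e where "e = nat (- 1 - i)"
  have ij: "i = - 1 - int e" "j = int e - 1 - int (a + b)" "(a, b, e) \<in> lines"
    using True deg by (auto simp: e_def lines_def)
  let ?f = "Poly_Mapping.single (a, b, i, j) 1 :: laurent"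
  have "cohomology_class (Poly_Mapping.single (a, b, i, j) c) = H1_scale c (cohomology_class ?f)"
    using single_sections_zw[OF deg]
    by (simp add: H1_scale.abs_eq cech_eq_refl laurent_scale_single)
  then have "cohomology_class (Poly_Mapping.single (a, b, i, j) c) \<otimes>\<^sub>q 1
      = H1q_scale (cq_of_complex c) (cohomology_class ?f \<otimes>\<^sub>q 1)"
    by (simp add: tensor_scale_left H1q_scale_tensor)
  also have "cohomology_class ?f \<otimes>\<^sub>q 1 = line_class (a, b, e)"
    by (simp add: ij)
  also have "H1q_scale (cq_of_complex c) (line_class (a, b, e)) \<in> H1q.span (line_class ` lines)"
    using ij(3) by (intro H1q.span_scale H1q.span_base imageI)
  finally show ?thesis .
next
  case False
  let ?f = "Poly_Mapping.single (a, b, i, j) c :: laurent"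
  have "?f \<in> sections_w (- 2) \<or> ?f \<in> sections_z (- 2)"
    using False deg by (auto simp: sections_w_def sections_z_def sections_zw_def)
  moreover have "?f \<in> coboundaries (- 2)" if "?f \<in> sections_w (- 2)"
    using that laurent.subspace_0[OF subspace_sections_z[of "- 2"]] unfolding coboundaries_def
    by (intro CollectI exI[of _ 0] exI[of _ ?f]) simp
  moreover have "?f \<in> coboundaries (- 2)" if "?f \<in> sections_z (- 2)"
    using laurent.subspace_neg[OF subspace_sections_z that] laurent.subspace_0[OF subspace_sections_w[of "- 2"]]
    unfolding coboundaries_def by (intro CollectI exI[of _ "- ?f"] exI[of _ 0]) simp
  ultimately have "cech_eq ?f 0"
    using single_sections_zw[OF deg] laurent.subspace_0[OF subspace_sections_zw]
    by (auto simp: cech_eq_def)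
  then have "cohomology_class ?f = 0"
    by (simp add: zero_cech_H1_def Quotient3_rel_abs[OF Quotient3_cech_H1])
  then show ?thesis by (simp add: tensor_0_left H1q.span_zero)
qed

lemma span_line_class: "x \<in> H1q.span (line_class ` lines)"
proof (induction x rule: cech_H1q_induct)
  case zero
  show ?case by (rule H1q.span_zero)
next
  case (diff x y)
  then show ?case by (rule H1q.span_diff)
next
  case (tensor u c)
  obtain f where f: "f \<in> sections_zw (- 2)" "u = cohomology_class f"
    by (induct u) (auto simp: cech_eq_def)
  \<comment> \<open>Membership in degree \<open>-2\<close> is carried along because
    \<open>class_add\<close> requires it of both summands.\<close>
  have partial_sum: "(\<Sum>k\<in>K. Poly_Mapping.single k (Poly_Mapping.lookup f k)) \<in> sections_zw (- 2) \<and>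
      cohomology_class (\<Sum>k\<in>K. Poly_Mapping.single k (Poly_Mapping.lookup f k)) \<otimes>\<^sub>q 1 \<in> H1q.span (line_class ` lines)"
    if "finite K" "K \<subseteq> Poly_Mapping.keys f" for K
    using that
  proof (induction K rule: finite_induct)
    case empty
    show ?case
      by (simp add: laurent.subspace_0 subspace_sections_zw tensor_0_left H1q.span_zero flip: zero_cech_H1_def)
  next
    case (insert k K)
    obtain a b i j where k: "k = (a, b, i, j)" by (cases k)
    then have deg: "int a + int b + i + j = - 2"
      using insert.prems f(1) by (auto simp: sections_zw_def)
    show ?case
      using insert single_sections_zw[OF deg] class_single_in_span[OF deg] k
      by (simp add: class_add tensor_add_left H1q.span_add laurent.subspace_add[OF subspace_sections_zw])
  qed
  have "(\<Sum>k\<in>Poly_Mapping.keys f. Poly_Mapping.single k (Poly_Mapping.lookup f k)) = f"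
    by (rule poly_mapping_eqI)
      (auto simp: lookup_sum lookup_single when_def sum.delta in_keys_iff)
  then have "u \<otimes>\<^sub>q 1 \<in> H1q.span (line_class ` lines)"
    using partial_sum[OF finite_keys order_refl] f(2) by simp
  then have "H1q_scale c (u \<otimes>\<^sub>q 1) \<in> H1q.span (line_class ` lines)"
    by (rule H1q.span_scale)
  then show ?case by (simp add: H1q_scale_tensor)
qed

lemma H1q_integral_line_class:
  "H1q_integral (line_class (a, b, e)) = Poly_Mapping.lookup (twistor_power a b) (int e)"
  by (simp add: H1q_integral_tensor cech_integral_class single_sections_zw twistor_integral_single
      monomial_integral_def)

text \<open>The classes in \<open>line_class\<close> span, and their images are pairwise distinct
  and form a basis of the kernel. A linear map with this property is injective on the span and maps
  it onto the kernel.\<close>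

lemma bij_betw_H1q_integral:
  assumes "p \<in> {q, inverse q}"
  shows "bij_betw H1q_integral UNIV {f. quantum_laplacian p f = 0}"
proof -
  obtain \<sigma> Q where "chart \<sigma> Q" and p: "p = inverse Q"
    using assms by (rule chart_exists)
  then interpret chart \<sigma> Q by simp
  interpret integral: Vector_Spaces.linear H1q_scale mink_scale H1q_integral
    by (rule linear_H1q_integral)
  have "H1q_integral (line_class k) = mink_scale (qfact (fst k) * qfact (fst (snd k))) (line_sum (line_flip k))"
    if "k \<in> lines" for k
    using that H1q_integral_line_class lookup_twistor_power by (cases k) (simp del: line_class.simps)
  then have G: "inj_on (\<lambda>k. H1q_integral (line_class k)) lines"
    "mink.independent ((\<lambda>k. H1q_integral (line_class k)) ` lines)"
    "mink.span ((\<lambda>k. H1q_integral (line_class k)) ` lines) = {f. laplacian f = 0}"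
    by (rule ker_laplacian_basis[OF _ _ bij_line_flip]; simp)+
  have UNIV: "H1q.span (line_class ` lines) = UNIV"
    using span_line_class by blast
  have "inj_on H1q_integral (line_class ` lines)"
    using G(1) by (auto simp: inj_on_def)
  then have "inj_on H1q_integral UNIV"
    using integral.inj_on_span_independent_image[of "line_class ` lines"] G(2) UNIV
    by (simp add: image_image)
  moreover have "range H1q_integral = {f. laplacian f = 0}"
    using integral.span_image[of "line_class ` lines"] G(3) UNIV by (simp add: image_image)
  ultimately show ?thesis
    by (simp add: bij_betw_def laplacian_def p)
qed

text \<open>The four exponents add up to \<open>-2\<close>; the bounds on \<open>m\<close> make the
  first two nonnegative, so that \<open>nat\<close> does not truncate them.\<close>

lemma basis_monomials_sections: "basis_monomials \<subseteq> sections_zw (- 2)"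
proof
  fix f
  assume "f \<in> basis_monomials"
  then obtain l m n :: rat where f: "f = Poly_Mapping.single
        (nat \<lfloor>l - m\<rfloor>, nat \<lfloor>l + m\<rfloor>, - \<lfloor>l - n + 1\<rfloor>, - \<lfloor>l + n + 1\<rfloor>) 1"
    and l: "2 * l \<in> \<nat>" and bounds: "- l \<le> m" "m \<le> l" and ints: "n - l \<in> \<int>" "m - l \<in> \<int>"
    unfolding basis_monomials_def by blast
  obtain N where N: "2 * l = of_int N"
    using l by (metis Nats_cases of_int_of_nat_eq)
  obtain u v where u: "m - l = of_int u" and v: "n - l = of_int v"
    using ints by (metis Ints_cases)
  have eqs: "l - m = of_int (- u)" "l + m = of_int (N + u)" "l - n = of_int (- v)" "l + n = of_int (N + v)"
    using N u v by (simp_all add: algebra_simps)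
  have "(of_int 0 :: rat) \<le> of_int (- u)" "(of_int 0 :: rat) \<le> of_int (N + u)"
    unfolding eqs(1,2)[symmetric] using bounds by simp_all
  then have "0 \<le> - u" "0 \<le> N + u"
    by (simp_all only: of_int_le_iff)
  then show "f \<in> sections_zw (- 2)"
    unfolding f eqs by (intro single_sections_zw) simp
qed

theorem proposition30:
  fixes p :: cq
  assumes "p \<in> {q, inverse q}"
  shows "\<exists>\<Phi> :: cech_H1q \<Rightarrow> qmink.
    Vector_Spaces.linear H1q_scale mink_scale \<Phi> \<and>
    bij_betw \<Phi> UNIV {f. quantum_laplacian p f = 0} \<and>
    (\<forall>f \<in> laurent.span basis_monomials.
       \<Phi> (cohomology_class f \<otimes>\<^sub>q 1) = twistor_integral f)"
proof (intro exI conjI ballI)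
  show "Vector_Spaces.linear H1q_scale mink_scale H1q_integral"
    by (rule linear_H1q_integral)
  show "bij_betw H1q_integral UNIV {f. quantum_laplacian p f = 0}"
    using assms by (rule bij_betw_H1q_integral)
  fix f
  assume "f \<in> laurent.span basis_monomials"
  then have "f \<in> sections_zw (- 2)"
    using laurent.span_minimal[OF basis_monomials_sections subspace_sections_zw] by blast
  then show "H1q_integral (cohomology_class f \<otimes>\<^sub>q 1) = twistor_integral f"
    by (simp add: H1q_integral_tensor cech_integral_class)
qed

end
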